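(* Let $\mathcal{T}^{A_1A_2\to B}$ be a completely positive trace non-increasing superoperator, with Choi state \[ \tau^{A'_1A'_2B}:=(\mathcal{T}^{A_1A_2\to B}\otimes\mathbb{I}^{A'_1A'_2})(\Phi^{A'_1A_1}\otimes\Phi^{A'_2A_2}). \] Let $\rho^{A_1A_2R}$ be a subnormalised density matrix. For unitary matrices $U^{A_1}$, $U^{A_2}$ on their respective Hilbert spaces, define the unitarily perturbed state \[ \sigma^{BR}(U^{A_1},U^{A_2}):=(\mathcal{T}\otimes\mathbb{I}^R)\big((U^{A_1}\otimes U^{A_2}\otimes 1^R)\,\rho^{A_1A_2R}\,(U^{A_1}\otimes U^{A_2}\otimes 1^R)^\dagger\big). \] Define \[ D_1:=(1-|A_1|^{-2})^{-1/2},\quad D_2:=(1-|A_2|^{-2})^{-1/2},\quad D_{1,2}:=2(1-|A_1|^{-2})^{-1/2}(1-|A_2|^{-2})^{-1/2}. \] Let $0<\epsilon<1$. Then \begin{align*} &\mathbb{E}_{U^{A_1},U^{A_2}}\big[\|\sigma^{BR}(U^{A_1},U^{A_2})-\tau^B\otimes\rho^R\|_1\big]\\ &\quad\le 16\epsilon+2D_1\cdot2^{-\frac12H_2^\epsilon(A_1|R)_\rho-\frac12H_2^\epsilon(A'_1|B)_\tau}+2D_2\cdot2^{-\frac12H_2^\epsilon(A_2|R)_\rho-\frac12H_2^\epsilon(A'_2|B)_\tau}\\ &\qquad+4D_{1,2}\cdot2^{-\frac12H_2^\epsilon(A_1A_2|R)_\rho-\frac12H_2^\epsilon(A'_1A'_2|B)_\tau},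 \end{align*} where the expectation is over independent choices of $U^{A_1}$, $U^{A_2}$ from their respective Haar measures.
   Context: All Hilbert spaces are finite dimensional; $|A|$ denotes the dimension of $A$ (with $|A_1|,|A_2|\ge2$ so that $D_1,D_2,D_{1,2}$ are defined); logarithms are base 2. $\mathbb{I}$ is the identity superoperator, $1^R$ the identity matrix. A subnormalised density matrix is a positive semidefinite matrix of trace at most one. $A'$ is a Hilbert space of the same dimension as $A$, and the EPR state is $\Phi^{A'A}:=|A|^{-1}\sum_{a_1,a_2=1}^{|A|}|a_1,a_1\rangle\langle a_2,a_2|^{A'A}$. Marginals ($\rho^R$, $\tau^B$, $\rho^{A_1R}$, $\tau^{A_1'B}$, etc.) are partial traces. $\|\cdot\|_p$ is the Schatten-$\ell_p$ norm; negative powers of positive semidefinite matrices are taken on the support. For a subnormalised density matrix $\alpha$ and a positive semidefinite $\beta$ on the same space, the Rényi-2 divergence is $D_2(\alpha\|\beta):=2\log\|\beta^{-1/4}\alpha\beta^{-1/4}\|_2$ if $\mathrm{supp}(\alpha)\subseteq\mathrm{supp}(\beta)$, and $+\infty$ otherwise (this divergence is not to be confused with the number $D_2$ in the claim). For $0<\epsilon<1$, $D_2^\epsilon(\alpha\|\beta):=\min_{\alpha'}D_2(\alpha'\|\beta)$ over all subnormalised density matrices $\alpha'$ with $\|\alpha'-\alpha\|_1\le\epsilon\,(\mathrm{Tr}\,\alpha)$. The smooth conditional Rényi-2 entropy is $H_2^\epsilon(A|R)_\rho:=-D_2^\epsilon(\rho^{AR}\|1^A\otimes\rho^R)$. *)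

theory Defs
  imports "HOL-Probability.Probability"
begin

text \<open>
  A Hilbert space of dimension \<open>n\<close> is \<open>complex^'n\<close> with its standard basis indexed by a finite
  type of cardinality \<open>n\<close>; tensor products of spaces are indexed by product types.
\<close>

type_synonym 'n cmat = "complex^'n^'n"

section \<open>Matrices\<close>

definition cdot :: "complex^'n::finite \<Rightarrow> complex^'n \<Rightarrow> complex" where
  "cdot v w = (\<Sum>i\<in>UNIV. cnj (v $ i) * w $ i)"

definition dagger :: "'n::finite cmat \<Rightarrow> 'n cmat" where
  "dagger X = (\<chi> i j. cnj (X $ j $ i))"

definition cscale :: "complex \<Rightarrow> 'n::finite cmat \<Rightarrow> 'n cmat" where
  "cscale c X = (\<chi> i j. c * X $ i $ j)"

definition unitary :: "'n::finite cmat \<Rightarrow> bool" where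
  "unitary U \<longleftrightarrow> dagger U ** U = mat 1 \<and> U ** dagger U = mat 1"

definition psd :: "'n::finite cmat \<Rightarrow> bool" where
  "psd X \<longleftrightarrow> dagger X = X \<and> (\<forall>v. 0 \<le> Re (cdot v (X *v v)))"

text \<open>The trace of a positive semidefinite matrix is real, so taking its real part loses nothing.\<close>

definition subnormalised :: "'n::finite cmat \<Rightarrow> bool" where
  "subnormalised X \<longleftrightarrow> psd X \<and> Re (trace X) \<le> 1"

definition supp :: "'n::finite cmat \<Rightarrow> (complex^'n) set" where
  "supp X = {v. \<forall>w. X *v w = 0 \<longrightarrow> cdot w v = 0}"

definition diag :: "('n::finite \<Rightarrow> real) \<Rightarrow> 'n cmat" where
  "diag d = (\<chi> i j. if i = j then complex_of_real (d i) else 0)"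

text \<open>
  Real powers of a positive semidefinite matrix, taken on the support: since \<open>0 powr s = 0\<close> for
  every \<open>s\<close>, also for negative ones, zero eigenvalues stay zero. The resulting matrix does not
  depend on the chosen eigendecomposition.
\<close>

definition mpow :: "'n::finite cmat \<Rightarrow> real \<Rightarrow> 'n cmat" where
  "mpow X s = (THE Y. \<exists>U d. unitary U \<and> (\<forall>i. 0 \<le> d i) \<and>
      X = U ** diag d ** dagger U \<and> Y = U ** diag (\<lambda>i. d i powr s) ** dagger U)"

text \<open>\<open>\<parallel>X\<parallel>\<^sub>p = (Tr |X|\<^sup>p)\<^bsup>1/p\<^esup>\<close> where \<open>|X| = (X\<^sup>\<dagger> X)\<^bsup>1/2\<^esup>\<close>.\<close>

definition schatten :: "real \<Rightarrow> 'n::finite cmat \<Rightarrow> real" where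
  "schatten p X = Re (trace (mpow (dagger X ** X) (p / 2))) powr (1 / p)"

section \<open>Tensor products and partial traces\<close>

definition kron :: "'m::finite cmat \<Rightarrow> 'n::finite cmat \<Rightarrow> ('m \<times> 'n) cmat" where
  "kron X Y = (\<chi> i j. X $ fst i $ fst j * Y $ snd i $ snd j)"

text \<open>Reordering of tensor factors, when \<open>f\<close> permutes the components of a product index.\<close>

definition relabel :: "('m::finite \<Rightarrow> 'n::finite) \<Rightarrow> 'n cmat \<Rightarrow> 'm cmat" where
  "relabel f X = (\<chi> i j. X $ f i $ f j)"

definition trace_out_fst :: "('m::finite \<times> 'n::finite) cmat \<Rightarrow> 'n cmat" where
  "trace_out_fst X = (\<chi> i j. \<Sum>k\<in>UNIV. X $ (k, i) $ (k, j))"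

definition trace_out_snd :: "('m::finite \<times> 'n::finite) cmat \<Rightarrow> 'm cmat" where
  "trace_out_snd X = (\<chi> i j. \<Sum>k\<in>UNIV. X $ (i, k) $ (j, k))"

text \<open>Marginals of a state on \<open>A\<^sub>1A\<^sub>2C\<close> on the systems \<open>A\<^sub>1C\<close> and \<open>A\<^sub>2C\<close>.\<close>

definition marginal1 ::
  "(('a1::finite \<times> 'a2::finite) \<times> 'c::finite) cmat \<Rightarrow> ('a1 \<times> 'c) cmat" where
  "marginal1 X = trace_out_snd (relabel (\<lambda>((a1, c), a2). ((a1, a2), c)) X)"

definition marginal2 ::
  "(('a1::finite \<times> 'a2::finite) \<times> 'c::finite) cmat \<Rightarrow> ('a2 \<times> 'c) cmat" where
  "marginal2 X = trace_out_snd (relabel (\<lambda>((a2, c), a1). ((a1, a2), c)) X)"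

section \<open>Superoperators\<close>

definition superoperator :: "('a::finite cmat \<Rightarrow> 'b::finite cmat) \<Rightarrow> bool" where
  "superoperator T \<longleftrightarrow> (\<forall>X Y. T (X + Y) = T X + T Y) \<and> (\<forall>c X. T (cscale c X) = cscale c (T X))"

text \<open>
  The superoperator \<open>T \<otimes> \<I>\<^sup>R\<close>: \<open>T\<close> is applied to each of the blocks of \<open>X\<close> indexed by a pair of
  basis elements of \<open>R\<close>.
\<close>

definition tensor_id :: "('a::finite cmat \<Rightarrow> 'b::finite cmat) \<Rightarrow>
    ('a \<times> 'r::finite) cmat \<Rightarrow> ('b \<times> 'r) cmat" where
  "tensor_id T X = (\<chi> i j. T (\<chi> a a'. X $ (a, snd i) $ (a', snd j)) $ fst i $ fst j)"

text \<open>
  Complete positivity is positivity of \<open>T \<otimes> \<I>\<close> for ancillas of every dimension \<open>n\<close>. As \<open>n\<close> is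
  quantified inside the definition, a matrix on \<open>A \<otimes> \<complex>\<^sup>n\<close> is represented by its blocks
  \<open>X j k\<close>, \<open>j, k < n\<close>, and a vector of \<open>A \<otimes> \<complex>\<^sup>n\<close> by its components \<open>v j\<close>, \<open>j < n\<close>.
\<close>

definition block_psd :: "nat \<Rightarrow> (nat \<Rightarrow> nat \<Rightarrow> 'a::finite cmat) \<Rightarrow> bool" where
  "block_psd n X \<longleftrightarrow> (\<forall>j<n. \<forall>k<n. dagger (X k j) = X j k) \<and>
     (\<forall>v. 0 \<le> Re (\<Sum>j<n. \<Sum>k<n. cdot (v j) (X j k *v v k)))"

definition completely_positive :: "('a::finite cmat \<Rightarrow> 'b::finite cmat) \<Rightarrow> bool" where
  "completely_positive T \<longleftrightarrow> (\<forall>n X. block_psd n X \<longrightarrow> block_psd n (\<lambda>j k. T (X j k)))"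

definition trace_nonincreasing :: "('a::finite cmat \<Rightarrow> 'b::finite cmat) \<Rightarrow> bool" where
  "trace_nonincreasing T \<longleftrightarrow> (\<forall>X. psd X \<longrightarrow> Re (trace (T X)) \<le> Re (trace X))"

text \<open>Every finite type can serve as the index set of the ancilla.\<close>

lemma sum_prod_UNIV:
  fixes f :: "'a::finite \<times> 'b::finite \<Rightarrow> 'c::comm_monoid_add"
  shows "(\<Sum>i\<in>UNIV. f i) = (\<Sum>b\<in>UNIV. \<Sum>a\<in>UNIV. f (a, b))"
proof -
  have "(\<Sum>i\<in>UNIV. f i) = (\<Sum>a\<in>UNIV. \<Sum>b\<in>UNIV. f (a, b))"
    by (simp add: sum.cartesian_product flip: UNIV_Times_UNIV)
  also have "\<dots> = (\<Sum>b\<in>UNIV. \<Sum>a\<in>UNIV. f (a, b))"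
    by (rule sum.swap)
  finally show ?thesis .
qed

lemma psd_iff_block_psd:
  fixes X :: "('a::finite \<times> 'r::finite) cmat" and h :: "nat \<Rightarrow> 'r"
  assumes h: "bij_betw h {..<n} UNIV"
  shows "psd X \<longleftrightarrow> block_psd n (\<lambda>j k. \<chi> a a'. X $ (a, h j) $ (a', h k))"
proof -
  let ?B = "\<lambda>j k. (\<chi> a a'. X $ (a, h j) $ (a', h k)) :: 'a cmat"
  have quad: "cdot v (X *v v) = (\<Sum>j<n. \<Sum>k<n. cdot (\<chi> a. v $ (a, h j)) (?B j k *v (\<chi> a. v $ (a, h k))))"
    for v
  proof -
    have "cdot v (X *v v) = (\<Sum>r\<in>UNIV. \<Sum>a\<in>UNIV. \<Sum>s\<in>UNIV. \<Sum>b\<in>UNIV.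
        cnj (v $ (a, r)) * (X $ (a, r) $ (b, s) * v $ (b, s)))"
      by (simp add: cdot_def matrix_vector_mult_def sum_prod_UNIV sum_distrib_left)
    also have "\<dots> = (\<Sum>r\<in>UNIV. \<Sum>s\<in>UNIV. \<Sum>a\<in>UNIV. \<Sum>b\<in>UNIV.
        cnj (v $ (a, r)) * (X $ (a, r) $ (b, s) * v $ (b, s)))"
      by (rule sum.cong[OF refl], rule sum.swap)
    also have "\<dots> = (\<Sum>j<n. \<Sum>k<n. \<Sum>a\<in>UNIV. \<Sum>b\<in>UNIV.
        cnj (v $ (a, h j)) * (X $ (a, h j) $ (b, h k) * v $ (b, h k)))"
      by (simp add: sum.reindex_bij_betw[OF h, symmetric])
    finally show ?thesis
      by (simp add: cdot_def matrix_vector_mult_def sum_distrib_left)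
  qed
  define g where "g = the_inv_into {..<n} h"
  have gh: "g (h j) = j" if "j < n" for j
    using h that by (simp add: g_def bij_betw_def the_inv_into_f_f)
  have hg: "h (g r) = r" "g r < n" for r
    using h f_the_inv_into_f[of h "{..<n}" r] the_inv_into_into[of h "{..<n}" r]
    by (auto simp: g_def bij_betw_def)
  have herm: "dagger X = X \<longleftrightarrow> (\<forall>j<n. \<forall>k<n. dagger (?B k j) = ?B j k)"
  proof
    assume X: "dagger X = X"
    have *: "cnj (X $ i $ j) = X $ j $ i" for i j
      using arg_cong[OF X, of "\<lambda>Y. Y $ j $ i"] by (simp add: dagger_def)
    show "\<forall>j<n. \<forall>k<n. dagger (?B k j) = ?B j k"
      unfolding dagger_def vec_eq_iff by (simp add: *)
  next
    assume B: "\<forall>j<n. \<forall>k<n. dagger (?B k j) = ?B j k"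
    have *: "cnj (X $ (a, r) $ (b, s)) = X $ (b, s) $ (a, r)" for a b r s
      using arg_cong[OF B[rule_format, OF hg(2)[of s] hg(2)[of r]], of "\<lambda>Y. Y $ b $ a"]
      by (simp add: dagger_def hg(1))
    show "dagger X = X"
      unfolding dagger_def vec_eq_iff split_paired_All by (simp add: *)
  qed
  have "(\<forall>v. 0 \<le> Re (cdot v (X *v v))) \<longleftrightarrow>
      (\<forall>w. 0 \<le> Re (\<Sum>j<n. \<Sum>k<n. cdot (w j) (?B j k *v w k)))" (is "?L \<longleftrightarrow> ?R")
  proof
    assume L: ?L
    show ?R
    proof
      fix w :: "nat \<Rightarrow> complex^'a"
      define v :: "complex^('a \<times> 'r)" where "v = (\<chi> i. w (g (snd i)) $ fst i)"
      have v: "(\<chi> a. v $ (a, h j)) = w j" if "j < n" for j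
        using that by (simp add: v_def gh)
      have "cdot v (X *v v) = (\<Sum>j<n. \<Sum>k<n. cdot (w j) (?B j k *v w k))"
        unfolding quad by (intro sum.cong refl) (simp add: v)
      then show "0 \<le> Re (\<Sum>j<n. \<Sum>k<n. cdot (w j) (?B j k *v w k))"
        using L[rule_format, of v] by simp
    qed
  next
    assume R: ?R
    show ?L
      unfolding quad by (intro allI) (rule R[rule_format, of "\<lambda>j. \<chi> a. v $ (a, h j)" for v])
  qed
  then show ?thesis
    unfolding psd_def block_psd_def herm by blast
qed

lemma completely_positive_tensor_id:
  fixes T :: "'a::finite cmat \<Rightarrow> 'b::finite cmat" and X :: "('a \<times> 'r::finite) cmat"
  assumes T: "completely_positive T" and X: "psd X"
  shows "psd (tensor_id T X)"
proof -
  obtain h :: "nat \<Rightarrow> 'r" where h: "bij_betw h {..<CARD('r)} UNIV"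
    using ex_bij_betw_nat_finite[of "UNIV :: 'r set"] by (auto simp: atLeast0LessThan)
  have "block_psd CARD('r) (\<lambda>j k. T (\<chi> a a'. X $ (a, h j) $ (a', h k)))"
    using T X[unfolded psd_iff_block_psd[OF h]] by (simp add: completely_positive_def)
  then show ?thesis
    by (simp add: psd_iff_block_psd[OF h] tensor_id_def)
qed

section \<open>EPR and Choi states\<close>

definition epr :: "('a::finite \<times> 'a) cmat" where
  "epr = (\<chi> i j. if fst i = snd i \<and> fst j = snd j then 1 / of_nat CARD('a) else 0)"

text \<open>
  The factors \<open>A\<^sub>1'A\<^sub>1A\<^sub>2'A\<^sub>2\<close> are first reordered to \<open>A\<^sub>1A\<^sub>2A\<^sub>1'A\<^sub>2'\<close>, and the result is reordered from
  \<open>BA\<^sub>1'A\<^sub>2'\<close> to \<open>A\<^sub>1'A\<^sub>2'B\<close>.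
\<close>

definition choi_state :: "(('a1::finite \<times> 'a2::finite) cmat \<Rightarrow> 'b::finite cmat) \<Rightarrow>
    (('a1 \<times> 'a2) \<times> 'b) cmat" where
  "choi_state T = relabel prod.swap (tensor_id T
     (relabel (\<lambda>((a1, a2), (a1', a2')). ((a1', a1), (a2', a2)))
       (kron (epr :: ('a1 \<times> 'a1) cmat) (epr :: ('a2 \<times> 'a2) cmat))))"

section \<open>Smooth conditional Renyi-2 entropy\<close>

text \<open>Base-2 logarithm and exponential with \<open>log 0 = -\<infinity>\<close> and \<open>2\<^bsup>-\<infinity>\<^esup> = 0\<close>.\<close>

definition elog2 :: "real \<Rightarrow> ereal" where
  "elog2 x = (if x \<le> 0 then -\<infinity> else ereal (log 2 x))"

definition eexp2 :: "ereal \<Rightarrow> ereal" where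
  "eexp2 x = (case x of ereal r \<Rightarrow> ereal (2 powr r) | PInfty \<Rightarrow> \<infinity> | MInfty \<Rightarrow> 0)"

definition renyi2_div :: "'n::finite cmat \<Rightarrow> 'n cmat \<Rightarrow> ereal" where
  "renyi2_div \<alpha> \<beta> =
     (if supp \<alpha> \<subseteq> supp \<beta>
      then 2 * elog2 (schatten 2 (mpow \<beta> (-1/4) ** \<alpha> ** mpow \<beta> (-1/4)))
      else \<infinity>)"

text \<open>
  The infimum is attained: the feasible set is compact and \<open>\<alpha>' \<mapsto> renyi2_div \<alpha>' \<beta>\<close> is lower
  semicontinuous.
\<close>

definition smooth_renyi2_div :: "real \<Rightarrow> 'n::finite cmat \<Rightarrow> 'n cmat \<Rightarrow> ereal" where
  "smooth_renyi2_div \<epsilon> \<alpha> \<beta> =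
     (INF \<alpha>' \<in> {\<alpha>'. subnormalised \<alpha>' \<and> schatten 1 (\<alpha>' - \<alpha>) \<le> \<epsilon> * Re (trace \<alpha>)}. renyi2_div \<alpha>' \<beta>)"

definition smooth_H2 :: "real \<Rightarrow> ('a::finite \<times> 'r::finite) cmat \<Rightarrow> ereal" where
  "smooth_H2 \<epsilon> \<rho> = - smooth_renyi2_div \<epsilon> \<rho> (kron (mat 1 :: 'a cmat) (trace_out_fst \<rho>))"

section \<open>Haar measure on the unitary group\<close>

definition haar_unitary :: "('n::finite cmat) measure \<Rightarrow> bool" where
  "haar_unitary M \<longleftrightarrow> prob_space M \<and> sets M = sets (restrict_space borel {U. unitary U}) \<and>
     (\<forall>V. unitary V \<longrightarrow> distr M M (\<lambda>U. V ** U) = M \<and> distr M M (\<lambda>U. U ** V) = M)"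

end

theory Submission
  imports Defs
begin

text \<open>
  Writing \<open>E\<^sub>1\<close>, \<open>E\<^sub>2\<close> for the Haar averages over the two local unitaries, the identity
  \<open>1 = (1 - E\<^sub>1)(1 - E\<^sub>2) + (1 - E\<^sub>1) E\<^sub>2 + E\<^sub>1 (1 - E\<^sub>2) + E\<^sub>1 E\<^sub>2\<close> applied to \<open>\<rho>\<close> splits
  \<open>\<sigma> - \<tau>\<^sup>B \<otimes> \<rho>\<^sup>R\<close> into three terms, which depend only on the pairs of states
  \<open>(\<tau>, \<rho>)\<close>, \<open>(\<tau>\<^sup>A\<^sup>1\<^sup>B, \<rho>\<^sup>A\<^sup>1\<^sup>R)\<close> and \<open>(\<tau>\<^sup>A\<^sup>2\<^sup>B, \<rho>\<^sup>A\<^sup>2\<^sup>R)\<close>, so that each of them can be smoothed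
  independently of the others. Smoothing costs \<open>8\<epsilon> + 4\<epsilon> + 4\<epsilon>\<close> in total. The remaining part of each
  term is weighted by \<open>(\<tau>\<^sup>B \<otimes> \<rho>\<^sup>R)\<^bsup>1/4\<^esup>\<close>, which turns the trace norm into the Hilbert-Schmidt norm,
  and the second moment of the latter is computed from the invariance of the Haar measure: an
  invariant four-index tensor is a combination of two elementary ones.
\<close>

section \<open>The inner product and adjoints\<close>

text \<open>The maps \<open>1 - E\<close> are not positive, so a smoothing error cannot be pushed
  through them directly. Each centred map is instead a difference of two positive maps that both
  multiply the trace by \<gamma>, with \<gamma> = 1 for one factor and \<gamma> = 2 for both.
  Smoothing one of the two states costs 2\<gamma>\<epsilon>, which is the origin of 4\<epsilon>,
  4\<epsilon> and 8\<epsilon>. To smooth the channel in the same way as the state, it is replaced by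
  the contraction \<open>choi_apply\<close> with its Choi state, which is bilinear and makes sense
  for every matrix in place of \<tau>. The weight acts on B and R only, so it passes through the
  random unitaries, and its Cauchy-Schwarz factor is at most 1 because \<tau> and \<rho> are
  subnormalised. The square of \<open>D1\<close> is the second moment itself: |A|^2 from the
  normalisation of the Choi state times 1 / (|A|^2 - 1) from the Haar average. The infima in the
  entropies are only approached, up to a slack \<delta> that is sent to 0 at the end.\<close>

lemma cdot_real_inner: "Re (cdot v w) = v \<bullet> w"
  by (simp add: cdot_def inner_vec_def inner_complex_def)

lemma cdot_self: "cdot v v = of_real ((norm v)\<^sup>2)"
  by (simp add: complex_eq_iff cdot_real_inner power2_norm_eq_inner)
    (simp add: cdot_def mult.commute)

lemma cdot_eq_0_self: "cdot v v = 0 \<longleftrightarrow> v = 0"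
  by (simp add: cdot_self)

lemma cdot_add_right: "cdot u (v + w) = cdot u v + cdot u w"
  by (simp add: cdot_def distrib_left sum.distrib)

lemma cdot_diff_right: "cdot u (v - w) = cdot u v - cdot u w"
  by (simp add: cdot_def right_diff_distrib sum_subtractf)

lemma cdot_scale_right: "cdot u (c *s v) = c * cdot u v"
  by (simp add: cdot_def sum_distrib_left mult.left_commute)

lemma cdot_scale_left: "cdot (c *s u) v = cnj c * cdot u v"
  by (simp add: cdot_def sum_distrib_left mult.assoc)

lemma cdot_zero_right [simp]: "cdot u 0 = 0"
  by (simp add: cdot_def)

lemma cdot_sum_right: "cdot u (\<Sum>x\<in>S. f x) = (\<Sum>x\<in>S. cdot u (f x))"
  by (induction S rule: infinite_finite_induct) (auto simp: cdot_add_right)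

lemma cdot_cnj: "cnj (cdot u v) = cdot v u"
  by (simp add: cdot_def mult.commute)

lemma cdot_dagger: "cdot u (X *v v) = cdot (dagger X *v u) v"
  unfolding cdot_def matrix_vector_mult_def dagger_def
  by (simp add: sum_distrib_left sum_distrib_right)
    (subst sum.swap, simp add: mult_ac)

lemma continuous_on_cdot_right: "continuous_on S (\<lambda>v. cdot u v)"
  unfolding cdot_def by (intro continuous_intros)

lemma dagger_dagger [simp]: "dagger (dagger X) = X"
  by (simp add: dagger_def vec_eq_iff)

lemma dagger_mult: "dagger (X ** Y) = dagger Y ** dagger X"
  by (simp add: dagger_def matrix_matrix_mult_def vec_eq_iff mult.commute)

lemma dagger_mat_1 [simp]: "dagger (mat 1) = mat 1"
  by (auto simp: dagger_def mat_def vec_eq_iff)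

lemma dagger_diag [simp]: "dagger (diag d) = diag d"
  by (auto simp: dagger_def diag_def vec_eq_iff)

lemma dagger_add: "dagger (X + Y) = dagger X + dagger Y"
  by (simp add: dagger_def vec_eq_iff)

lemma dagger_diff: "dagger (X - Y) = dagger X - dagger Y"
  by (simp add: dagger_def vec_eq_iff)

lemma dagger_nth: "dagger X $ i $ j = cnj (X $ j $ i)"
  by (simp add: dagger_def)

section \<open>Spectral theorem\<close>

text \<open>By counting dimensions some vector lies outside the span of \<open>S\<close>;
  subtracting its orthogonal projection onto that span, one Gram-Schmidt step, gives
  \<open>w\<close>.\<close>

lemma exists_orthogonal_vector:
  fixes S :: "(complex^'n::finite) set"
  assumes S: "finite S" "card S < CARD('n)"
    and on: "\<And>u v. u \<in> S \<Longrightarrow> v \<in> S \<Longrightarrow> cdot u v = (if u = v then 1 else 0)"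
  shows "\<exists>w. w \<noteq> 0 \<and> (\<forall>u\<in>S. cdot u w = 0)"
proof -
  have "vec.span S \<noteq> UNIV"
  proof
    assume "vec.span S = UNIV"
    then have "vec.dim (UNIV :: (complex^'n) set) \<le> card S"
      using vec.dim_le_card[of UNIV S] S by auto
    with S show False by (simp only: vec_dim_card)
  qed
  then obtain x where x: "x \<notin> vec.span S" by auto
  define w where "w = x - (\<Sum>u\<in>S. cdot u x *s u)"
  have "(\<Sum>u\<in>S. cdot u x *s u) \<in> vec.span S"
    by (intro vec.span_sum vec.span_scale vec.span_base)
  then have "w \<noteq> 0" using x by (auto simp: w_def)
  moreover have "cdot u w = 0" if "u \<in> S" for u
  proof -
    have "(\<Sum>v\<in>S. cdot v x * cdot u v) = (\<Sum>v\<in>S. if u = v then cdot v x else 0)"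
      by (intro sum.cong refl) (simp add: on that)
    then show ?thesis
      using S that by (simp add: w_def cdot_diff_right cdot_sum_right cdot_scale_right)
  qed
  ultimately show ?thesis by blast
qed

text \<open>Variational argument: the orthogonal complement \<open>W\<close> of \<open>S\<close> is
  invariant under \<open>X\<close>, because \<open>X\<close> is Hermitian and \<open>S\<close>
  consists of eigenvectors. A unit vector maximising the quadratic form of \<open>X\<close> on
  \<open>W\<close> is an eigenvector, since otherwise a small move along the residual would increase
  the Rayleigh quotient.\<close>

lemma hermitian_eigenvector_orthogonal:
  fixes X :: "'n::finite cmat"
  assumes X: "dagger X = X" and w0: "w0 \<noteq> 0" "\<forall>u\<in>S. cdot u w0 = 0"
    and eig: "\<And>u. u \<in> S \<Longrightarrow> \<exists>l. X *v u = l *s u"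
  shows "\<exists>w l. norm w = 1 \<and> (\<forall>u\<in>S. cdot u w = 0) \<and> X *v w = of_real l *s w"
proof -
  define W where "W = {w. \<forall>u\<in>S. cdot u w = 0}"
  define f where "f w = Re (cdot w (X *v w))" for w
  have Wadd: "a *s v + b *s w \<in> W" if "v \<in> W" "w \<in> W" for a b v w
    using that by (auto simp: W_def cdot_add_right cdot_scale_right)
  have WX: "X *v w \<in> W" if "w \<in> W" for w
    unfolding W_def
  proof safe
    fix u assume "u \<in> S"
    with eig obtain l where "X *v u = l *s u" by blast
    with that \<open>u \<in> S\<close> show "cdot u (X *v w) = 0"
      by (simp add: cdot_dagger X cdot_scale_left W_def)
  qed
  have "W = (\<Inter>u\<in>S. {w. cdot u w = 0})" by (auto simp: W_def)
  moreover have "closed {w. cdot u w = 0}" for u :: "complex^'n"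
    using continuous_closed_preimage_constant[OF continuous_on_cdot_right[of UNIV u] closed_UNIV, of 0]
    by simp
  ultimately have "closed W" by (simp add: closed_INT)
  then have comp: "compact (W \<inter> sphere 0 1)"
    by (intro closed_Int_compact) auto
  have "(1 / norm w0) *\<^sub>R w0 \<in> W"
  proof -
    have "(1 / norm w0) *\<^sub>R w0 = complex_of_real (1 / norm w0) *s w0"
      unfolding vec_eq_iff vector_scaleR_component by (simp add: scaleR_conv_of_real)
    then show ?thesis using w0 by (simp add: W_def cdot_scale_right)
  qed
  then have "W \<inter> sphere 0 1 \<noteq> {}"
    using w0 by (auto simp: disjoint_iff intro!: bexI[of _ "(1 / norm w0) *\<^sub>R w0"])
  moreover have "continuous_on (W \<inter> sphere 0 1) f"
    unfolding f_def cdot_def matrix_vector_mult_def by (intro continuous_intros)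
  ultimately obtain w where w': "w \<in> W \<inter> sphere 0 1" "\<forall>v\<in>W \<inter> sphere 0 1. f v \<le> f w"
    using continuous_attains_sup[OF comp] by blast
  then have w: "w \<in> W" "norm w = 1"
    and max: "\<And>v. v \<in> W \<Longrightarrow> norm v = 1 \<Longrightarrow> f v \<le> f w"
    by auto
  define l where "l = f w"
  have fscale: "f (of_real c *s v) = c\<^sup>2 * f v" for c v
    by (simp add: f_def cdot_scale_left cdot_scale_right vector_scalar_commute power2_eq_square
        matrix_vector_mult_scaleR)
  have g: "f v \<le> l * (norm v)\<^sup>2" if "v \<in> W" for v
  proof (cases "v = 0")
    case True
    then show ?thesis by (simp add: f_def)
  next
    case False
    define u where "u = of_real (1 / norm v) *s v"
    have "u = (1 / norm v) *\<^sub>R v" 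
      unfolding u_def vec_eq_iff vector_scaleR_component by (simp add: scaleR_conv_of_real)
    then have "norm u = 1" using False by simp
    moreover have "u \<in> W" using Wadd[OF that that, of "of_real (1 / norm v)" 0] by (simp add: u_def)
    ultimately have "f u \<le> l" using max by (simp add: l_def)
    then show ?thesis
      using False by (simp add: u_def fscale field_simps del: of_real_divide)
  qed
  \<comment> \<open>The residual of the eigenvalue equation is the direction of variation: along it,
    the derivative at \<open>w\<close> of the quadratic form minus \<open>l\<close> times the
    squared norm is twice the squared norm of \<open>z\<close>.\<close>
  define z where "z = X *v w - of_real l *s w"
  have zW: "z \<in> W" using Wadd[OF WX[OF w(1)] w(1), of 1 "- of_real l"]
    by (simp add: z_def)
  have Xadd: "f (w + of_real t *s z) = f w + 2 * t * (z \<bullet> (X *v w)) + t\<^sup>2 * f z" for t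
  proof -
    have 1: "Re (cdot w (X *v z)) = z \<bullet> (X *v w)"
      by (metis X cdot_dagger cdot_real_inner inner_commute)
    show ?thesis
      using 1 by (simp add: f_def matrix_vector_right_distrib cdot_real_inner inner_add_left inner_add_right
         vector_scalar_commute power2_eq_square algebra_simps)
       (simp add: cdot_real_inner[symmetric] cdot_scale_left cdot_scale_right algebra_simps)
  qed
  have nadd: "(norm (w + of_real t *s z))\<^sup>2 = 1 + 2 * t * (z \<bullet> w) + t\<^sup>2 * (norm z)\<^sup>2" for t
  proof -
    have "of_real t *s z = t *\<^sub>R z"
      unfolding vec_eq_iff vector_scaleR_component by (simp add: scaleR_conv_of_real)
    then have "(norm (w + of_real t *s z))\<^sup>2 = (w + t *\<^sub>R z) \<bullet> (w + t *\<^sub>R z)"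
      by (simp add: power2_norm_eq_inner)
    also have "\<dots> = w \<bullet> w + 2 * t * (z \<bullet> w) + t\<^sup>2 * (z \<bullet> z)"
      by (simp add: inner_add_left inner_add_right inner_commute[of w z] power2_eq_square algebra_simps)
    finally show ?thesis
      using w(2) by (simp add: power2_norm_eq_inner[symmetric])
  qed
  have zz: "z \<bullet> (X *v w) - l * (z \<bullet> w) = (norm z)\<^sup>2"
  proof -
    have "of_real l *s w = l *\<^sub>R w"
      unfolding vec_eq_iff vector_scaleR_component by (simp add: scaleR_conv_of_real)
    then have "z \<bullet> (X *v w) - l * (z \<bullet> w) = z \<bullet> z" by (simp add: z_def inner_diff_right)
    then show ?thesis by (simp add: power2_norm_eq_inner)
  qed
  have quad: "2 * t * (norm z)\<^sup>2 \<le> t\<^sup>2 * (l * (norm z)\<^sup>2 - f z)" for t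
  proof -
    have "f (w + of_real t *s z) \<le> l * (norm (w + of_real t *s z))\<^sup>2"
      by (rule g) (use Wadd[OF w(1) zW, of 1] in simp)
    then show ?thesis unfolding Xadd nadd using zz
      by (simp add: l_def[symmetric] algebra_simps)
  qed
  have "z = 0"
  proof (rule ccontr)
    assume nz: "z \<noteq> 0"
    define B where "B = l * (norm z)\<^sup>2 - f z"
    \<comment> \<open>So small that \<open>t * B\<close> is at most the squared norm of
      \<open>z\<close>, half of what the first-order term forces; the summand 1 avoids a division by
      zero.\<close>
    define t where "t = (norm z)\<^sup>2 / (\<bar>B\<bar> + 1)"
    have t: "t > 0" using nz by (simp add: t_def add_nonneg_pos)
    have "2 * t * (norm z)\<^sup>2 \<le> t\<^sup>2 * B" using quad[of t] by (simp add: B_def)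
    then have "2 * (norm z)\<^sup>2 \<le> t * B" using t by (simp add: power2_eq_square)
    also have "\<dots> \<le> t * (\<bar>B\<bar> + 1)" using t by (intro mult_left_mono) auto
    also have "\<dots> = (norm z)\<^sup>2" unfolding t_def by (simp add: add_nonneg_eq_0_iff)
    finally show False using nz by simp
  qed
  then show ?thesis using w by (intro exI[of _ w] exI[of _ l]) (auto simp: z_def W_def)
qed

lemma hermitian_eigenbasis:
  fixes X :: "'n::finite cmat"
  assumes X: "dagger X = X" and k: "k \<le> CARD('n)"
  shows "\<exists>S. finite S \<and> card S = k \<and> (\<forall>u\<in>S. \<forall>v\<in>S. cdot u v = (if u = v then 1 else 0)) \<and>
    (\<forall>u\<in>S. \<exists>l. X *v u = of_real l *s u)"
  using k
proof (induction k)
  case 0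
  show ?case by (intro exI[of _ "{}"]) auto
next
  case (Suc k)
  then obtain S where S: "finite S" "card S = k"
    "\<forall>u\<in>S. \<forall>v\<in>S. cdot u v = (if u = v then 1 else 0)"
    "\<forall>u\<in>S. \<exists>l. X *v u = of_real l *s u" by auto
  obtain w0 where "w0 \<noteq> 0" "\<forall>u\<in>S. cdot u w0 = 0"
    using exists_orthogonal_vector[of S] S Suc.prems by auto
  then obtain w l where w: "norm w = 1" "\<forall>u\<in>S. cdot u w = 0" "X *v w = of_real l *s w"
    using hermitian_eigenvector_orthogonal[OF X, of w0 S] S(4) by blast
  have ww: "cdot w w = 1" using w by (simp add: cdot_self)
  then have "w \<notin> S" using w(2) by force
  have wu: "cdot w u = 0" if "u \<in> S" for u
    using w(2) that cdot_cnj[of u w] by simp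
  show ?case
    using S w ww wu \<open>w \<notin> S\<close> by (intro exI[of _ "insert w S"]) auto
qed

theorem hermitian_spectral:
  fixes X :: "'n::finite cmat"
  assumes X: "dagger X = X"
  obtains U d where "unitary U" "X = U ** diag d ** dagger U"
proof -
  obtain S where S: "finite S" "card S = CARD('n)"
    "\<forall>u\<in>S. \<forall>v\<in>S. cdot u v = (if u = v then 1 else 0)"
    "\<forall>u\<in>S. \<exists>l. X *v u = of_real l *s u"
    using hermitian_eigenbasis[OF X order_refl] by blast
  obtain h where h: "bij_betw h (UNIV :: 'n set) S"
    using S finite_same_card_bij[of "UNIV :: 'n set" S] by auto
  have hS: "h i \<in> S" for i using h by (auto simp: bij_betw_def)
  have hinj: "h i = h j \<longleftrightarrow> i = j" for i j using h by (auto simp: bij_betw_def inj_on_def)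
  have "\<forall>i. \<exists>l. X *v h i = of_real l *s h i" using S(4) hS by blast
  then obtain d where d: "\<forall>i. X *v h i = of_real (d i) *s h i"
    by (rule choice[THEN exE])
  define U :: "'n cmat" where "U = (\<chi> i j. h j $ i)"
  have "cdot (h i) (h j) = (if i = j then 1 else 0)" for i j
    using S(3) hS hinj by metis
  then have "dagger U ** U = mat 1"
    by (simp add: vec_eq_iff U_def dagger_def matrix_matrix_mult_def mat_def cdot_def[symmetric])
  then have U: "unitary U"
    by (simp add: unitary_def matrix_left_right_inverse)
  have "X ** U = U ** diag d"
  proof -
    have "(X ** U) $ i $ j = (U ** diag d) $ i $ j" for i j
    proof -
      have "(X ** U) $ i $ j = (X *v h j) $ i"
        by (simp add: matrix_matrix_mult_def matrix_vector_mult_def U_def)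
      also have "\<dots> = (U ** diag d) $ i $ j"
        by (simp add: d matrix_matrix_mult_def U_def diag_def if_distrib[of "(*) _"] sum.delta
            mult.commute cong: if_cong)
      finally show ?thesis .
    qed
    then show ?thesis by (simp add: vec_eq_iff)
  qed
  then have "X ** U ** dagger U = U ** diag d ** dagger U" by simp
  then have "X = U ** diag d ** dagger U"
    using U by (simp add: unitary_def matrix_mul_assoc[symmetric])
  with U that show thesis by blast
qed

section \<open>Powers and norms\<close>

lemma unitaryD: "unitary U \<Longrightarrow> dagger U ** U = mat 1" "unitary U \<Longrightarrow> U ** dagger U = mat 1"
  by (auto simp: unitary_def)

lemma unitary_dagger: "unitary U \<Longrightarrow> unitary (dagger U)"
  by (auto simp: unitary_def)

lemma unitary_cancel:
  assumes "unitary U"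
  shows "X ** dagger U ** U = X" "X ** U ** dagger U = X"
  using unitaryD[OF assms] by (simp_all add: matrix_mul_assoc[symmetric])

lemma unitary_mult: "unitary U \<Longrightarrow> unitary V \<Longrightarrow> unitary (U ** V)"
  by (simp add: unitary_def[of "U ** V"] dagger_mult matrix_mul_assoc unitary_cancel unitaryD)

lemma mult_diag_nth: "(X ** diag d) $ i $ j = X $ i $ j * of_real (d j)"
  by (simp add: matrix_matrix_mult_def diag_def if_distrib[of "(*) _"] cong: if_cong)

lemma diag_mult_nth: "(diag d ** X) $ i $ j = of_real (d i) * X $ i $ j"
  by (simp add: matrix_matrix_mult_def diag_def if_distrib[of "\<lambda>x. x * _"] cong: if_cong)

lemma diag_mult_diag: "diag d ** diag e = diag (\<lambda>i. d i * e i)"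
  by (simp add: vec_eq_iff mult_diag_nth) (auto simp: diag_def)

lemma trace_diag: "trace (diag d) = of_real (\<Sum>i\<in>UNIV. d i)"
  by (simp add: trace_def diag_def)

lemma spectral_mult:
  assumes "unitary U"
  shows "(U ** X ** dagger U) ** (U ** Y ** dagger U) = U ** (X ** Y) ** dagger U"
  by (simp add: matrix_mul_assoc unitary_cancel[OF assms])

lemma trace_conj_unitary:
  assumes "unitary U"
  shows "trace (U ** X ** dagger U) = trace X"
  using unitaryD[OF assms] trace_mul_sym[of "U ** X" "dagger U"]
  by (simp add: matrix_mul_assoc)

lemma dagger_conj: "dagger (U ** X ** dagger U) = U ** dagger X ** dagger U"
  by (simp add: dagger_mult matrix_mul_assoc)

text \<open>The unitary \<open>W\<close> intertwines the two diagonal matrices, so an entry of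
  \<open>W\<close> is nonzero only between equal eigenvalues; hence \<open>W\<close> also
  intertwines their images under \<open>f\<close>. This makes the definite description in
  \<open>mpow\<close> well defined.\<close>

lemma spectral_function_unique:
  assumes U: "unitary U" and V: "unitary V"
    and eq: "U ** diag d ** dagger U = V ** diag e ** dagger V"
  shows "U ** diag (\<lambda>i. f (d i)) ** dagger U = V ** diag (\<lambda>i. f (e i)) ** dagger V"
proof -
  define W where "W = dagger V ** U"
  have UVW: "U = V ** W"
    using unitaryD[OF V] by (simp add: W_def matrix_mul_assoc)
  have "W ** diag d = diag e ** W"
    using arg_cong[OF eq, of "\<lambda>Y. dagger V ** Y ** U"]
    by (simp add: W_def matrix_mul_assoc unitary_cancel[OF U] unitaryD[OF V])
  then have "(W ** diag d) $ i $ j = (diag e ** W) $ i $ j" for i j by simp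
  then have "W $ i $ j = 0 \<or> d j = e i" for i j
    by (simp add: mult_diag_nth diag_mult_nth)
  then have "W ** diag (\<lambda>i. f (d i)) = diag (\<lambda>i. f (e i)) ** W"
    by (fastforce simp: vec_eq_iff mult_diag_nth diag_mult_nth)
  then have "V ** (W ** diag (\<lambda>i. f (d i))) ** dagger U = V ** (diag (\<lambda>i. f (e i)) ** W) ** dagger U"
    by simp
  then show ?thesis
    by (simp add: W_def matrix_mul_assoc unitary_cancel[OF U] unitaryD[OF V])
qed

lemma mpow_spectral:
  assumes U: "unitary U" and d: "\<And>i. 0 \<le> d i" and X: "X = U ** diag d ** dagger U"
  shows "mpow X s = U ** diag (\<lambda>i. d i powr s) ** dagger U"
  unfolding mpow_def
proof (rule the_equality)
  show "\<exists>V e. unitary V \<and> (\<forall>i. 0 \<le> e i) \<and> X = V ** diag e ** dagger V \<and>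
      U ** diag (\<lambda>i. d i powr s) ** dagger U = V ** diag (\<lambda>i. e i powr s) ** dagger V"
    using assms by blast
next
  fix Y
  assume "\<exists>V e. unitary V \<and> (\<forall>i. 0 \<le> e i) \<and> X = V ** diag e ** dagger V \<and>
      Y = V ** diag (\<lambda>i. e i powr s) ** dagger V"
  then obtain V e where V: "unitary V" "X = V ** diag e ** dagger V"
    "Y = V ** diag (\<lambda>i. e i powr s) ** dagger V" by blast
  show "Y = U ** diag (\<lambda>i. d i powr s) ** dagger U"
    unfolding V(3) by (rule spectral_function_unique) (use U V X in auto)
qed

section \<open>Positive semidefinite matrices and Gram decompositions\<close>

lemma psd_hermitian: "psd X \<Longrightarrow> dagger X = X"
  by (simp add: psd_def)

text \<open>The standard way of proving positivity below: \<open>psd_gramE\<close> supplies Gram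
  vectors for the given matrices, and combining them exhibits the new matrix as a Gram
  matrix.\<close>

lemma psd_gram:
  assumes "\<And>i j. X $ i $ j = (\<Sum>k\<in>K. cnj (b k i) * b k j)"
  shows "psd X"
proof -
  have "dagger X = X"
    by (simp add: vec_eq_iff dagger_nth assms mult.commute)
  moreover have "0 \<le> Re (cdot v (X *v v))" for v
  proof -
    have "cdot v (X *v v) = (\<Sum>i\<in>UNIV. \<Sum>j\<in>UNIV. \<Sum>k\<in>K. cnj (b k i * v $ i) * (b k j * v $ j))"
      by (simp add: cdot_def matrix_vector_mult_def assms sum_distrib_left sum_distrib_right mult_ac)
    also have "\<dots> = (\<Sum>k\<in>K. \<Sum>i\<in>UNIV. \<Sum>j\<in>UNIV. cnj (b k i * v $ i) * (b k j * v $ j))"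
      by (subst (2) sum.swap, subst sum.swap, rule refl)
    also have "\<dots> = (\<Sum>k\<in>K. cnj (\<Sum>i\<in>UNIV. b k i * v $ i) * (\<Sum>j\<in>UNIV. b k j * v $ j))"
      by (simp add: sum_product)
    also have "\<dots> = (\<Sum>k\<in>K. of_real ((cmod (\<Sum>i\<in>UNIV. b k i * v $ i))\<^sup>2))"
      by (intro sum.cong refl) (simp only: mult.commute[of "cnj _"] complex_norm_square)
    finally show ?thesis by (simp add: sum_nonneg)
  qed
  ultimately show ?thesis by (simp add: psd_def)
qed

text \<open>An eigenvalue is the quadratic form at the corresponding column of \<open>U\<close>, so
  it inherits nonnegativity.\<close>

lemma psd_spectral:
  fixes X :: "'n::finite cmat"
  assumes X: "psd X"
  obtains U d where "unitary U" "\<And>i. 0 \<le> d i" "X = U ** diag d ** dagger U"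
proof -
  obtain U d where U: "unitary U" and eq: "X = U ** diag d ** dagger U"
    using hermitian_spectral[OF psd_hermitian[OF X]] by blast
  have "0 \<le> d k" for k
  proof -
    have eq': "dagger U ** X ** U = diag d"
      by (simp add: eq matrix_mul_assoc unitary_cancel[OF U] unitaryD[OF U])
    have "(dagger U ** X ** U) $ k $ k = cdot (\<chi> i. U $ i $ k) (X *v (\<chi> i. U $ i $ k))"
      unfolding matrix_mul_assoc[symmetric]
      by (simp add: cdot_def matrix_matrix_mult_def matrix_vector_mult_def dagger_def)
    then have "of_real (d k) = cdot (\<chi> i. U $ i $ k) (X *v (\<chi> i. U $ i $ k))"
      unfolding eq' by (simp add: diag_def)
    then have "d k = Re (cdot (\<chi> i. U $ i $ k) (X *v (\<chi> i. U $ i $ k)))"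
      by (metis Re_complex_of_real)
    then show ?thesis using X by (simp add: psd_def)
  qed
  with U eq that show thesis by blast
qed

lemma spectral_nth:
  "(U ** diag d ** dagger U) $ i $ j = (\<Sum>k\<in>UNIV. of_real (d k) * (U $ i $ k * cnj (U $ j $ k)))"
  unfolding matrix_matrix_mult_def[of _ "dagger U"]
  by (simp add: mult_diag_nth dagger_nth mult_ac)

lemma spectral_gram:
  assumes "\<And>i. 0 \<le> d i"
  shows "(U ** diag d ** dagger U) $ i $ j =
    (\<Sum>k\<in>UNIV. cnj (of_real (sqrt (d k)) * cnj (U $ i $ k)) * (of_real (sqrt (d k)) * cnj (U $ j $ k)))"
  unfolding spectral_nth
proof (intro sum.cong refl)
  fix k
  have "complex_of_real (d k) = of_real (sqrt (d k)) * of_real (sqrt (d k))"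
    using assms[of k] by (simp flip: of_real_mult)
  then show "of_real (d k) * (U $ i $ k * cnj (U $ j $ k)) =
    cnj (of_real (sqrt (d k)) * cnj (U $ i $ k)) * (of_real (sqrt (d k)) * cnj (U $ j $ k))"
    by (simp add: mult_ac)
qed

lemma psd_spectral_nonneg:
  assumes "\<And>i. 0 \<le> d i"
  shows "psd (U ** diag d ** dagger U)"
  by (rule psd_gram, rule spectral_gram[OF assms])

lemma psd_gramE:
  fixes X :: "'n::finite cmat"
  assumes X: "psd X"
  obtains b :: "'n \<Rightarrow> 'n \<Rightarrow> complex" where "\<And>i j. X $ i $ j = (\<Sum>k\<in>UNIV. cnj (b k i) * b k j)"
proof -
  obtain U d where U: "unitary U" and d: "\<And>i. 0 \<le> d i" and eq: "X = U ** diag d ** dagger U"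
    using psd_spectral[OF X] by blast
  show thesis
    by (rule that[of "\<lambda>k i. of_real (sqrt (d k)) * cnj (U $ i $ k)"])
      (simp only: eq spectral_gram[OF d])
qed

lemma psd_trace_nonneg: "psd X \<Longrightarrow> 0 \<le> Re (trace X)"
  by (erule psd_gramE) (auto simp: trace_def intro!: sum_nonneg)

lemma psd_add: "psd X \<Longrightarrow> psd Y \<Longrightarrow> psd (X + Y)"
  by (auto simp: psd_def dagger_add matrix_vector_mult_add_rdistrib cdot_add_right)

lemma psd_mat_1: "psd (mat 1 :: 'n::finite cmat)"
  by (rule psd_gram[where K = UNIV and b = "\<lambda>k i. if k = i then 1 else 0"])
    (auto simp: mat_def if_distrib[of cnj] if_distrib[of "\<lambda>x. x * _"] cong: if_cong)

lemma psd_conj: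
  assumes X: "psd X"
  shows "psd (V ** X ** dagger V)"
proof -
  have "0 \<le> Re (cdot v ((V ** X ** dagger V) *v v))" for v
    using X unfolding psd_def
    by (simp add: matrix_vector_mul_assoc[symmetric] cdot_dagger[of v V])
  then show ?thesis
    using psd_hermitian[OF X] by (simp add: psd_def dagger_conj)
qed

section \<open>Hilbert-Schmidt norm and trace norm\<close>

lemma norm_cmat_power2: "(norm X)\<^sup>2 = (\<Sum>i\<in>UNIV. \<Sum>j\<in>UNIV. (cmod (X $ i $ j))\<^sup>2)"
  for X :: "'n::finite cmat"
  by (simp add: norm_vec_def L2_set_def real_sqrt_pow2 sum_nonneg)

lemma trace_dagger_mult: "trace (dagger X ** Y) = (\<Sum>i\<in>UNIV. \<Sum>j\<in>UNIV. cnj (X $ i $ j) * Y $ i $ j)"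
  by (simp add: trace_def matrix_matrix_mult_def dagger_nth) (rule sum.swap)

text \<open>The library norm on \<open>complex^'n^'n\<close> is the Euclidean norm of the Euclidean
  norms of the rows, that is, the Hilbert-Schmidt norm. This form makes it accessible to cyclicity
  of the trace.\<close>

lemma norm_cmat_trace: "of_real ((norm X)\<^sup>2) = trace (dagger X ** X)"
  unfolding norm_cmat_power2 trace_dagger_mult
  by (simp only: of_real_sum complex_norm_square mult.commute)

text \<open>Cauchy-Schwarz for the Hilbert-Schmidt inner product, applied within each row and then
  across the rows.\<close>

lemma trace_dagger_mult_le: "cmod (trace (dagger X ** Y)) \<le> norm X * norm Y"
proof -
  have "cmod (trace (dagger X ** Y)) \<le> (\<Sum>i\<in>UNIV. \<Sum>j\<in>UNIV. cmod (X $ i $ j) * cmod (Y $ i $ j))"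
    unfolding trace_dagger_mult
    by (intro order_trans[OF norm_sum] sum_mono) (simp add: norm_mult)
  also have "\<dots> \<le> (\<Sum>i\<in>UNIV. norm (X $ i) * norm (Y $ i))"
    unfolding norm_vec_def
    by (intro sum_mono order_trans[OF _ L2_set_mult_ineq]) simp
  also have "\<dots> \<le> norm X * norm Y"
    unfolding norm_vec_def[of X] norm_vec_def[of Y]
    by (rule order_trans[OF _ L2_set_mult_ineq]) simp
  finally show ?thesis .
qed

lemma norm_mult_unitary_left:
  fixes X :: "'n::finite cmat"
  assumes "unitary U"
  shows "norm (U ** X) = norm X"
proof -
  have "dagger (U ** X) ** (U ** X) = dagger X ** X"
    by (simp add: dagger_mult matrix_mul_assoc unitary_cancel[OF assms])
  then have "complex_of_real ((norm (U ** X))\<^sup>2) = of_real ((norm X)\<^sup>2)"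
    by (simp only: norm_cmat_trace)
  then show ?thesis by (simp only: of_real_eq_iff) simp
qed

lemma norm_dagger: "norm (dagger X) = norm X"
proof -
  have "(norm (dagger X))\<^sup>2 = (norm X)\<^sup>2"
    unfolding norm_cmat_power2 by (simp add: dagger_nth) (rule sum.swap)
  then show ?thesis by simp
qed

lemma norm_conj_unitary:
  fixes X :: "'n::finite cmat"
  assumes "unitary U"
  shows "norm (U ** X ** dagger U) = norm X"
proof -
  have "norm (U ** X ** dagger U) = norm (X ** dagger U)"
    by (simp only: matrix_mul_assoc[symmetric] norm_mult_unitary_left[OF assms])
  also have "\<dots> = norm (U ** dagger X)"
    by (simp only: norm_dagger[of "X ** dagger U", symmetric] dagger_mult dagger_dagger)
  finally show ?thesis
    by (simp only: norm_mult_unitary_left[OF assms] norm_dagger)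
qed

lemma psd_dagger_mult: "psd (dagger X ** X)"
  by (rule psd_gram[where K = UNIV and b = "\<lambda>k i. X $ k $ i"])
    (simp add: matrix_matrix_mult_def dagger_nth)

lemma schatten_2: "schatten 2 X = norm X"
proof -
  obtain U d where U: "unitary U" "\<And>i. 0 \<le> d i" "dagger X ** X = U ** diag d ** dagger U"
    using psd_spectral[OF psd_dagger_mult] by blast
  have "mpow (dagger X ** X) 1 = dagger X ** X"
    unfolding mpow_spectral[OF U] using U by simp
  then have "Re (trace (mpow (dagger X ** X) (2/2))) = (norm X)\<^sup>2"
    by (simp add: norm_cmat_trace[symmetric])
  then show ?thesis unfolding schatten_def by (simp add: powr_half_sqrt)
qed

lemma matrix_mult_diff_left: "A ** (B - C) = A ** B - A ** (C :: 'n::finite cmat)"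
  by (simp add: vec_eq_iff matrix_matrix_mult_def right_diff_distrib sum_subtractf)

lemma matrix_mult_diff_right: "(A - B) ** C = A ** C - B ** (C :: 'n::finite cmat)"
  by (simp add: vec_eq_iff matrix_matrix_mult_def left_diff_distrib sum_subtractf)

lemma schatten_1_spectral:
  assumes U: "unitary U" and H: "H = U ** diag k ** dagger U"
  shows "schatten 1 H = (\<Sum>i\<in>UNIV. \<bar>k i\<bar>)"
proof -
  have "dagger H ** H = U ** diag (\<lambda>i. (k i)\<^sup>2) ** dagger U"
    unfolding H dagger_conj dagger_diag spectral_mult[OF U] diag_mult_diag
    by (simp add: power2_eq_square)
  then have "mpow (dagger H ** H) (1/2) = U ** diag (\<lambda>i. (k i)\<^sup>2 powr (1/2)) ** dagger U"
    by (intro mpow_spectral[OF U]) auto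
  then show ?thesis
    by (simp add: schatten_def trace_conj_unitary[OF U] trace_diag powr_half_sqrt sum_nonneg)
qed

text \<open>In the eigenbasis of \<open>H\<close> each eigenvalue is the difference of two diagonal
  entries, of the conjugated \<open>P\<close> and \<open>N\<close>. Both are nonnegative, so its
  modulus is at most their sum, and conjugation keeps the traces.\<close>

lemma schatten_1_hermitian_le:
  assumes P: "psd P" and N: "psd N" and H: "H = P - N"
  shows "schatten 1 H \<le> Re (trace P) + Re (trace N)"
proof -
  have "dagger H = H" by (simp add: H dagger_diff psd_hermitian P N)
  then obtain U k where U: "unitary U" and eq: "H = U ** diag k ** dagger U"
    by (rule hermitian_spectral)
  have conj: "dagger U ** H ** U = diag k"
    by (simp add: eq matrix_mul_assoc unitary_cancel[OF U] unitaryD[OF U])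
  define P' where "P' = dagger U ** P ** U"
  define N' where "N' = dagger U ** N ** U"
  have P': "psd P'" "trace P' = trace P"
    using psd_conj[OF P, of "dagger U"] trace_conj_unitary[OF unitary_dagger[OF U], of P]
    by (simp_all add: P'_def)
  have N': "psd N'" "trace N' = trace N"
    using psd_conj[OF N, of "dagger U"] trace_conj_unitary[OF unitary_dagger[OF U], of N]
    by (simp_all add: N'_def)
  have "diag k = P' - N'"
    by (simp only: P'_def N'_def conj[symmetric] H matrix_mult_diff_left matrix_mult_diff_right)
  then have "diag k $ i $ i = (P' - N') $ i $ i" for i by simp
  then have k: "k i = Re (P' $ i $ i) - Re (N' $ i $ i)" for i
    by (simp add: diag_def complex_eq_iff)
  have nonneg: "0 \<le> Re (X $ i $ i)" if "psd X" for X :: "'a cmat" and i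
    by (rule psd_gramE[OF that]) (simp add: sum_nonneg)
  have "(\<Sum>i\<in>UNIV. \<bar>k i\<bar>) \<le> (\<Sum>i\<in>UNIV. Re (P' $ i $ i) + Re (N' $ i $ i))"
  proof (rule sum_mono)
    fix i
    show "\<bar>k i\<bar> \<le> Re (P' $ i $ i) + Re (N' $ i $ i)"
      using nonneg[OF P'(1), of i] nonneg[OF N'(1), of i] by (simp add: k)
  qed
  also have "\<dots> = Re (trace P) + Re (trace N)"
    by (simp only: P'(2)[symmetric] N'(2)[symmetric]) (simp add: trace_def sum.distrib)
  finally show ?thesis by (simp add: schatten_1_spectral[OF U eq])
qed

text \<open>The Jordan decomposition attains equality in \<open>schatten_1_hermitian_le\<close>.
  Together the two facts reduce trace norm estimates for Hermitian matrices to traces of positive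
  ones.\<close>

lemma schatten_1_decomposition:
  assumes H: "dagger H = H"
  obtains P N where "psd P" "psd N" "H = P - N" "schatten 1 H = Re (trace P) + Re (trace N)"
proof -
  obtain U k where U: "unitary U" and eq: "H = U ** diag k ** dagger U"
    using hermitian_spectral[OF H] by blast
  define P where "P = U ** diag (\<lambda>i. max 0 (k i)) ** dagger U"
  define N where "N = U ** diag (\<lambda>i. max 0 (- k i)) ** dagger U"
  have "diag k = diag (\<lambda>i. max 0 (k i)) - diag (\<lambda>i. max 0 (- k i))"
    by (auto simp: diag_def vec_eq_iff max_def)
  then have "H = P - N"
    by (simp add: eq P_def N_def matrix_mult_diff_left matrix_mult_diff_right)
  moreover have "psd P" "psd N"
    unfolding P_def N_def by (auto intro: psd_spectral_nonneg)
  moreover have "schatten 1 H = Re (trace P) + Re (trace N)"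
    unfolding schatten_1_spectral[OF U eq] P_def N_def trace_conj_unitary[OF U] trace_diag
    by (simp flip: sum.distrib) (intro sum.cong refl, auto)
  ultimately show thesis using that by blast
qed

lemma schatten_1_triangle:
  assumes A: "dagger A = A" and B: "dagger B = B"
  shows "schatten 1 (A + B) \<le> schatten 1 A + schatten 1 B"
proof -
  obtain P N where PN: "psd P" "psd N" "A = P - N" "schatten 1 A = Re (trace P) + Re (trace N)"
    using schatten_1_decomposition[OF A] by blast
  obtain P' N' where PN': "psd P'" "psd N'" "B = P' - N'" "schatten 1 B = Re (trace P') + Re (trace N')"
    using schatten_1_decomposition[OF B] by blast
  have "schatten 1 (A + B) \<le> Re (trace (P + P')) + Re (trace (N + N'))"
    by (rule schatten_1_hermitian_le) (use PN PN' in \<open>auto intro: psd_add\<close>)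
  then show ?thesis by (simp add: trace_add PN(4) PN'(4))
qed

text \<open>Cauchy-Schwarz with a weight. With \<open>S\<close> the sign of
  \<open>H = K M K\<close>, the trace norm is the trace of \<open>S H\<close>, hence by cyclicity
  that of \<open>(K S K) M\<close>. This is at most the product of the Hilbert-Schmidt norms of
  \<open>K S K\<close> and \<open>M\<close>, and \<open>S\<close> can then be dropped.\<close>

lemma schatten_1_weighted_le:
  assumes K: "dagger K = K" and M: "dagger M = M"
  shows "schatten 1 (K ** M ** K) \<le> norm (K ** K) * norm M"
proof -
  define H where "H = K ** M ** K"
  have "dagger H = H" by (simp add: H_def dagger_mult K M matrix_mul_assoc)
  then obtain U k where U: "unitary U" and eq: "H = U ** diag k ** dagger U"
    by (rule hermitian_spectral)
  \<comment> \<open>The sign of 0 is taken to be 1, so that \<open>S\<close> squares to the identity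
    and is unitary.\<close>
  define s :: "'a \<Rightarrow> real" where "s i = (if k i < 0 then -1 else 1)" for i
  define S where "S = U ** diag s ** dagger U"
  have dS: "dagger S = S" by (simp add: S_def dagger_conj)
  have "diag (\<lambda>i. s i * s i) = mat 1"
    by (auto simp: diag_def mat_def s_def vec_eq_iff)
  then have "S ** S = mat 1"
    using unitaryD[OF U] by (simp add: S_def spectral_mult[OF U] diag_mult_diag)
  then have S: "unitary S" by (simp add: unitary_def dS)
  have "S ** H = U ** diag (\<lambda>i. \<bar>k i\<bar>) ** dagger U"
    unfolding S_def eq spectral_mult[OF U] diag_mult_diag
    by (rule arg_cong[of _ _ "\<lambda>d. U ** diag d ** dagger U"]) (auto simp: s_def)
  then have "trace (S ** H) = of_real (\<Sum>i\<in>UNIV. \<bar>k i\<bar>)"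
    by (simp add: trace_conj_unitary[OF U] trace_diag)
  then have "schatten 1 H = Re (trace (S ** H))"
    by (simp add: schatten_1_spectral[OF U eq])
  also have "S ** H = (S ** K ** M) ** K" by (simp add: H_def matrix_mul_assoc)
  also have "trace \<dots> = trace (K ** (S ** K ** M))" by (rule trace_mul_sym)
  also have "K ** (S ** K ** M) = dagger (K ** S ** K) ** M"
    by (simp add: dagger_mult K dS matrix_mul_assoc)
  also have "Re (trace (dagger (K ** S ** K) ** M)) \<le> norm (K ** S ** K) * norm M"
    by (rule order_trans[OF complex_Re_le_cmod trace_dagger_mult_le])
  \<comment> \<open>A second use of Cauchy-Schwarz: the squared norm of \<open>K S K\<close> is the
    inner product of \<open>S K^2 S\<close> with \<open>K^2\<close>, and these two have the same
    norm.\<close>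
  also have "norm (K ** S ** K) \<le> norm (K ** K)"
  proof -
    have "dagger (K ** S ** K) ** (K ** S ** K) = K ** (S ** (K ** K) ** S ** K)"
      by (simp add: dagger_mult K dS matrix_mul_assoc)
    then have "trace (dagger (K ** S ** K) ** (K ** S ** K)) = trace ((S ** (K ** K) ** S ** K) ** K)"
      by (simp add: trace_mul_sym[of K])
    also have "(S ** (K ** K) ** S ** K) ** K = dagger (S ** (K ** K) ** dagger S) ** (K ** K)"
      by (simp add: dagger_mult K dS matrix_mul_assoc)
    finally have "complex_of_real ((norm (K ** S ** K))\<^sup>2) = trace (dagger (S ** (K ** K) ** dagger S) ** (K ** K))"
      by (simp only: norm_cmat_trace)
    then have "cmod (complex_of_real ((norm (K ** S ** K))\<^sup>2)) \<le> norm (S ** (K ** K) ** dagger S) * norm (K ** K)"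
      using trace_dagger_mult_le by metis
    then have "(norm (K ** S ** K))\<^sup>2 \<le> (norm (K ** K))\<^sup>2"
      by (simp only: norm_conj_unitary[OF S] norm_of_real) (simp add: power2_eq_square)
    then show ?thesis by (simp add: power2_le_iff_abs_le)
  qed
  finally show ?thesis by (simp add: H_def mult_right_mono)
qed

section \<open>Weighting by quarter powers\<close>

lemma mpow_hermitian:
  assumes "psd \<beta>"
  shows "dagger (mpow \<beta> s) = mpow \<beta> s"
proof -
  obtain U d where U: "unitary U" "\<And>i. 0 \<le> d i" "\<beta> = U ** diag d ** dagger U"
    using psd_spectral[OF assms] by blast
  show ?thesis unfolding mpow_spectral[OF U] by (simp add: dagger_conj)
qed

text \<open>The square of the quarter power is the square root of \<beta>, whose squared
  Hilbert-Schmidt norm is the trace. This evaluates the first factor in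
  \<open>schatten_1_weighted_le\<close>.\<close>

lemma norm_mpow_quarter:
  assumes "psd \<beta>"
  shows "(norm (mpow \<beta> (1/4) ** mpow \<beta> (1/4)))\<^sup>2 = Re (trace \<beta>)"
proof -
  obtain U d where U: "unitary U" "\<And>i. 0 \<le> d i" "\<beta> = U ** diag d ** dagger U"
    using psd_spectral[OF assms] by blast
  have *: "mpow \<beta> (1/4) ** mpow \<beta> (1/4) = U ** diag (\<lambda>i. d i powr (1/2)) ** dagger U"
    unfolding mpow_spectral[OF U] spectral_mult[OF U(1)] diag_mult_diag
    by (simp flip: powr_add)
  have "dagger (mpow \<beta> (1/4) ** mpow \<beta> (1/4)) ** (mpow \<beta> (1/4) ** mpow \<beta> (1/4)) = \<beta>"
    unfolding * dagger_conj dagger_diag spectral_mult[OF U(1)] diag_mult_diag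
    using U by (simp flip: powr_add)
  then have "of_real ((norm (mpow \<beta> (1/4) ** mpow \<beta> (1/4)))\<^sup>2) = trace \<beta>"
    by (simp only: norm_cmat_trace)
  then show ?thesis by (metis Re_complex_of_real)
qed

text \<open>The vector obtained by applying \<alpha> twice to \<open>w\<close> lies in the range of
  \<alpha>, hence in \<open>supp \<beta>\<close>, and is orthogonal to the kernel vector
  \<open>w\<close>. By hermiticity this inner product is the squared norm of \<alpha> applied to
  \<open>w\<close>.\<close>

lemma supp_subset_kernel:
  assumes \<alpha>: "dagger \<alpha> = \<alpha>" and sub: "supp \<alpha> \<subseteq> supp \<beta>" and w: "\<beta> *v w = 0"
  shows "\<alpha> *v w = 0"
proof -
  have "\<alpha> *v u \<in> supp \<alpha>" for u
    by (auto simp: supp_def cdot_dagger \<alpha>) (simp add: cdot_def)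
  then have "\<alpha> *v (\<alpha> *v w) \<in> supp \<beta>" using sub by blast
  then have "cdot w (\<alpha> *v (\<alpha> *v w)) = 0" using w unfolding supp_def by blast
  then show ?thesis by (simp only: cdot_dagger[of w] \<alpha> cdot_eq_0_self)
qed

text \<open>The positive and the negative quarter power multiply only to the support projection of
  \<beta>, because zero eigenvalues stay zero. The support inclusion is what lets \<alpha> absorb
  this projection on both sides.\<close>

lemma mpow_quarter_sandwich:
  assumes \<beta>: "psd \<beta>" and \<alpha>: "dagger \<alpha> = \<alpha>" and sub: "supp \<alpha> \<subseteq> supp \<beta>"
  shows "\<alpha> = mpow \<beta> (1/4) ** (mpow \<beta> (-1/4) ** \<alpha> ** mpow \<beta> (-1/4)) ** mpow \<beta> (1/4)"
proof -
  obtain U d where U: "unitary U" "\<And>i. 0 \<le> d i" "\<beta> = U ** diag d ** dagger U"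
    using psd_spectral[OF \<beta>] by blast
  define P where "P = U ** diag (\<lambda>i. if d i = 0 then 0 else 1) ** dagger U"
  have dP: "dagger P = P" by (simp add: P_def dagger_conj)
  have 1: "mpow \<beta> (1/4) ** mpow \<beta> (-1/4) = P" "mpow \<beta> (-1/4) ** mpow \<beta> (1/4) = P"
    unfolding mpow_spectral[OF U] spectral_mult[OF U(1)] diag_mult_diag P_def
    using U(2) by (auto simp flip: powr_add intro!: arg_cong[of _ _ "\<lambda>d. U ** diag d ** dagger U"])
  have "(\<lambda>i. d i * (if d i = 0 then 0 else 1)) = d" by auto
  then have \<beta>P: "\<beta> ** P = \<beta>"
    unfolding P_def using U by (simp add: spectral_mult[OF U(1)] diag_mult_diag)
  have "\<alpha> *v (v - P *v v) = 0" for v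
    by (rule supp_subset_kernel[OF \<alpha> sub])
      (simp add: matrix_vector_mult_diff_distrib matrix_vector_mul_assoc \<beta>P)
  then have "\<alpha> *v v = (\<alpha> ** P) *v v" for v
    by (simp add: matrix_vector_mult_diff_distrib matrix_vector_mul_assoc)
  then have \<alpha>P: "\<alpha> ** P = \<alpha>" by (metis matrix_eq)
  then have P\<alpha>: "P ** \<alpha> = \<alpha>" by (metis \<alpha> dP dagger_mult)
  have "mpow \<beta> (1/4) ** (mpow \<beta> (-1/4) ** \<alpha> ** mpow \<beta> (-1/4)) ** mpow \<beta> (1/4) =
     (mpow \<beta> (1/4) ** mpow \<beta> (-1/4)) ** \<alpha> ** (mpow \<beta> (-1/4) ** mpow \<beta> (1/4))"
    by (simp add: matrix_mul_assoc)
  then show ?thesis by (simp only: 1 \<alpha>P P\<alpha>)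
qed

section \<open>Tensor products and partial traces\<close>

text \<open>Companion of \<open>sum_prod_UNIV\<close> with the first index outermost; having both
  orders lets a proof choose the nesting it needs.\<close>

lemma UNIV_pair_sum:
  fixes f :: "'a::finite \<times> 'b::finite \<Rightarrow> 'c::comm_monoid_add"
  shows "(\<Sum>x\<in>UNIV. f x) = (\<Sum>i\<in>UNIV. \<Sum>j\<in>UNIV. f (i, j))"
  by (simp add: sum.cartesian_product flip: UNIV_Times_UNIV)

lemma kron_nth [simp]: "kron X Y $ (i, j) $ (k, l) = X $ i $ k * Y $ j $ l"
  by (simp add: kron_def)

lemma cmat_pair_eqI:
  assumes "\<And>i j k l. X $ (i, j) $ (k, l) = Y $ (i, j) $ (k, l)"
  shows "X = (Y :: ('a::finite \<times> 'b::finite) cmat)"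
  using assms by (simp add: vec_eq_iff)

lemma kron_mult: "kron A B ** kron C D = kron (A ** C) (B ** D)"
  by (rule cmat_pair_eqI) (simp add: matrix_matrix_mult_def UNIV_pair_sum sum_product mult_ac)

lemma dagger_kron: "dagger (kron A B) = kron (dagger A) (dagger B)"
  by (rule cmat_pair_eqI) (simp add: dagger_nth)

lemma kron_mat_1: "kron (mat 1) (mat 1) = mat 1"
  by (rule cmat_pair_eqI) (simp add: mat_def)

lemma unitary_kron: "unitary U \<Longrightarrow> unitary V \<Longrightarrow> unitary (kron U V)"
  by (simp add: unitary_def dagger_kron kron_mult kron_mat_1)

lemma trace_kron: "trace (kron A B) = trace A * trace B"
  by (simp add: trace_def UNIV_pair_sum sum_product)

lemma norm_kron: "norm (kron A B) = norm A * norm B"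
  for A :: "'a::finite cmat" and B :: "'b::finite cmat"
proof -
  have "complex_of_real ((norm (kron A B))\<^sup>2) = of_real ((norm A * norm B)\<^sup>2)"
    by (simp only: power_mult_distrib of_real_mult norm_cmat_trace dagger_kron kron_mult trace_kron)
  then have "(norm (kron A B))\<^sup>2 = (norm A * norm B)\<^sup>2" by (simp only: of_real_eq_iff)
  then show ?thesis by simp
qed

lemma unitary_mat_1: "unitary (mat 1)"
  by (simp add: unitary_def)

lemma psd_gram_pair:
  fixes X :: "('m::finite \<times> 'n::finite) cmat"
    and b :: "'k::finite \<Rightarrow> 'l::finite \<Rightarrow> 'm \<Rightarrow> 'n \<Rightarrow> complex"
  assumes "\<And>i c j c'. X $ (i, c) $ (j, c') =
    (\<Sum>k\<in>UNIV. \<Sum>l\<in>UNIV. cnj (b k l i c) * b k l j c')"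
  shows "psd X"
proof (rule psd_gram[where K = UNIV and b = "\<lambda>p x. b (fst p) (snd p) (fst x) (snd x)"])
  fix x y
  show "X $ x $ y = (\<Sum>p\<in>UNIV. cnj (b (fst p) (snd p) (fst x) (snd x)) * b (fst p) (snd p) (fst y) (snd y))"
    using assms[of "fst x" "snd x" "fst y" "snd y"] by (simp add: UNIV_pair_sum)
qed

lemma psd_kron:
  fixes A :: "'m::finite cmat" and B :: "'n::finite cmat"
  assumes "psd A" "psd B"
  shows "psd (kron A B)"
proof -
  obtain a :: "'m \<Rightarrow> 'm \<Rightarrow> complex" where a: "\<And>i j. A $ i $ j = (\<Sum>k\<in>UNIV. cnj (a k i) * a k j)"
    using psd_gramE[OF assms(1)] by blast
  obtain b :: "'n \<Rightarrow> 'n \<Rightarrow> complex" where b: "\<And>i j. B $ i $ j = (\<Sum>k\<in>UNIV. cnj (b k i) * b k j)"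
    using psd_gramE[OF assms(2)] by blast
  show ?thesis
    by (rule psd_gram_pair[where b = "\<lambda>k l i j. a k i * b l j"])
      (simp add: a b sum_product mult_ac)
qed

lemma psd_relabel:
  fixes X :: "'m::finite cmat"
  assumes "psd X"
  shows "psd (relabel f X)"
proof -
  obtain b :: "'m \<Rightarrow> 'm \<Rightarrow> complex" where b: "\<And>i j. X $ i $ j = (\<Sum>k\<in>UNIV. cnj (b k i) * b k j)"
    using psd_gramE[OF assms] by blast
  show ?thesis
    by (rule psd_gram[where K = UNIV and b = "\<lambda>k i. b k (f i)"]) (simp add: relabel_def b)
qed

lemma trace_relabel: "bij f \<Longrightarrow> trace (relabel f X) = trace X"
  using sum.reindex_bij_betw[of f UNIV UNIV "\<lambda>i. X $ i $ i"] by (simp add: trace_def relabel_def)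

lemma psd_trace_out_snd:
  fixes X :: "('m::finite \<times> 'n::finite) cmat"
  assumes "psd X"
  shows "psd (trace_out_snd X)"
proof -
  obtain b :: "'m \<times> 'n \<Rightarrow> 'm \<times> 'n \<Rightarrow> complex" where b: "\<And>i j. X $ i $ j = (\<Sum>k\<in>UNIV. cnj (b k i) * b k j)"
    using psd_gramE[OF assms] by blast
  show ?thesis
    by (rule psd_gram[where K = UNIV and b = "\<lambda>(k, l) i. b l (i, k)"])
      (simp add: trace_out_snd_def b UNIV_pair_sum)
qed

lemma psd_trace_out_fst:
  fixes X :: "('m::finite \<times> 'n::finite) cmat"
  assumes "psd X"
  shows "psd (trace_out_fst X)"
proof -
  obtain b :: "'m \<times> 'n \<Rightarrow> 'm \<times> 'n \<Rightarrow> complex" where b: "\<And>i j. X $ i $ j = (\<Sum>k\<in>UNIV. cnj (b k i) * b k j)"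
    using psd_gramE[OF assms] by blast
  show ?thesis
    by (rule psd_gram[where K = UNIV and b = "\<lambda>(k, l) i. b l (k, i)"])
      (simp add: trace_out_fst_def b UNIV_pair_sum)
qed

lemma trace_trace_out_snd: "trace (trace_out_snd X) = trace X"
  by (simp add: trace_def trace_out_snd_def UNIV_pair_sum)

lemma trace_trace_out_fst: "trace (trace_out_fst X) = trace X"
  by (simp add: trace_def trace_out_fst_def sum_prod_UNIV)

lemma psd_marginal1: "psd X \<Longrightarrow> psd (marginal1 X)"
  unfolding marginal1_def by (intro psd_trace_out_snd psd_relabel)

lemma psd_marginal2: "psd X \<Longrightarrow> psd (marginal2 X)"
  unfolding marginal2_def by (intro psd_trace_out_snd psd_relabel)

lemma marginal1_nth: "marginal1 X $ (i, c) $ (j, c') = (\<Sum>k\<in>UNIV. X $ ((i, k), c) $ ((j, k), c'))"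
  by (simp add: marginal1_def trace_out_snd_def relabel_def)

lemma marginal2_nth: "marginal2 X $ (i, c) $ (j, c') = (\<Sum>k\<in>UNIV. X $ ((k, i), c) $ ((k, j), c'))"
  by (simp add: marginal2_def trace_out_snd_def relabel_def)

lemma trace_out_fst_marginal1: "trace_out_fst (marginal1 X) = trace_out_fst X"
  by (simp add: vec_eq_iff trace_out_fst_def marginal1_nth UNIV_pair_sum)

lemma trace_out_fst_marginal2: "trace_out_fst (marginal2 X) = trace_out_fst X"
  by (simp add: vec_eq_iff trace_out_fst_def marginal2_nth sum_prod_UNIV)

lemma trace_marginal1: "trace (marginal1 X) = trace X"
  by (metis trace_trace_out_fst trace_out_fst_marginal1)

lemma trace_marginal2: "trace (marginal2 X) = trace X"
  by (metis trace_trace_out_fst trace_out_fst_marginal2)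

lemma subnormalised_marginal:
  assumes "subnormalised X"
  shows "subnormalised (marginal1 X)" "subnormalised (marginal2 X)"
  using assms by (simp_all add: subnormalised_def psd_marginal1 psd_marginal2 trace_marginal1 trace_marginal2)

text \<open>The identity tensored with an eigenbasis of \<beta> is an eigenbasis of the tensor
  product. Consequently the weights in the conditional divergence act on the second system
  alone.\<close>

lemma mpow_kron_mat_1:
  assumes "psd \<beta>"
  shows "mpow (kron (mat 1) \<beta>) s = kron (mat 1) (mpow \<beta> s)"
proof -
  obtain U d where U: "unitary U" "\<And>i. 0 \<le> d i" "\<beta> = U ** diag d ** dagger U"
    using psd_spectral[OF assms] by blast
  have diag: "kron (mat 1 :: 'b cmat) (diag e) = diag (\<lambda>i. e (snd i))" for e :: "'a \<Rightarrow> real"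
    by (rule cmat_pair_eqI) (simp add: mat_def diag_def)
  have spectral: "kron (mat 1 :: 'b cmat) (U ** diag e ** dagger U) =
      kron (mat 1) U ** diag (\<lambda>i. e (snd i)) ** dagger (kron (mat 1) U)" for e
    unfolding diag[symmetric] dagger_kron kron_mult by simp
  have "unitary (kron (mat 1 :: 'b cmat) U)"
    by (intro unitary_kron unitary_mat_1 U(1))
  then have "mpow (kron (mat 1 :: 'b cmat) \<beta>) s =
     kron (mat 1) U ** diag (\<lambda>i. d (snd i) powr s) ** dagger (kron (mat 1) U)"
    by (rule mpow_spectral) (simp_all only: U(2) U(3) spectral)
  then show ?thesis by (simp only: mpow_spectral[OF U] spectral)
qed

section \<open>Superoperators as contractions with their Choi states\<close>

text \<open>The inverse Choi correspondence, with \<open>|A|\<close> undoing the normalisation of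
  the EPR state. As a function of two matrices it treats channel and state alike, so that \<tau> can
  be split and smoothed just like \<rho>.\<close>

definition choi_apply :: "('a::finite \<times> 'b::finite) cmat \<Rightarrow> ('a \<times> 'r::finite) cmat \<Rightarrow> ('b \<times> 'r) cmat" where
  "choi_apply \<tau> \<rho> = (\<chi> x y. of_nat CARD('a) *
     (\<Sum>i\<in>UNIV. \<Sum>j\<in>UNIV. \<tau> $ (i, fst x) $ (j, fst y) * \<rho> $ (i, snd x) $ (j, snd y)))"

lemma choi_apply_nth:
  "choi_apply \<tau> \<rho> $ (b, r) $ (b', r') =
     of_nat CARD('a) * (\<Sum>i\<in>UNIV. \<Sum>j\<in>UNIV. \<tau> $ (i, b) $ (j, b') * \<rho> $ (i, r) $ (j, r'))"
  for \<tau> :: "('a::finite \<times> 'b::finite) cmat"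
  by (simp add: choi_apply_def)

lemma choi_apply_add_left: "choi_apply (\<tau> + \<tau>') \<rho> = choi_apply \<tau> \<rho> + choi_apply \<tau>' \<rho>"
  by (rule cmat_pair_eqI) (simp add: choi_apply_nth distrib_right distrib_left sum.distrib)

lemma choi_apply_diff_left: "choi_apply (\<tau> - \<tau>') \<rho> = choi_apply \<tau> \<rho> - choi_apply \<tau>' \<rho>"
  by (rule cmat_pair_eqI) (simp add: choi_apply_nth left_diff_distrib right_diff_distrib sum_subtractf)

lemma choi_apply_add_right: "choi_apply \<tau> (\<rho> + \<rho>') = choi_apply \<tau> \<rho> + choi_apply \<tau> \<rho>'"
  by (rule cmat_pair_eqI) (simp add: choi_apply_nth distrib_left sum.distrib)

lemma choi_apply_diff_right: "choi_apply \<tau> (\<rho> - \<rho>') = choi_apply \<tau> \<rho> - choi_apply \<tau> \<rho>'"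
  by (rule cmat_pair_eqI) (simp add: choi_apply_nth right_diff_distrib sum_subtractf)

lemma dagger_choi_apply: "dagger (choi_apply \<tau> \<rho>) = choi_apply (dagger \<tau>) (dagger \<rho>)"
  by (rule cmat_pair_eqI) (simp add: choi_apply_nth dagger_nth, rule sum.swap)

text \<open>Gram vectors of the result are the products of Gram vectors of \<tau> and \<rho>
  contracted over the common index, scaled by the square root of the dimension.\<close>

lemma psd_choi_apply:
  fixes \<tau> :: "('a::finite \<times> 'b::finite) cmat" and \<rho> :: "('a \<times> 'r::finite) cmat"
  assumes "psd \<tau>" "psd \<rho>"
  shows "psd (choi_apply \<tau> \<rho>)"
proof -
  obtain a :: "'a \<times> 'b \<Rightarrow> 'a \<times> 'b \<Rightarrow> complex" where a: "\<And>i j. \<tau> $ i $ j = (\<Sum>k\<in>UNIV. cnj (a k i) * a k j)"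
    using psd_gramE[OF assms(1)] by blast
  obtain b :: "'a \<times> 'r \<Rightarrow> 'a \<times> 'r \<Rightarrow> complex" where b: "\<And>i j. \<rho> $ i $ j = (\<Sum>k\<in>UNIV. cnj (b k i) * b k j)"
    using psd_gramE[OF assms(2)] by blast
  have n: "of_nat CARD('a) = complex_of_real (sqrt CARD('a)) * of_real (sqrt CARD('a))"
    by (simp flip: of_real_mult)
  show ?thesis
  proof (rule psd_gram_pair[where
        b = "\<lambda>k l c r. of_real (sqrt CARD('a)) * (\<Sum>i\<in>UNIV. a k (i, c) * b l (i, r))"])
    fix c c' :: 'b and r r' :: 'r
    have "(\<Sum>i\<in>UNIV. \<Sum>j\<in>UNIV. \<tau> $ (i, c) $ (j, c') * \<rho> $ (i, r) $ (j, r')) =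
       (\<Sum>i\<in>UNIV. \<Sum>j\<in>UNIV. \<Sum>k\<in>UNIV. \<Sum>l\<in>UNIV. cnj (a k (i, c) * b l (i, r)) * (a k (j, c') * b l (j, r')))"
      by (simp add: a b sum_product mult_ac)
    also have "\<dots> = (\<Sum>i\<in>UNIV. \<Sum>k\<in>UNIV. \<Sum>l\<in>UNIV. \<Sum>j\<in>UNIV. cnj (a k (i, c) * b l (i, r)) * (a k (j, c') * b l (j, r')))"
      by (rule sum.cong[OF refl], subst sum.swap, rule sum.cong[OF refl], rule sum.swap)
    also have "\<dots> = (\<Sum>k\<in>UNIV. \<Sum>l\<in>UNIV. \<Sum>i\<in>UNIV. \<Sum>j\<in>UNIV. cnj (a k (i, c) * b l (i, r)) * (a k (j, c') * b l (j, r')))"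
      by (subst sum.swap, rule sum.cong[OF refl], rule sum.swap)
    also have "\<dots> = (\<Sum>k\<in>UNIV. \<Sum>l\<in>UNIV. cnj (\<Sum>i\<in>UNIV. a k (i, c) * b l (i, r)) * (\<Sum>j\<in>UNIV. a k (j, c') * b l (j, r')))"
      by (simp add: sum_product)
    finally have eq: "(\<Sum>i\<in>UNIV. \<Sum>j\<in>UNIV. \<tau> $ (i, c) $ (j, c') * \<rho> $ (i, r) $ (j, r')) =
      (\<Sum>k\<in>UNIV. \<Sum>l\<in>UNIV. cnj (\<Sum>i\<in>UNIV. a k (i, c) * b l (i, r)) * (\<Sum>j\<in>UNIV. a k (j, c') * b l (j, r')))" .
    have sq: "cnj (of_real (sqrt CARD('a)) * z) * (of_real (sqrt CARD('a)) * w) = of_nat CARD('a) * (cnj z * w)" for z w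
      by (simp add: n)
    show "choi_apply \<tau> \<rho> $ (c, r) $ (c', r') = (\<Sum>k\<in>UNIV. \<Sum>l\<in>UNIV.
       cnj (of_real (sqrt CARD('a)) * (\<Sum>i\<in>UNIV. a k (i, c) * b l (i, r))) *
       (of_real (sqrt CARD('a)) * (\<Sum>i\<in>UNIV. a k (i, c') * b l (i, r'))))"
      unfolding choi_apply_nth eq sq sum_distrib_left[of "of_nat CARD('a)"] ..
  qed
qed

text \<open>Tracing out both outputs leaves only the marginals on the contracted system. The result
  is linear in the marginal of \<rho>, so averaging it over unitaries needs the first moment
  only.\<close>

lemma trace_choi_apply:
  "trace (choi_apply \<tau> \<rho>) = of_nat CARD('a) *
     (\<Sum>i\<in>UNIV. \<Sum>j\<in>UNIV. trace_out_snd \<tau> $ i $ j * trace_out_snd \<rho> $ i $ j)"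
  for \<tau> :: "('a::finite \<times> 'b::finite) cmat" and \<rho> :: "('a \<times> 'r::finite) cmat"
proof -
  let ?f = "\<lambda>b r i j. \<tau> $ (i, b) $ (j, b) * \<rho> $ (i, r) $ (j, r)"
  have "trace (choi_apply \<tau> \<rho>) = of_nat CARD('a) *
     (\<Sum>b\<in>UNIV. \<Sum>r\<in>UNIV. \<Sum>i\<in>UNIV. \<Sum>j\<in>UNIV. ?f b r i j)"
    by (simp add: trace_def UNIV_pair_sum choi_apply_nth sum_distrib_left)
  also have "(\<Sum>b\<in>UNIV. \<Sum>r\<in>UNIV. \<Sum>i\<in>UNIV. \<Sum>j\<in>UNIV. ?f b r i j) =
     (\<Sum>b\<in>UNIV. \<Sum>i\<in>UNIV. \<Sum>j\<in>UNIV. \<Sum>r\<in>UNIV. ?f b r i j)"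
    by (rule sum.cong[OF refl], subst sum.swap, rule sum.cong[OF refl], rule sum.swap)
  also have "\<dots> = (\<Sum>i\<in>UNIV. \<Sum>j\<in>UNIV. \<Sum>b\<in>UNIV. \<Sum>r\<in>UNIV. ?f b r i j)"
    by (subst sum.swap, rule sum.cong[OF refl], rule sum.swap)
  also have "\<dots> = (\<Sum>i\<in>UNIV. \<Sum>j\<in>UNIV. trace_out_snd \<tau> $ i $ j * trace_out_snd \<rho> $ i $ j)"
    by (simp add: trace_out_snd_def sum_product)
  finally show ?thesis .
qed

definition block :: "('a::finite \<times> 'b::finite) cmat \<Rightarrow> 'a \<Rightarrow> 'a \<Rightarrow> 'b cmat" where
  "block X i j = (\<chi> b b'. X $ (i, b) $ (j, b'))"

lemma kron_mat_1_left_mult_nth: "(kron (mat 1) K ** X) $ (i, b) $ y = (\<Sum>c\<in>UNIV. K $ b $ c * X $ (i, c) $ y)"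
  by (simp add: matrix_matrix_mult_def sum_prod_UNIV mat_def if_distrib[of "\<lambda>x. x * _"] cong: if_cong)

lemma mult_kron_mat_1_left_nth: "(X ** kron (mat 1) K) $ x $ (i, b) = (\<Sum>c\<in>UNIV. X $ x $ (i, c) * K $ c $ b)"
  by (simp add: matrix_matrix_mult_def sum_prod_UNIV mat_def if_distrib[of "\<lambda>x. x * _"]
      if_distrib[of "\<lambda>x. _ * x"] cong: if_cong)

lemma kron_mat_1_right_mult_nth: "(kron V (mat 1) ** X) $ (a, r) $ y = (\<Sum>c\<in>UNIV. V $ a $ c * X $ (c, r) $ y)"
  by (simp add: matrix_matrix_mult_def UNIV_pair_sum mat_def if_distrib[of "\<lambda>x. _ * x"]
      if_distrib[of "\<lambda>x. x * _"] sum.delta cong: if_cong)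

lemma mult_kron_mat_1_right_nth: "(X ** kron V (mat 1)) $ x $ (a, r) = (\<Sum>c\<in>UNIV. X $ x $ (c, r) * V $ c $ a)"
  by (simp add: matrix_matrix_mult_def UNIV_pair_sum mat_def if_distrib[of "\<lambda>x. _ * x"] sum.delta cong: if_cong)

lemma block_local_sandwich: "block (kron (mat 1) K ** X ** kron (mat 1) L) i j = K ** block X i j ** L"
  by (simp add: block_def vec_eq_iff mult_kron_mat_1_left_nth kron_mat_1_left_mult_nth
      matrix_matrix_mult_def[of _ L] matrix_matrix_mult_def[of K])

lemma choi_apply_blocks:
  "choi_apply \<tau> \<rho> = of_nat CARD('a) *\<^sub>R (\<Sum>i\<in>UNIV. \<Sum>j\<in>UNIV. kron (block \<tau> i j) (block \<rho> i j))"
  for \<tau> :: "('a::finite \<times> 'b::finite) cmat"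
  by (rule cmat_pair_eqI) (simp add: choi_apply_nth block_def sum_component scaleR_conv_of_real[of _ "_ :: complex"])

lemma matrix_mult_sum_left: "A ** (\<Sum>i\<in>S. f i) = (\<Sum>i\<in>S. A ** (f i :: 'n::finite cmat))"
  by (induction S rule: infinite_finite_induct)
    (auto simp: matrix_matrix_mult_def vec_eq_iff distrib_left sum.distrib)

lemma matrix_mult_sum_right: "(\<Sum>i\<in>S. f i) ** A = (\<Sum>i\<in>S. (f i :: 'n::finite cmat) ** A)"
  by (induction S rule: infinite_finite_induct)
    (auto simp: matrix_matrix_mult_def vec_eq_iff distrib_right sum.distrib)

lemma matrix_mult_scaleR: "A ** (c *\<^sub>R B) = c *\<^sub>R (A ** B)" "(c *\<^sub>R A) ** B = c *\<^sub>R (A ** B)"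
  for A B :: "'n::finite cmat"
  by (simp_all add: vec_eq_iff matrix_matrix_mult_def scaleR_sum_right)

text \<open>The contraction runs over the first factors and is a sum of Kronecker products of
  blocks, so operators on the second factors pass through it. This moves the quarter powers of both
  marginals out of the channel.\<close>

lemma choi_apply_local_sandwich:
  "choi_apply (kron (mat 1) K ** \<tau> ** kron (mat 1) K') (kron (mat 1) L ** \<rho> ** kron (mat 1) L') =
    kron K L ** choi_apply \<tau> \<rho> ** kron K' L'"
  unfolding choi_apply_blocks block_local_sandwich
  by (simp add: matrix_mult_scaleR matrix_mult_sum_left matrix_mult_sum_right kron_mult)

abbreviation block_snd :: "('a::finite \<times> 'r::finite) cmat \<Rightarrow> 'r \<Rightarrow> 'r \<Rightarrow> 'a cmat" where
  "block_snd X r r' \<equiv> (\<chi> a a'. X $ (a, r) $ (a', r'))"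

lemma tensor_id_nth: "tensor_id S X $ (b, r) $ (b', r') = S (block_snd X r r') $ b $ b'"
  by (simp add: tensor_id_def)

lemma block_snd_tensor_id: "block_snd (tensor_id S X) r r' = S (block_snd X r r')"
  by (simp add: tensor_id_nth vec_eq_iff)

lemma tensor_id_conj:
  "tensor_id (\<lambda>Y. V ** Y ** dagger V) X = kron V (mat 1) ** X ** dagger (kron V (mat 1))"
  by (rule cmat_pair_eqI)
    (simp add: dagger_kron tensor_id_nth mult_kron_mat_1_right_nth kron_mat_1_right_mult_nth
      matrix_matrix_mult_def[of _ "dagger V"] matrix_matrix_mult_def[of V])

lemma psd_tensor_id_conj: "psd X \<Longrightarrow> psd (tensor_id (\<lambda>Y. V ** Y ** dagger V) X)"
  unfolding tensor_id_conj by (rule psd_conj)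

lemma trace_tensor_id_conj:
  assumes "unitary V"
  shows "trace (tensor_id (\<lambda>Y. V ** Y ** dagger V) X) = trace X"
  unfolding tensor_id_conj by (intro trace_conj_unitary unitary_kron assms unitary_mat_1)

lemma tensor_id_compose: "tensor_id S (tensor_id S' X) = tensor_id (\<lambda>Y. S (S' Y)) X"
  by (rule cmat_pair_eqI) (simp add: tensor_id_nth)

section \<open>Linear superoperators and their Choi states\<close>

lemma superoperatorD:
  assumes "superoperator S"
  shows "S (X + Y) = S X + S Y" "S (X - Y) = S X - S Y" "S (cscale c X) = cscale c (S X)"
    "S 0 = 0" "S (\<Sum>i\<in>K. f i) = (\<Sum>i\<in>K. S (f i))"
proof -
  show add: "S (X + Y) = S X + S Y" and sc: "S (cscale c X) = cscale c (S X)" for X Y c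
    using assms by (auto simp: superoperator_def)
  show S0: "S 0 = 0" using add[of 0 0] by simp
  show "S (X - Y) = S X - S Y" using add[of "X - Y" Y] by simp
  show "S (\<Sum>i\<in>K. f i) = (\<Sum>i\<in>K. S (f i))"
    by (induction K rule: infinite_finite_induct) (auto simp: add S0)
qed

lemma tensor_id_diff_right:
  assumes "superoperator S"
  shows "tensor_id S (X - Y) = tensor_id S X - tensor_id S Y"
proof (rule cmat_pair_eqI)
  fix b r b' r'
  have "block_snd (X - Y) r r' = block_snd X r r' - block_snd Y r r'" by (simp add: vec_eq_iff)
  then show "tensor_id S (X - Y) $ (b, r) $ (b', r') = (tensor_id S X - tensor_id S Y) $ (b, r) $ (b', r')"
    by (simp add: tensor_id_nth superoperatorD[OF assms])
qed

definition matrix_unit :: "'a::finite \<Rightarrow> 'a \<Rightarrow> 'a cmat" where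
  "matrix_unit i j = (\<chi> a b. if a = i \<and> b = j then 1 else 0)"

lemma superoperator_expansion:
  assumes "superoperator S"
  shows "S X = (\<Sum>i\<in>UNIV. \<Sum>j\<in>UNIV. cscale (X $ i $ j) (S (matrix_unit i j)))"
proof -
  have "X $ a $ b = (\<Sum>i\<in>UNIV. \<Sum>j\<in>UNIV. cscale (X $ i $ j) (matrix_unit i j)) $ a $ b" for a b
  proof -
    have "(\<Sum>i\<in>UNIV. \<Sum>j\<in>UNIV. cscale (X $ i $ j) (matrix_unit i j)) $ a $ b =
      (\<Sum>i\<in>UNIV. \<Sum>j\<in>UNIV. if b = j then (if a = i then X $ i $ j else 0) else 0)"
      unfolding sum_component by (intro sum.cong refl) (auto simp: cscale_def matrix_unit_def)
    also have "\<dots> = X $ a $ b" by simp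
    finally show ?thesis by (rule sym)
  qed
  then have "X = (\<Sum>i\<in>UNIV. \<Sum>j\<in>UNIV. cscale (X $ i $ j) (matrix_unit i j))"
    unfolding vec_eq_iff by blast
  then have "S X = S (\<Sum>i\<in>UNIV. \<Sum>j\<in>UNIV. cscale (X $ i $ j) (matrix_unit i j))" by simp
  then show ?thesis by (simp add: superoperatorD[OF assms])
qed

lemma superoperator_nth:
  assumes "superoperator S"
  shows "S X $ b $ b' = (\<Sum>i\<in>UNIV. \<Sum>j\<in>UNIV. X $ i $ j * S (matrix_unit i j) $ b $ b')"
  by (subst superoperator_expansion[OF assms]) (simp add: sum_component cscale_def)

text \<open>Multiplication by operators on the reference only forms linear combinations of the
  blocks to which \<open>S\<close> is applied, so linearity of \<open>S\<close> suffices.\<close>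

lemma tensor_id_local_sandwich:
  fixes S :: "'a::finite cmat \<Rightarrow> 'b::finite cmat" and X :: "('a \<times> 'r::finite) cmat"
  assumes "superoperator S"
  shows "tensor_id S (kron (mat 1) K ** X ** kron (mat 1) L) =
    kron (mat 1) K ** tensor_id S X ** kron (mat 1) L"
proof (rule cmat_pair_eqI)
  fix b b' :: 'b and r r' :: 'r
  let ?Y = "kron (mat 1) K ** X ** kron (mat 1) L"
  have "block_snd ?Y r r' = (\<Sum>c'\<in>UNIV. \<Sum>c\<in>UNIV. cscale (K $ r $ c * L $ c' $ r') (block_snd X c c'))"
    by (simp add: vec_eq_iff sum_component cscale_def mult_kron_mat_1_left_nth kron_mat_1_left_mult_nth
        sum_distrib_right sum_distrib_left mult_ac)
  then have "tensor_id S ?Y $ (b, r) $ (b', r') =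
     (\<Sum>c'\<in>UNIV. \<Sum>c\<in>UNIV. cscale (K $ r $ c * L $ c' $ r') (S (block_snd X c c'))) $ b $ b'"
    by (simp only: tensor_id_nth superoperatorD[OF assms])
  also have "\<dots> = (kron (mat 1) K ** tensor_id S X ** kron (mat 1) L) $ (b, r) $ (b', r')"
    by (simp add: sum_component cscale_def mult_kron_mat_1_left_nth kron_mat_1_left_mult_nth
        sum_distrib_right sum_distrib_left mult_ac tensor_id_nth)
  finally show "tensor_id S ?Y $ (b, r) $ (b', r') =
     (kron (mat 1) K ** tensor_id S X ** kron (mat 1) L) $ (b, r) $ (b', r')" .
qed

lemma choi_state_nth:
  fixes T :: "('a1::finite \<times> 'a2::finite) cmat \<Rightarrow> 'b::finite cmat"
  assumes "superoperator T"
  shows "choi_state T $ (i, b) $ (j, b') = T (matrix_unit i j) $ b $ b' / of_nat CARD('a1 \<times> 'a2)"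
proof -
  let ?E = "relabel (\<lambda>((a1, a2), (a1', a2')). ((a1', a1), (a2', a2)))
       (kron (epr :: ('a1 \<times> 'a1) cmat) (epr :: ('a2 \<times> 'a2) cmat))"
  have "block_snd ?E i j = cscale (1 / of_nat CARD('a1 \<times> 'a2)) (matrix_unit i j)"
    by (cases i; cases j)
      (auto simp: vec_eq_iff relabel_def kron_def epr_def cscale_def matrix_unit_def card_prod split: prod.splits)
  then show ?thesis
    by (simp add: choi_state_def relabel_def tensor_id_nth superoperatorD[OF assms])
      (simp add: cscale_def)
qed

text \<open>By linearity \<open>T\<close> is determined by its values on matrix units, and these are
  the blocks of the Choi state up to the dimension factor.\<close>

lemma tensor_id_eq_choi_apply:
  fixes T :: "('a1::finite \<times> 'a2::finite) cmat \<Rightarrow> 'b::finite cmat"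
  assumes "superoperator T"
  shows "tensor_id T X = choi_apply (choi_state T) X"
proof (rule cmat_pair_eqI)
  fix b r b' r'
  show "tensor_id T X $ (b, r) $ (b', r') = choi_apply (choi_state T) X $ (b, r) $ (b', r')"
    unfolding tensor_id_nth choi_apply_nth choi_state_nth[OF assms]
    by (subst superoperator_nth[OF assms]) (simp add: sum_distrib_left mult.commute)
qed

lemma psd_epr: "psd (epr :: ('a::finite \<times> 'a) cmat)"
  by (rule psd_gram[where K = "{()}" and b = "\<lambda>_ i. if fst i = snd i then of_real (sqrt (1 / CARD('a))) else 0"])
    (auto simp: epr_def simp flip: of_real_mult)

lemma psd_choi_state: "completely_positive T \<Longrightarrow> psd (choi_state T)"
  unfolding choi_state_def
  by (intro psd_relabel completely_positive_tensor_id psd_kron psd_epr)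

lemma trace_tensor_id: "trace (tensor_id T X) = trace (T (trace_out_snd X))"
  if T: "superoperator T"
proof -
  have "trace_out_snd X = (\<Sum>r\<in>UNIV. block_snd X r r)"
    by (simp add: vec_eq_iff trace_out_snd_def sum_component)
  then have "T (trace_out_snd X) = (\<Sum>r\<in>UNIV. T (block_snd X r r))"
    by (simp only: superoperatorD[OF T])
  then show ?thesis
    by (simp add: trace_def sum_component sum_prod_UNIV tensor_id_nth) (rule sum.swap)
qed

section \<open>Unitarily invariant tensors\<close>

text \<open>A permutation matrix with phases. Invariance under these unitaries shows which entries
  of a tensor vanish and which coincide.\<close>

definition monomial_matrix :: "('n::finite \<Rightarrow> 'n) \<Rightarrow> ('n \<Rightarrow> complex) \<Rightarrow> 'n cmat" where
  "monomial_matrix f v = (\<chi> i j. if j = f i then v i else 0)"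

lemma unitary_monomial_matrix:
  assumes f: "inj f" and v: "\<And>i. cmod (v i) = 1"
  shows "unitary (monomial_matrix f v)"
proof -
  have "v i * cnj (v i) = 1" for i
    using v[of i] by (simp add: complex_norm_square[symmetric])
  then have "monomial_matrix f v ** dagger (monomial_matrix f v) = mat 1"
    using f by (auto simp: vec_eq_iff matrix_matrix_mult_def monomial_matrix_def dagger_nth mat_def
        if_distrib[of "\<lambda>x. x * _"] if_distrib[of cnj] inj_eq cong: if_cong)
  then show ?thesis by (simp add: unitary_def matrix_left_right_inverse)
qed

lemma exists_permutation_2:
  fixes i j k l :: 'a
  assumes "i \<noteq> j" "k \<noteq> l"
  shows "\<exists>f. bij f \<and> f i = k \<and> f j = l"
proof -
  define g where "g = Transposition.transpose i k"
  define f where "f = Transposition.transpose (g j) l \<circ> g"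
  have "g i = k" "bij g" by (auto simp: g_def)
  then have "g j \<noteq> k" using assms(1) by (metis bij_pointE)
  then have "f i = k" "f j = l"
    using assms(2) \<open>g i = k\<close> by (auto simp: f_def transpose_def)
  then show ?thesis using \<open>bij g\<close> by (auto simp: f_def intro!: exI[of _ f] bij_comp)
qed

lemma eq_mult_self_imp_zero: "z = w * z \<Longrightarrow> w \<noteq> 1 \<Longrightarrow> z = (0 :: complex)"
  by (metis mult_cancel_right1)

text \<open>An instance of Schur's lemma by explicit test unitaries: the phase of the imaginary unit
  on a single index kills the off-diagonal entries, and transpositions equate the diagonal
  ones.\<close>

lemma unitarily_invariant_matrix:
  fixes m :: "'n::finite \<Rightarrow> 'n \<Rightarrow> complex"
  assumes inv: "\<And>V i j. unitary V \<Longrightarrow> m i j =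
      (\<Sum>a\<in>UNIV. V $ i $ a * (\<Sum>b\<in>UNIV. cnj (V $ j $ b) * m a b))"
  shows "m i j = (if i = j then (\<Sum>k\<in>UNIV. m k k) / of_nat CARD('n) else 0)"
proof -
  have mon: "m i j = v i * (cnj (v j) * m (f i) (f j))" if "inj f" "\<And>i. cmod (v i) = 1" for f v i j
    by (subst inv[OF unitary_monomial_matrix[of f v, OF that]])
      (simp add: monomial_matrix_def if_distrib[of "\<lambda>x. x * _"] if_distrib[of cnj] cong: if_cong)
  have eq: "m k k = m l l" for k l
    using mon[of "Transposition.transpose k l" "\<lambda>_. 1" k k] by simp
  have "(\<Sum>k\<in>UNIV. m k k) = (\<Sum>k\<in>(UNIV :: 'n set). m i i)"
  proof (rule sum.cong[OF refl])
    show "m k k = m i i" for k by (rule eq)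
  qed
  moreover have "m i j = 0" if "i \<noteq> j"
  proof (rule eq_mult_self_imp_zero)
    show "m i j = \<i> * m i j"
      using mon[of id "\<lambda>k. if k = i then \<i> else 1" i j] that by simp
  qed (simp add: complex_eq_iff)
  ultimately show ?thesis by simp
qed

text \<open>
  A rotation that mixes \<open>p\<close> and \<open>q\<close> with rational coefficients. Together with the monomial
  matrices it forces the invariance under the full unitary group.
\<close>

definition mixing_matrix :: "'n::finite \<Rightarrow> 'n \<Rightarrow> 'n cmat" where
  "mixing_matrix p q = (\<chi> i k.
     if i = p then (if k = p then 3/5 else if k = q then -4/5 else 0)
     else if i = q then (if k = p then -4/5 else if k = q then -3/5 else 0)
     else if k = i then 1 else 0)"

lemma mixing_matrix_rows:
  assumes "p \<noteq> q"
  shows "(\<Sum>k\<in>UNIV. mixing_matrix p q $ p $ k * f k) = 3/5 * f p - 4/5 * f q"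
    "(\<Sum>k\<in>UNIV. mixing_matrix p q $ q $ k * f k) = - 4/5 * f p - 3/5 * f q"
    "i \<noteq> p \<Longrightarrow> i \<noteq> q \<Longrightarrow> (\<Sum>k\<in>UNIV. mixing_matrix p q $ i $ k * f k) = f i"
proof -
  have "(\<Sum>k\<in>UNIV. mixing_matrix p q $ p $ k * f k) =
      (\<Sum>k\<in>UNIV. (if k = p then 3/5 * f k else 0) + (if k = q then - 4/5 * f k else 0))"
    using assms by (intro sum.cong refl) (simp add: mixing_matrix_def)
  then show "(\<Sum>k\<in>UNIV. mixing_matrix p q $ p $ k * f k) = 3/5 * f p - 4/5 * f q"
    by (simp add: sum.distrib)
  have "(\<Sum>k\<in>UNIV. mixing_matrix p q $ q $ k * f k) =
      (\<Sum>k\<in>UNIV. (if k = p then - 4/5 * f k else 0) + (if k = q then - 3/5 * f k else 0))"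
    using assms by (intro sum.cong refl) (simp add: mixing_matrix_def)
  then show "(\<Sum>k\<in>UNIV. mixing_matrix p q $ q $ k * f k) = - 4/5 * f p - 3/5 * f q"
    by (simp add: sum.distrib)
  show "(\<Sum>k\<in>UNIV. mixing_matrix p q $ i $ k * f k) = f i" if "i \<noteq> p" "i \<noteq> q"
    using that by (simp add: mixing_matrix_def if_distrib[of "\<lambda>x. x * _"] cong: if_cong)
qed

lemma cnj_mixing_matrix [simp]: "cnj (mixing_matrix p q $ i $ k) = mixing_matrix p q $ i $ k"
  by (simp add: mixing_matrix_def)

text \<open>The two mixed rows are orthonormal because 3, 4, 5 is a Pythagorean triple.\<close>

lemma unitary_mixing_matrix:
  assumes "p \<noteq> q"
  shows "unitary (mixing_matrix p q)"
proof -
  let ?M = "mixing_matrix p q"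
  have "(?M ** dagger ?M) $ i $ j = mat 1 $ i $ j" for i j
  proof -
    have eq: "(?M ** dagger ?M) $ i $ j = (\<Sum>k\<in>UNIV. ?M $ i $ k * ?M $ j $ k)"
      by (simp add: matrix_matrix_mult_def dagger_nth)
    consider "i = p" | "i = q" | "i \<noteq> p" "i \<noteq> q" by blast
    then show ?thesis
    proof cases
      case 1
      show ?thesis
        unfolding eq unfolding 1 unfolding mixing_matrix_rows[OF assms] using assms
        by (cases "j = p"; cases "j = q") (simp_all add: mixing_matrix_def mat_def)
    next
      case 2
      show ?thesis
        unfolding eq unfolding 2 unfolding mixing_matrix_rows[OF assms] using assms
        by (cases "j = p"; cases "j = q") (simp_all add: mixing_matrix_def mat_def)
    next
      case 3
      show ?thesis
        unfolding eq unfolding mixing_matrix_rows(3)[OF assms 3] using assms 3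
        by (cases "j = p"; cases "j = q") (simp_all add: mixing_matrix_def mat_def)
    qed
  qed
  then have "mixing_matrix p q ** dagger (mixing_matrix p q) = mat 1" by (simp add: vec_eq_iff)
  then show ?thesis by (simp add: unitary_def matrix_left_right_inverse)
qed

text \<open>Weingarten calculus with finitely many test unitaries. Phases leave only entries of the
  types \<open>m i j i j\<close> and \<open>m i i k k\<close>, permutations reduce these to three
  numbers \<alpha>, \<beta> and \<open>c\<close>, and \<open>mixing_matrix\<close> adds the relation
  \<open>c = \<alpha> - \<beta>\<close>. The trace condition then fixes the ratios, and
  \<open>s\<close> the scale.\<close>

lemma unitarily_invariant_tensor:
  fixes m :: "'n::finite \<Rightarrow> 'n \<Rightarrow> 'n \<Rightarrow> 'n \<Rightarrow> complex"
  assumes inv: "\<And>V i j k l. unitary V \<Longrightarrow> m i j k l =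
      (\<Sum>a\<in>UNIV. V $ i $ a * (\<Sum>b\<in>UNIV. cnj (V $ j $ b) *
       (\<Sum>c\<in>UNIV. cnj (V $ k $ c) * (\<Sum>d\<in>UNIV. V $ l $ d * m a b c d))))"
    and tr: "\<And>k l. (\<Sum>i\<in>UNIV. m i i k l) = 0"
    and n: "2 \<le> CARD('n)"
  defines "s \<equiv> \<Sum>i\<in>UNIV. \<Sum>j\<in>UNIV. m i j i j"
  shows "m i j k l = s / of_nat (CARD('n)\<^sup>2 - 1) *
    ((if i = k \<and> j = l then 1 else 0) - (if i = j \<and> k = l then 1 else 0) / of_nat CARD('n))"
proof -
  have mon: "m i j k l = v i * (cnj (v j) * (cnj (v k) * (v l * m (f i) (f j) (f k) (f l))))"
    if "inj f" "\<And>i. cmod (v i) = 1" for f v i j k l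
    by (subst inv[OF unitary_monomial_matrix[of f v, OF that]])
      (simp add: monomial_matrix_def if_distrib[of "\<lambda>x. x * _"] if_distrib[of cnj] cong: if_cong)
  have perm: "m i j k l = m (f i) (f j) (f k) (f l)" if "bij f" for f i j k l
    using mon[of f "\<lambda>_. 1" i j k l] that by (simp add: bij_is_inj)
  \<comment> \<open>The phase is the imaginary unit rather than -1, since a sign would cancel
    against itself when an index occurs twice without conjugation, as for
    \<open>l = i\<close>.\<close>
  have phase: "m i j k l = 0"
    if w: "v = (\<lambda>x. if x = p then \<i> else 1)" "v i * (cnj (v j) * (cnj (v k) * v l)) \<noteq> 1" for v p i j k l
  proof (rule eq_mult_self_imp_zero[OF _ w(2)])
    have "cmod (v i) = 1" for i using w(1) by simp
    then show "m i j k l = v i * (cnj (v j) * (cnj (v k) * v l)) * m i j k l"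
      using mon[of id v i j k l] by (simp only: inj_on_id id_apply mult.assoc)
  qed
  have off: "m i j k l = 0" if "i \<noteq> j" "\<not> (i = k \<and> j = l)" for i j k l
  proof (cases "i = k \<and> i \<noteq> l")
    case True
    show ?thesis
      by (rule phase[OF refl, of i j j k l]) (use that True in \<open>auto simp: complex_eq_iff\<close>)
  next
    case False
    show ?thesis
      by (rule phase[OF refl, of i i j k l]) (use that False in \<open>auto simp: complex_eq_iff\<close>)
  qed
  have off': "m i i k l = 0" if "k \<noteq> l" for i k l
    by (rule phase[OF refl, of i k i k l]) (use that in \<open>auto simp: complex_eq_iff\<close>)
  obtain p q :: 'n where pq: "p \<noteq> q"
    using n by (metis card_le_Suc0_iff_eq finite not_less_eq_eq numeral_2_eq_2 UNIV_I)
  define \<alpha> where "\<alpha> = m p p p p"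
  define \<beta> where "\<beta> = m p p q q"
  define c where "c = m p q p q"
  have \<alpha>: "m i i i i = \<alpha>" for i
    using perm[of "Transposition.transpose i p" i i i i] by (simp add: \<alpha>_def)
  have \<beta>: "m i i j j = \<beta>" and c: "m i j i j = c" if ij: "i \<noteq> j" for i j
  proof -
    obtain f where f: "bij f" "f i = p" "f j = q"
      using exists_permutation_2[OF ij pq] by blast
    show "m i i j j = \<beta>" "m i j i j = c"
      using perm[OF f(1), of i i j j] perm[OF f(1), of i j i j] f by (simp_all add: \<beta>_def c_def)
  qed
  have sums: "(\<Sum>i\<in>UNIV. if i = x then y else z) = y + of_nat (CARD('n) - 1) * z" for x :: 'n and y z :: complex
  proof -
    have "(\<Sum>i\<in>UNIV. if i = x then y else z) = (\<Sum>i\<in>UNIV. z + (if i = x then y - z else 0))"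
      by (intro sum.cong) auto
    also have "\<dots> = of_nat CARD('n) * z + (y - z)"
      by (simp add: sum.distrib)
    finally show ?thesis using n by (simp add: of_nat_diff algebra_simps)
  qed
  have "(\<Sum>i\<in>UNIV. m i i p p) = (\<Sum>i\<in>UNIV. if i = p then \<alpha> else \<beta>)"
    by (intro sum.cong refl) (simp add: \<alpha> \<beta>)
  then have ab: "\<alpha> + of_nat (CARD('n) - 1) * \<beta> = 0"
    using tr[of p p] by (simp only: sums)
  have cab: "c = \<alpha> - \<beta>"
  proof -
    note rows = mixing_matrix_rows[OF pq]
    note expand = inv[OF unitary_mixing_matrix[OF pq], of p q p q, unfolded cnj_mixing_matrix rows]
    have zero: "m p q q p = 0" "m q p p q = 0" "m p p p q = 0" "m p p q p = 0" "m q q p q = 0" "m q q q p = 0"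
      "m p q p p = 0" "m p q q q = 0" "m q p p p = 0" "m q p q q = 0"
      using pq by (auto intro!: off off')
    have "m p p p p = \<alpha>" "m q q q q = \<alpha>" "m p p q q = \<beta>" "m q q p p = \<beta>" "m p q p q = c" "m q p q p = c"
      using pq by (auto simp: \<alpha> \<beta> c)
    \<comment> \<open>With entries 3/5 and 4/5 up to sign, the invariance at \<open>p q p q\<close>
      reads \<open>625 c = 288 (\<alpha> - \<beta>) + 337 c\<close>. Clearing denominators leaves
      the common factor 288 times 625, which is 180000.\<close>
    note expand [unfolded zero this]
    then have "180000 * (\<beta> + c) = 180000 * \<alpha>" by (simp add: field_simps)
    then have "\<beta> + c = \<alpha>" by (simp only: mult_cancel_left) simp
    then show ?thesis by (simp add: algebra_simps)
  qed
  have s: "s = of_nat (CARD('n)\<^sup>2 - 1) * c"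
  proof -
    have "s = (\<Sum>i\<in>(UNIV :: 'n set). \<Sum>j\<in>UNIV. if j = i then \<alpha> else c)"
      unfolding s_def by (intro sum.cong refl) (auto simp: \<alpha> c)
    also have "\<dots> = of_nat CARD('n) * (\<alpha> + of_nat (CARD('n) - 1) * c)"
      by (simp only: sums) simp
    also have "\<dots> = of_nat (CARD('n)\<^sup>2 - 1) * c"
    proof -
      have "\<alpha> = (of_nat CARD('n) - 1) * (c - \<alpha>)"
        using ab n by (simp add: cab of_nat_diff algebra_simps)
      then have "of_nat CARD('n) * \<alpha> = (of_nat CARD('n) - 1) * c" by (simp add: algebra_simps)
      then show ?thesis
        using n by (simp add: of_nat_diff algebra_simps power2_eq_square)
    qed
    finally show ?thesis .
  qed
  have n0: "of_nat (CARD('n)\<^sup>2 - 1) \<noteq> (0 :: complex)"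
  proof -
    have "2\<^sup>2 \<le> CARD('n)\<^sup>2" using n by (rule power_mono) simp
    then show ?thesis unfolding of_nat_eq_0_iff by simp
  qed
  then have sc: "s / of_nat (CARD('n)\<^sup>2 - 1) = c" by (simp add: s)
  have \<beta>': "\<beta> = - c / of_nat CARD('n)"
  proof -
    have "of_nat CARD('n) * \<beta> = - c"
      using ab n by (simp add: cab of_nat_diff algebra_simps)
    then show ?thesis using n by (simp add: field_simps)
  qed
  have \<alpha>': "\<alpha> = c * (1 - 1 / of_nat CARD('n))"
    using cab \<beta>' n by (simp add: field_simps)
  show ?thesis
    unfolding sc
    by (cases "i = j"; cases "k = l"; cases "i = k")
      (use off off' in \<open>auto simp: \<alpha> \<beta> c \<alpha>' \<beta>'\<close>)
qed

section \<open>Moments of Haar random unitaries\<close>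

abbreviation conj_by :: "'n::finite cmat \<Rightarrow> 'n cmat \<Rightarrow> 'n cmat" where
  "conj_by V Y \<equiv> V ** Y ** dagger V"

lemma conj_by_nth: "conj_by V Y $ i $ j = (\<Sum>a\<in>UNIV. V $ i $ a * (\<Sum>b\<in>UNIV. cnj (V $ j $ b) * Y $ a $ b))"
proof -
  have "conj_by V Y $ i $ j = (\<Sum>a\<in>UNIV. V $ i $ a * (\<Sum>b\<in>UNIV. Y $ a $ b * dagger V $ b $ j))"
    unfolding matrix_mul_assoc[symmetric] by (simp add: matrix_matrix_mult_def)
  then show ?thesis by (simp add: dagger_nth mult.commute)
qed

lemma trace_conj_by: "unitary V \<Longrightarrow> trace (conj_by V Y) = trace Y"
  by (rule trace_conj_unitary)

lemma cmod_entry_le_norm: "cmod (X $ i $ j) \<le> norm X"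
  by (meson Finite_Cartesian_Product.norm_nth_le order_trans)

lemma borel_measurable_cnj:
  assumes "f \<in> borel_measurable M"
  shows "(\<lambda>x. cnj (f x)) \<in> borel_measurable M"
  by (rule measurable_compose[OF assms]) (intro borel_measurable_continuous_onI continuous_intros)

text \<open>No distribution is fixed: the smoothing argument is carried out once in this setting and
  serves both a single Haar unitary and the tensor product of two independent ones, which in general
  is not Haar distributed on the joint space.\<close>

locale random_unitary = prob_space M for M :: "'w measure" +
  fixes V :: "'w \<Rightarrow> 'n::finite cmat"
  assumes measurable_entry: "\<And>i j. (\<lambda>\<omega>. V \<omega> $ i $ j) \<in> borel_measurable M"
    and unitary_V: "\<And>\<omega>. \<omega> \<in> space M \<Longrightarrow> unitary (V \<omega>)"
begin

lemma measurable_conj_by: "(\<lambda>\<omega>. conj_by (V \<omega>) Y $ i $ j) \<in> borel_measurable M"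
  unfolding conj_by_nth
  by (intro borel_measurable_sum borel_measurable_times borel_measurable_cnj measurable_entry
      borel_measurable_const)

text \<open>Conjugation preserves the Hilbert-Schmidt norm, so the entries are bounded;
  integrability of all moments on the probability space rests on this.\<close>

lemma conj_by_bound: "\<omega> \<in> space M \<Longrightarrow> cmod (conj_by (V \<omega>) Y $ i $ j) \<le> norm Y"
  using cmod_entry_le_norm[of "conj_by (V \<omega>) Y"] norm_conj_unitary[OF unitary_V] by simp

lemma integrable_conj_by: "integrable M (\<lambda>\<omega>. conj_by (V \<omega>) Y $ i $ j)"
  by (rule integrable_const_bound[where B = "norm Y"])
    (auto intro: conj_by_bound measurable_conj_by)

lemma integrable_conj_by_prod:
  "integrable M (\<lambda>\<omega>. conj_by (V \<omega>) Y $ i $ j * cnj (conj_by (V \<omega>) Y' $ k $ l))"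
  by (rule integrable_const_bound[where B = "norm Y * norm Y'"])
    (auto simp: norm_mult intro!: mult_mono conj_by_bound borel_measurable_times borel_measurable_cnj
        measurable_conj_by)

end

lemma space_haar: "haar_unitary \<mu> \<Longrightarrow> space \<mu> = {U. unitary U}"
  by (auto simp: haar_unitary_def space_restrict_space dest!: sets_eq_imp_space_eq)

lemma haar_random_unitary:
  assumes "haar_unitary \<mu>"
  shows "random_unitary \<mu> (\<lambda>U. U)"
proof -
  have "(\<lambda>U. U $ i $ j) \<in> borel_measurable (borel :: 'a cmat measure)" for i j
    by (intro borel_measurable_continuous_onI continuous_intros)
  then have "(\<lambda>U. U $ i $ j) \<in> borel_measurable (restrict_space borel {U :: 'a cmat. unitary U})" for i j
    by (rule measurable_restrict_space1)
  moreover have "sets \<mu> = sets (restrict_space borel {U. unitary U})"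
    using assms by (simp add: haar_unitary_def)
  ultimately have "(\<lambda>U. U $ i $ j) \<in> borel_measurable \<mu>" for i j
    by (subst measurable_cong_sets[OF _ refl]) auto
  then show ?thesis
    using assms space_haar[OF assms]
    by (auto simp: random_unitary_def random_unitary_axioms_def haar_unitary_def)
qed

lemma haar_left_invariant:
  fixes f :: "'n::finite cmat \<Rightarrow> complex"
  assumes \<mu>: "haar_unitary \<mu>" and V: "unitary V" and f: "f \<in> borel_measurable \<mu>"
  shows "(\<integral>U. f (V ** U) \<partial>\<mu>) = (\<integral>U. f U \<partial>\<mu>)"
proof -
  have "continuous_on UNIV (\<lambda>U :: 'n cmat. V ** U)"
    unfolding matrix_matrix_mult_def by (intro continuous_intros)
  then have "(\<lambda>U :: 'n cmat. V ** U) \<in> measurable borel borel"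
    by (rule borel_measurable_continuous_onI)
  then have "(\<lambda>U. V ** U) \<in> measurable (restrict_space borel {U. unitary U}) (restrict_space borel {U. unitary U})"
    by (rule measurable_restrict_space3) (auto intro: unitary_mult V)
  moreover have s: "sets \<mu> = sets (restrict_space borel {U. unitary U})"
    using \<mu> by (simp add: haar_unitary_def)
  ultimately have "(\<lambda>U. V ** U) \<in> measurable \<mu> \<mu>"
    by (subst measurable_cong_sets[OF s s])
  then have "(\<integral>U. f U \<partial>(distr \<mu> \<mu> (\<lambda>U. V ** U))) = (\<integral>U. f (V ** U) \<partial>\<mu>)"
    by (rule integral_distr) (rule f)
  moreover have "distr \<mu> \<mu> (\<lambda>U. V ** U) = \<mu>"
    using \<mu> V by (simp add: haar_unitary_def)
  ultimately show ?thesis by simp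
qed

lemma conj_by_mult: "conj_by (V ** U) Y = conj_by V (conj_by U Y)"
  by (simp add: dagger_mult matrix_mul_assoc)

text \<open>Left invariance makes the matrix of expectations invariant under conjugation by every
  unitary, so it is a multiple of the identity, and the trace determines which one.\<close>

lemma haar_first_moment:
  fixes Y :: "'n::finite cmat"
  assumes \<mu>: "haar_unitary \<mu>"
  shows "(\<integral>U. conj_by U Y $ i $ j \<partial>\<mu>) = (if i = j then trace Y / of_nat CARD('n) else 0)"
proof -
  interpret random_unitary \<mu> "\<lambda>U. U" by (rule haar_random_unitary[OF \<mu>])
  define m where "m i j = (\<integral>U. conj_by U Y $ i $ j \<partial>\<mu>)" for i j
  have inv: "m i j = (\<Sum>a\<in>UNIV. V $ i $ a * (\<Sum>b\<in>UNIV. cnj (V $ j $ b) * m a b))" if "unitary V" for V i j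
  proof -
    have "m i j = (\<integral>U. conj_by (V ** U) Y $ i $ j \<partial>\<mu>)"
      unfolding m_def by (rule haar_left_invariant[OF \<mu> that measurable_conj_by, symmetric])
    also have "\<dots> = (\<integral>U. (\<Sum>a\<in>UNIV. V $ i $ a * (\<Sum>b\<in>UNIV. cnj (V $ j $ b) * conj_by U Y $ a $ b)) \<partial>\<mu>)"
      by (simp only: conj_by_mult conj_by_nth[of V])
    also have "\<dots> = (\<Sum>a\<in>UNIV. V $ i $ a * (\<Sum>b\<in>UNIV. cnj (V $ j $ b) * m a b))"
      by (simp add: integrable_conj_by m_def)
    finally show ?thesis .
  qed
  have "(\<Sum>k\<in>UNIV. m k k) = (\<integral>U. trace (conj_by U Y) \<partial>\<mu>)"
    by (simp add: m_def trace_def integrable_conj_by)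
  also have "\<dots> = (\<integral>U. trace Y \<partial>\<mu>)"
    by (rule Bochner_Integration.integral_cong[OF refl]) (simp add: trace_conj_by unitary_V)
  also have "\<dots> = trace Y" by (simp add: prob_space)
  finally have tr: "(\<Sum>k\<in>UNIV. m k k) = trace Y" .
  show ?thesis
    using unitarily_invariant_matrix[of m i j, OF inv] unfolding tr by (simp add: m_def)
qed

text \<open>The expectations form a unitarily invariant four-index tensor. Its partial trace
  vanishes because \<open>Y\<close> is traceless, and its full contraction is the Hilbert-Schmidt
  inner product of \<open>Y\<close> and \<open>Y'\<close>, which conjugation by \<open>U\<close>
  does not change.\<close>

lemma haar_second_moment:
  fixes Y Y' :: "'n::finite cmat"
  assumes \<mu>: "haar_unitary \<mu>" and n: "2 \<le> CARD('n)" and Y: "trace Y = 0"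
  shows "(\<integral>U. conj_by U Y $ i $ j * cnj (conj_by U Y' $ k $ l) \<partial>\<mu>) =
    (\<Sum>p\<in>UNIV. \<Sum>q\<in>UNIV. Y $ p $ q * cnj (Y' $ p $ q)) / of_nat (CARD('n)\<^sup>2 - 1) *
    ((if i = k \<and> j = l then 1 else 0) - (if i = j \<and> k = l then 1 else 0) / of_nat CARD('n))"
proof -
  interpret random_unitary \<mu> "\<lambda>U. U" by (rule haar_random_unitary[OF \<mu>])
  define F where "F i j k l U = conj_by U Y $ i $ j * cnj (conj_by U Y' $ k $ l)" for i j k l U
  have F_int: "integrable \<mu> (F i j k l)" for i j k l
    unfolding F_def by (rule integrable_conj_by_prod)
  define m where "m i j k l = (\<integral>U. F i j k l U \<partial>\<mu>)" for i j k l
  have inv: "m i j k l = (\<Sum>a\<in>UNIV. V $ i $ a * (\<Sum>b\<in>UNIV. cnj (V $ j $ b) *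
       (\<Sum>c\<in>UNIV. cnj (V $ k $ c) * (\<Sum>d\<in>UNIV. V $ l $ d * m a b c d))))" if "unitary V" for V i j k l
  proof -
    have "m i j k l = (\<integral>U. F i j k l (V ** U) \<partial>\<mu>)"
      unfolding m_def
      by (rule haar_left_invariant[OF \<mu> that borel_measurable_integrable[OF F_int], symmetric])
    also have "\<dots> = (\<integral>U. (\<Sum>a\<in>UNIV. V $ i $ a * (\<Sum>b\<in>UNIV. cnj (V $ j $ b) *
       (\<Sum>c\<in>UNIV. cnj (V $ k $ c) * (\<Sum>d\<in>UNIV. V $ l $ d * F a b c d U)))) \<partial>\<mu>)"
      unfolding F_def conj_by_mult conj_by_nth[of V]
      by (simp only: sum_distrib_right mult.assoc) (simp add: sum_distrib_left mult_ac)
    also have "\<dots> = (\<Sum>a\<in>UNIV. V $ i $ a * (\<Sum>b\<in>UNIV. cnj (V $ j $ b) *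
       (\<Sum>c\<in>UNIV. cnj (V $ k $ c) * (\<Sum>d\<in>UNIV. V $ l $ d * m a b c d))))"
      by (simp add: F_int m_def)
    finally show ?thesis .
  qed
  have tr: "(\<Sum>i\<in>UNIV. m i i k l) = 0" for k l
  proof -
    have "(\<Sum>i\<in>UNIV. m i i k l) = (\<integral>U. (\<Sum>i\<in>UNIV. F i i k l U) \<partial>\<mu>)"
      by (simp add: m_def F_int)
    also have "\<dots> = (\<integral>U. trace (conj_by U Y) * cnj (conj_by U Y' $ k $ l) \<partial>\<mu>)"
      by (simp add: F_def trace_def sum_distrib_right)
    also have "\<dots> = (\<integral>U. 0 \<partial>\<mu>)"
      by (rule Bochner_Integration.integral_cong[OF refl]) (simp add: trace_conj_by unitary_V Y)
    finally show ?thesis by simp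
  qed
  have inner: "(\<Sum>p\<in>UNIV. \<Sum>q\<in>UNIV. X $ p $ q * cnj (X' $ p $ q)) = trace (dagger X' ** X)" for X X' :: "'n cmat"
    unfolding trace_dagger_mult by (simp add: mult.commute)
  have "(\<Sum>i\<in>UNIV. \<Sum>j\<in>UNIV. m i j i j) = (\<integral>U. (\<Sum>i\<in>UNIV. \<Sum>j\<in>UNIV. F i j i j U) \<partial>\<mu>)"
    by (simp add: m_def F_int)
  also have "\<dots> = (\<integral>U. trace (dagger Y' ** Y) \<partial>\<mu>)"
  proof (rule Bochner_Integration.integral_cong[OF refl])
    fix U assume "U \<in> space \<mu>"
    then have U: "unitary U" by (rule unitary_V)
    show "(\<Sum>i\<in>UNIV. \<Sum>j\<in>UNIV. F i j i j U) = trace (dagger Y' ** Y)"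
      unfolding F_def inner dagger_conj spectral_mult[OF U] trace_conj_unitary[OF U] ..
  qed
  also have "\<dots> = (\<Sum>p\<in>UNIV. \<Sum>q\<in>UNIV. Y $ p $ q * cnj (Y' $ p $ q))"
    by (simp add: inner prob_space)
  finally have s: "(\<Sum>i\<in>UNIV. \<Sum>j\<in>UNIV. m i j i j) = (\<Sum>p\<in>UNIV. \<Sum>q\<in>UNIV. Y $ p $ q * cnj (Y' $ p $ q))" .
  show ?thesis
    using unitarily_invariant_tensor[of m i j k l, OF inv tr n] unfolding s by (simp add: m_def F_def)
qed

section \<open>Second moments of linear forms\<close>

lemma complex_norm_square_sum:
  "of_real ((cmod (\<Sum>x\<in>A. f x))\<^sup>2) = (\<Sum>x\<in>A. \<Sum>y\<in>A. f x * cnj (f y))"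
  by (simp add: complex_norm_square sum_product del: of_real_power)

text \<open>A kernel given as a Gram sum becomes a sum of squares, so that the sign of its
  contribution to a second moment can be read off.\<close>

lemma sum_gram_sandwich:
  "(\<Sum>x\<in>A. \<Sum>y\<in>A. t x * cnj (t y) * (\<Sum>n\<in>N. w n x * cnj (w n y))) =
    of_real (\<Sum>n\<in>N. (cmod (\<Sum>x\<in>A. t x * w n x))\<^sup>2)"
proof -
  have "(\<Sum>x\<in>A. \<Sum>y\<in>A. t x * cnj (t y) * (\<Sum>n\<in>N. w n x * cnj (w n y))) =
      (\<Sum>x\<in>A. \<Sum>y\<in>A. \<Sum>n\<in>N. (t x * w n x) * cnj (t y * w n y))"
    by (simp add: sum_distrib_left mult_ac)
  also have "\<dots> = (\<Sum>x\<in>A. \<Sum>n\<in>N. \<Sum>y\<in>A. (t x * w n x) * cnj (t y * w n y))"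
    by (rule sum.cong[OF refl], rule sum.swap)
  also have "\<dots> = (\<Sum>n\<in>N. \<Sum>x\<in>A. \<Sum>y\<in>A. (t x * w n x) * cnj (t y * w n y))"
    by (rule sum.swap)
  finally show ?thesis by (simp only: complex_norm_square_sum of_real_sum)
qed

context random_unitary
begin

lemma integrable_linear_form_square:
  "integrable M (\<lambda>\<omega>. (cmod (\<Sum>x\<in>A. t x * conj_by (V \<omega>) (Y x) $ (f x) $ (g x)))\<^sup>2)"
proof -
  have "integrable M (\<lambda>\<omega>. \<Sum>x\<in>A. \<Sum>y\<in>A. (t x * cnj (t y)) *
     (conj_by (V \<omega>) (Y x) $ (f x) $ (g x) * cnj (conj_by (V \<omega>) (Y y) $ (f y) $ (g y))))"
    by (intro Bochner_Integration.integrable_sum integrable_mult_right integrable_conj_by_prod)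
  then have "integrable M (\<lambda>\<omega>. Re (\<Sum>x\<in>A. \<Sum>y\<in>A. (t x * cnj (t y)) *
     (conj_by (V \<omega>) (Y x) $ (f x) $ (g x) * cnj (conj_by (V \<omega>) (Y y) $ (f y) $ (g y)))))"
    by (rule integrable_Re)
  moreover have "Re (\<Sum>x\<in>A. \<Sum>y\<in>A. (t x * cnj (t y)) *
     (conj_by (V \<omega>) (Y x) $ (f x) $ (g x) * cnj (conj_by (V \<omega>) (Y y) $ (f y) $ (g y)))) =
     (cmod (\<Sum>x\<in>A. t x * conj_by (V \<omega>) (Y x) $ (f x) $ (g x)))\<^sup>2" for \<omega>
  proof -
    have "complex_of_real ((cmod (\<Sum>x\<in>A. t x * conj_by (V \<omega>) (Y x) $ (f x) $ (g x)))\<^sup>2) =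
     (\<Sum>x\<in>A. \<Sum>y\<in>A. (t x * cnj (t y)) *
     (conj_by (V \<omega>) (Y x) $ (f x) $ (g x) * cnj (conj_by (V \<omega>) (Y y) $ (f y) $ (g y))))"
      unfolding complex_norm_square_sum by (simp add: mult_ac)
    then show ?thesis by (metis Re_complex_of_real)
  qed
  ultimately show ?thesis by simp
qed

end

text \<open>
  Averaging over one unitary while a second system is carried along: the family index \<open>k\<close>
  enumerates the blocks of the second system.
\<close>

lemma haar_linear_form_square_le:
  fixes Y :: "'k::finite \<Rightarrow> 'n::finite cmat" and t :: "'k \<Rightarrow> 'n \<Rightarrow> 'n \<Rightarrow> complex"
  assumes \<mu>: "haar_unitary \<mu>" and n: "2 \<le> CARD('n)" and Y: "\<And>k. trace (Y k) = 0"
  shows "(\<integral>U. (cmod (\<Sum>k\<in>UNIV. \<Sum>i\<in>UNIV. \<Sum>j\<in>UNIV. t k i j * conj_by U (Y k) $ i $ j))\<^sup>2 \<partial>\<mu>) \<le>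
    1 / ((real CARD('n))\<^sup>2 - 1) * (\<Sum>i\<in>UNIV. \<Sum>j\<in>UNIV. \<Sum>p\<in>UNIV. \<Sum>q\<in>UNIV.
      (cmod (\<Sum>k\<in>UNIV. t k i j * Y k $ p $ q))\<^sup>2)"
proof -
  interpret random_unitary \<mu> "\<lambda>U. U" by (rule haar_random_unitary[OF \<mu>])
  define N where "N = CARD('n)"
  define T where "T x = t (fst x) (fst (snd x)) (snd (snd x))" for x :: "'k \<times> 'n \<times> 'n"
  define Z where "Z x U = conj_by U (Y (fst x)) $ (fst (snd x)) $ (snd (snd x))" for x :: "'k \<times> 'n \<times> 'n" and U
  \<comment> \<open>Gram vectors of the two elementary tensors in the second moment:
    \<open>w\<close> for the one with \<open>i = k\<close> and \<open>j = l\<close>, and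
    \<open>v\<close> for the one with \<open>i = j\<close> and \<open>k = l\<close>. Both also carry
    the entries of \<open>Y\<close>.\<close>
  define w where "w n x = (if (fst n) = snd x then Y (fst x) $ fst (snd n) $ snd (snd n) else 0)"
    for n :: "('n \<times> 'n) \<times> ('n \<times> 'n)" and x :: "'k \<times> 'n \<times> 'n"
  define v where "v n x = (if fst (snd x) = snd (snd x) then Y (fst x) $ fst n $ snd n else 0)"
    for n :: "'n \<times> 'n" and x :: "'k \<times> 'n \<times> 'n"
  have lhs: "(\<Sum>k\<in>UNIV. \<Sum>i\<in>UNIV. \<Sum>j\<in>UNIV. t k i j * conj_by U (Y k) $ i $ j) = (\<Sum>x\<in>UNIV. T x * Z x U)" for U
    by (simp add: T_def Z_def UNIV_pair_sum)
  have mom: "(\<integral>U. Z x U * cnj (Z y U) \<partial>\<mu>) = 1 / of_nat (N\<^sup>2 - 1) *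
     ((\<Sum>n\<in>UNIV. w n x * cnj (w n y)) - (\<Sum>n\<in>UNIV. v n x * cnj (v n y)) / of_nat N)" for x y
  proof -
    obtain k i j where x: "x = (k, i, j)" by (metis surj_pair)
    obtain l i' j' where y: "y = (l, i', j')" by (metis surj_pair)
    define s where "s = (\<Sum>p\<in>UNIV. \<Sum>q\<in>UNIV. Y k $ p $ q * cnj (Y l $ p $ q))"
    have s': "s = (\<Sum>n\<in>UNIV. Y k $ fst n $ snd n * cnj (Y l $ fst n $ snd n))"
      by (simp add: s_def UNIV_pair_sum)
    have "(\<Sum>n\<in>UNIV. w n x * cnj (w n y)) = (\<Sum>m\<in>UNIV. \<Sum>n\<in>UNIV.
        if m = (i, j) then if m = (i', j') then Y k $ fst n $ snd n * cnj (Y l $ fst n $ snd n) else 0 else 0)"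
      unfolding UNIV_pair_sum[of "\<lambda>n. w n x * cnj (w n y)"] by (intro sum.cong refl) (simp add: w_def x y)
    also have "\<dots> = (\<Sum>m\<in>UNIV. if m = (i, j) then if m = (i', j') then s else 0 else 0)"
      by (intro sum.cong refl) (auto simp: s')
    also have "\<dots> = s * (if i = i' \<and> j = j' then 1 else 0)"
      by (subst sum.delta) auto
    finally have 1: "(\<Sum>n\<in>UNIV. w n x * cnj (w n y)) = s * (if i = i' \<and> j = j' then 1 else 0)" .
    have 2: "(\<Sum>n\<in>UNIV. v n x * cnj (v n y)) = s * (if i = j \<and> i' = j' then 1 else 0)"
      by (cases "i = j"; cases "i' = j'") (simp_all add: v_def x y s')
    show ?thesis
      unfolding 1 2
      using haar_second_moment[OF \<mu> n Y, of k i j "Y l" i' j'] by (simp add: Z_def x y N_def s_def right_diff_distrib)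
  qed
  define E where "E = (\<integral>U. (cmod (\<Sum>x\<in>UNIV. T x * Z x U))\<^sup>2 \<partial>\<mu>)"
  have "complex_of_real E = (\<integral>U. of_real ((cmod (\<Sum>x\<in>UNIV. T x * Z x U))\<^sup>2) \<partial>\<mu>)"
    unfolding E_def by (rule integral_complex_of_real[symmetric])
  also have "\<dots> = (\<integral>U. (\<Sum>x\<in>UNIV. \<Sum>y\<in>UNIV. T x * cnj (T y) * (Z x U * cnj (Z y U))) \<partial>\<mu>)"
    unfolding complex_norm_square_sum by (simp add: mult_ac)
  also have "\<dots> = (\<Sum>x\<in>UNIV. \<Sum>y\<in>UNIV. T x * cnj (T y) * (\<integral>U. Z x U * cnj (Z y U) \<partial>\<mu>))"
    by (simp add: Z_def integrable_conj_by_prod)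
  also have "\<dots> = 1 / of_nat (N\<^sup>2 - 1) *
     ((\<Sum>x\<in>UNIV. \<Sum>y\<in>UNIV. T x * cnj (T y) * (\<Sum>n\<in>UNIV. w n x * cnj (w n y))) -
      (\<Sum>x\<in>UNIV. \<Sum>y\<in>UNIV. T x * cnj (T y) * (\<Sum>n\<in>UNIV. v n x * cnj (v n y))) / of_nat N)"
  proof -
    have "(\<Sum>x\<in>UNIV. \<Sum>y\<in>UNIV. C x y * (r * (A x y - B x y / z))) =
      r * ((\<Sum>x\<in>UNIV. \<Sum>y\<in>UNIV. C x y * A x y) - (\<Sum>x\<in>UNIV. \<Sum>y\<in>UNIV. C x y * B x y) / z)"
      for C A B :: "'k \<times> 'n \<times> 'n \<Rightarrow> 'k \<times> 'n \<times> 'n \<Rightarrow> complex" and r z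
      by (simp add: sum_subtractf sum_distrib_left right_diff_distrib sum_divide_distrib mult_ac)
    then show ?thesis unfolding mom .
  qed
  also have "\<dots> = of_real (1 / real (N\<^sup>2 - 1) * ((\<Sum>n\<in>UNIV. (cmod (\<Sum>x\<in>UNIV. T x * w n x))\<^sup>2) -
      (\<Sum>n\<in>UNIV. (cmod (\<Sum>x\<in>UNIV. T x * v n x))\<^sup>2) / real N))"
    unfolding sum_gram_sandwich by simp
  finally have "E = 1 / real (N\<^sup>2 - 1) * ((\<Sum>n\<in>UNIV. (cmod (\<Sum>x\<in>UNIV. T x * w n x))\<^sup>2) -
      (\<Sum>n\<in>UNIV. (cmod (\<Sum>x\<in>UNIV. T x * v n x))\<^sup>2) / real N)"
    by (simp only: of_real_eq_iff)
  \<comment> \<open>The part from \<open>v\<close> is a sum of squares with a minus sign, so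
    dropping it gives an upper bound.\<close>
  also have "\<dots> \<le> 1 / real (N\<^sup>2 - 1) * (\<Sum>n\<in>UNIV. (cmod (\<Sum>x\<in>UNIV. T x * w n x))\<^sup>2)"
    by (intro mult_left_mono) (simp_all add: sum_nonneg)
  also have "real (N\<^sup>2 - 1) = (real N)\<^sup>2 - 1"
    using n by (simp add: N_def of_nat_diff)
  also have "(\<Sum>n\<in>UNIV. (cmod (\<Sum>x\<in>UNIV. T x * w n x))\<^sup>2) = (\<Sum>i\<in>UNIV. \<Sum>j\<in>UNIV. \<Sum>p\<in>UNIV. \<Sum>q\<in>UNIV.
      (cmod (\<Sum>k\<in>UNIV. t k i j * Y k $ p $ q))\<^sup>2)"
  proof -
    have "(\<Sum>x\<in>UNIV. T x * w ((i, j), p, q) x) = (\<Sum>k\<in>UNIV. t k i j * Y k $ p $ q)" for i j p q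
    proof -
      have "(\<Sum>x\<in>UNIV. T x * w ((i, j), p, q) x) =
         (\<Sum>k\<in>UNIV. \<Sum>m\<in>UNIV. if m = (i, j) then t k i j * Y k $ p $ q else 0)"
        unfolding UNIV_pair_sum[of "\<lambda>x. T x * w ((i, j), p, q) x"] by (intro sum.cong refl) (auto simp: T_def w_def)
      then show ?thesis by simp
    qed
    then show ?thesis by (simp add: UNIV_pair_sum)
  qed
  finally show ?thesis by (simp only: E_def lhs N_def)
qed

section \<open>Averages over two independent local unitaries\<close>

lemma random_unitary_kron:
  assumes "haar_unitary \<mu>" "haar_unitary \<nu>"
  shows "random_unitary (\<mu> \<Otimes>\<^sub>M \<nu>) (\<lambda>(U1, U2). kron U1 U2)"
proof -
  interpret M1: random_unitary \<mu> "\<lambda>U. U" by (rule haar_random_unitary[OF assms(1)])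
  interpret M2: random_unitary \<nu> "\<lambda>U. U" by (rule haar_random_unitary[OF assms(2)])
  interpret pair_prob_space \<mu> \<nu> ..
  have "(\<lambda>\<omega>. (case \<omega> of (U1, U2) \<Rightarrow> kron U1 U2) $ x $ y) \<in> borel_measurable (\<mu> \<Otimes>\<^sub>M \<nu>)" for x y
  proof -
    have "(\<lambda>\<omega>. fst \<omega> $ fst x $ fst y * snd \<omega> $ snd x $ snd y) \<in> borel_measurable (\<mu> \<Otimes>\<^sub>M \<nu>)"
      by (intro borel_measurable_times measurable_compose[OF measurable_fst M1.measurable_entry]
          measurable_compose[OF measurable_snd M2.measurable_entry])
    then show ?thesis by (simp add: kron_def case_prod_unfold)
  qed
  moreover have "unitary (case \<omega> of (U1, U2) \<Rightarrow> kron U1 U2)" if "\<omega> \<in> space (\<mu> \<Otimes>\<^sub>M \<nu>)" for \<omega>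
    using that M1.unitary_V M2.unitary_V by (auto simp: space_pair_measure intro: unitary_kron)
  ultimately show ?thesis
    by (intro random_unitary.intro random_unitary_axioms.intro prob_space_axioms)
qed

text \<open>Conjugation in two stages, by \<open>U1\<close> on the whole matrix and then by
  \<open>U2\<close> on each block, so that an inner integral over \<open>U2\<close> sees a fixed
  family of blocks.\<close>

lemma conj_by_kron_nth:
  "conj_by (kron U1 U2) Y $ (i1, i2) $ (j1, j2) =
    conj_by U2 (block (conj_by (kron U1 (mat 1)) Y) i1 j1) $ i2 $ j2"
proof -
  have "conj_by (kron U1 U2) Y = kron (mat 1) U2 ** conj_by (kron U1 (mat 1)) Y ** kron (mat 1) (dagger U2)"
  proof -
    have "kron U1 U2 = kron (mat 1) U2 ** kron U1 (mat 1)"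
      "dagger (kron U1 U2) = dagger (kron U1 (mat 1)) ** kron (mat 1) (dagger U2)"
      by (simp_all add: kron_mult dagger_kron)
    then show ?thesis by (simp only: matrix_mul_assoc)
  qed
  then have "block (conj_by (kron U1 U2) Y) i1 j1 = conj_by U2 (block (conj_by (kron U1 (mat 1)) Y) i1 j1)"
    by (simp only: block_local_sandwich)
  then show ?thesis by (simp add: block_def vec_eq_iff)
qed

lemma block_conj_by_kron_nth:
  "block (conj_by (kron U (mat 1)) Y) i j $ p $ q = conj_by U (block_snd Y p q) $ i $ j"
  unfolding tensor_id_conj[symmetric] by (simp add: block_def tensor_id_nth)

text \<open>After Fubini the inner average replaces each block by its trace. These traces are the
  entries of the rotated marginal on the first factor, to which the outer average applies.\<close>

lemma haar_pair_first_moment: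
  fixes Y :: "('m::finite \<times> 'n::finite) cmat"
  assumes \<mu>: "haar_unitary \<mu>" and \<nu>: "haar_unitary \<nu>"
  shows "(\<integral>\<omega>. conj_by (case \<omega> of (U1, U2) \<Rightarrow> kron U1 U2) Y $ x $ y \<partial>(\<mu> \<Otimes>\<^sub>M \<nu>)) =
    (if x = y then trace Y / of_nat CARD('m \<times> 'n) else 0)"
proof -
  interpret M1: random_unitary \<mu> "\<lambda>U. U" by (rule haar_random_unitary[OF \<mu>])
  interpret M2: random_unitary \<nu> "\<lambda>U. U" by (rule haar_random_unitary[OF \<nu>])
  interpret P: random_unitary "\<mu> \<Otimes>\<^sub>M \<nu>" "\<lambda>(U1, U2). kron U1 U2" by (rule random_unitary_kron[OF \<mu> \<nu>])
  interpret pair_prob_space \<mu> \<nu> ..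
  obtain i1 i2 j1 j2 where xy: "x = (i1, i2)" "y = (j1, j2)" by (metis surj_pair)
  have tr: "trace (block (conj_by (kron U1 (mat 1)) Y) i1 j1) = conj_by U1 (trace_out_snd Y) $ i1 $ j1" for U1
    unfolding trace_def block_conj_by_kron_nth
    by (simp add: conj_by_nth trace_out_snd_def sum_distrib_left)
      (subst sum.swap, intro sum.cong refl, rule sum.swap)
  have "(\<integral>\<omega>. conj_by (case \<omega> of (U1, U2) \<Rightarrow> kron U1 U2) Y $ x $ y \<partial>(\<mu> \<Otimes>\<^sub>M \<nu>)) =
      (\<integral>U1. \<integral>U2. conj_by (kron U1 U2) Y $ x $ y \<partial>\<nu> \<partial>\<mu>)"
    using integral_fst'[OF P.integrable_conj_by[of Y x y]] by simp
  also have "\<dots> = (\<integral>U1. (if i2 = j2 then conj_by U1 (trace_out_snd Y) $ i1 $ j1 / of_nat CARD('n) else 0) \<partial>\<mu>)"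
    unfolding xy conj_by_kron_nth haar_first_moment[OF \<nu>] tr ..
  also have "\<dots> = (if i2 = j2 then (\<integral>U1. conj_by U1 (trace_out_snd Y) $ i1 $ j1 \<partial>\<mu>) / of_nat CARD('n) else 0)"
    by simp
  also have "\<dots> = (if x = y then trace Y / of_nat CARD('m \<times> 'n) else 0)"
    unfolding haar_first_moment[OF \<mu>] by (simp add: xy trace_trace_out_snd card_prod)
  finally show ?thesis .
qed

text \<open>Fubini, and the bound for one unitary in each variable. For \<open>U2\<close> the blocks
  are traceless because \<open>trace_out_snd Y = 0\<close>; what remains are squared linear forms in
  \<open>U1\<close>, whose matrices are traceless because
  \<open>trace_out_fst Y = 0\<close>.\<close>

lemma haar_pair_linear_form_square_le:
  fixes Y :: "('m::finite \<times> 'n::finite) cmat" and t :: "('m \<times> 'n) cmat"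
  assumes \<mu>: "haar_unitary \<mu>" and \<nu>: "haar_unitary \<nu>"
    and m: "2 \<le> CARD('m)" and n: "2 \<le> CARD('n)"
    and Y: "trace_out_fst Y = 0" "trace_out_snd Y = 0"
  shows "(\<integral>\<omega>. (cmod (\<Sum>x\<in>UNIV. \<Sum>y\<in>UNIV. t $ x $ y * conj_by (case \<omega> of (U1, U2) \<Rightarrow> kron U1 U2) Y $ x $ y))\<^sup>2
      \<partial>(\<mu> \<Otimes>\<^sub>M \<nu>)) \<le>
    1 / (((real CARD('m))\<^sup>2 - 1) * ((real CARD('n))\<^sup>2 - 1)) * (norm t)\<^sup>2 * (norm Y)\<^sup>2"
proof -
  interpret M1: random_unitary \<mu> "\<lambda>U. U" by (rule haar_random_unitary[OF \<mu>])
  interpret M2: random_unitary \<nu> "\<lambda>U. U" by (rule haar_random_unitary[OF \<nu>])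
  interpret P: random_unitary "\<mu> \<Otimes>\<^sub>M \<nu>" "\<lambda>(U1, U2). kron U1 U2" by (rule random_unitary_kron[OF \<mu> \<nu>])
  interpret pair_prob_space \<mu> \<nu> ..
  define F where "F \<omega> = (cmod (\<Sum>x\<in>UNIV. \<Sum>y\<in>UNIV. t $ x $ y *
      conj_by (case \<omega> of (U1, U2) \<Rightarrow> kron U1 U2) Y $ x $ y))\<^sup>2" for \<omega>
  have F_int: "integrable (\<mu> \<Otimes>\<^sub>M \<nu>) F"
    using P.integrable_linear_form_square[where A = UNIV and
        t = "\<lambda>p. t $ fst p $ snd p" and Y = "\<lambda>_. Y" and f = fst and g = snd]
    by (simp add: F_def[abs_def] UNIV_pair_sum[of "\<lambda>p. t $ fst p $ snd p * _ p"])
  have c: "1 \<le> (real CARD('m))\<^sup>2 - 1" "1 \<le> (real CARD('n))\<^sup>2 - 1"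
    using power_mono[of 2 "real CARD('m)" 2] power_mono[of 2 "real CARD('n)" 2] m n by simp_all
  define T where "T k i j = t $ (fst k, i) $ (snd k, j)" for k :: "'m \<times> 'm" and i j :: 'n
  define B where "B U k = block (conj_by (kron U (mat 1)) Y) (fst k) (snd k)" for U :: "'m cmat" and k :: "'m \<times> 'm"
  define G where "G i j p q U = (cmod (\<Sum>k\<in>UNIV. T k i j * B U k $ p $ q))\<^sup>2" for i j p q U
  have FG: "F (U1, U2) = (cmod (\<Sum>k\<in>UNIV. \<Sum>i\<in>UNIV. \<Sum>j\<in>UNIV. T k i j * conj_by U2 (B U1 k) $ i $ j))\<^sup>2" for U1 U2
  proof -
    have "(\<Sum>x\<in>UNIV. \<Sum>y\<in>UNIV. t $ x $ y * conj_by (kron U1 U2) Y $ x $ y) =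
       (\<Sum>i1\<in>UNIV. \<Sum>i2\<in>UNIV. \<Sum>j1\<in>UNIV. \<Sum>j2\<in>UNIV.
         t $ (i1, i2) $ (j1, j2) * conj_by U2 (B U1 (i1, j1)) $ i2 $ j2)"
      by (simp add: UNIV_pair_sum conj_by_kron_nth B_def)
    also have "\<dots> = (\<Sum>i1\<in>UNIV. \<Sum>j1\<in>UNIV. \<Sum>i2\<in>UNIV. \<Sum>j2\<in>UNIV.
         t $ (i1, i2) $ (j1, j2) * conj_by U2 (B U1 (i1, j1)) $ i2 $ j2)"
      by (rule sum.cong[OF refl], rule sum.swap)
    finally show ?thesis by (simp add: F_def T_def UNIV_pair_sum)
  qed
  have trB: "trace (B U k) = 0" for U k
  proof -
    have "trace (B U k) = conj_by U (trace_out_snd Y) $ fst k $ snd k"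
      unfolding trace_def B_def block_conj_by_kron_nth
      by (simp add: conj_by_nth trace_out_snd_def sum_distrib_left)
        (subst sum.swap, intro sum.cong refl, rule sum.swap)
    then show ?thesis by (simp add: Y)
  qed
  have G_int: "integrable \<mu> (G i j p q)" for i j p q
    using M1.integrable_linear_form_square[where A = UNIV and
        t = "\<lambda>k. T k i j" and Y = "\<lambda>_. block_snd Y p q" and f = fst and g = snd]
    by (simp add: G_def[abs_def] B_def block_conj_by_kron_nth)
  have trY: "trace (block_snd Y p q) = 0" for p q
  proof -
    have "trace (block_snd Y p q) = trace_out_fst Y $ p $ q"
      by (simp add: trace_def trace_out_fst_def)
    then show ?thesis by (simp add: Y)
  qed
  have G_le: "(\<integral>U. G i j p q U \<partial>\<mu>) \<le> 1 / ((real CARD('m))\<^sup>2 - 1) *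
      (\<Sum>k\<in>UNIV. \<Sum>l\<in>UNIV. \<Sum>a\<in>UNIV. \<Sum>b\<in>UNIV.
         (cmod (t $ (k, i) $ (l, j)))\<^sup>2 * (cmod (Y $ (a, p) $ (b, q)))\<^sup>2)" for i j p q
    \<comment> \<open>No further system is carried along at this stage, so the family index is
      \<open>unit\<close>.\<close>
    using haar_linear_form_square_le[OF \<mu> m trY, where t = "\<lambda>_::unit. \<lambda>k l. t $ (k, i) $ (l, j)", of "\<lambda>_. p" "\<lambda>_. q"]
    by (simp add: G_def B_def T_def block_conj_by_kron_nth UNIV_unit UNIV_pair_sum norm_mult power_mult_distrib)
  have nrm: "(\<Sum>i\<in>UNIV. \<Sum>j\<in>UNIV. \<Sum>k\<in>UNIV. \<Sum>l\<in>UNIV. (cmod (X $ (k, i) $ (l, j)))\<^sup>2) = (norm X)\<^sup>2"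
    for X :: "('m \<times> 'n) cmat"
  proof -
    have "(norm X)\<^sup>2 = (\<Sum>i\<in>UNIV. \<Sum>k\<in>UNIV. \<Sum>j\<in>UNIV. \<Sum>l\<in>UNIV. (cmod (X $ (k, i) $ (l, j)))\<^sup>2)"
      by (simp add: norm_cmat_power2 sum_prod_UNIV)
    also have "\<dots> = (\<Sum>i\<in>UNIV. \<Sum>j\<in>UNIV. \<Sum>k\<in>UNIV. \<Sum>l\<in>UNIV. (cmod (X $ (k, i) $ (l, j)))\<^sup>2)"
      by (rule sum.cong[OF refl], rule sum.swap)
    finally show ?thesis ..
  qed
  have "(\<integral>\<omega>. F \<omega> \<partial>(\<mu> \<Otimes>\<^sub>M \<nu>)) = (\<integral>U1. \<integral>U2. F (U1, U2) \<partial>\<nu> \<partial>\<mu>)"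
    by (rule integral_fst'[OF F_int, symmetric])
  also have "\<dots> \<le> (\<integral>U1. 1 / ((real CARD('n))\<^sup>2 - 1) *
      (\<Sum>i\<in>UNIV. \<Sum>j\<in>UNIV. \<Sum>p\<in>UNIV. \<Sum>q\<in>UNIV. G i j p q U1) \<partial>\<mu>)"
  proof (rule integral_mono)
    show "integrable \<mu> (\<lambda>U1. \<integral>U2. F (U1, U2) \<partial>\<nu>)" by (rule integrable_fst'[OF F_int])
    show "integrable \<mu> (\<lambda>U1. 1 / ((real CARD('n))\<^sup>2 - 1) *
      (\<Sum>i\<in>UNIV. \<Sum>j\<in>UNIV. \<Sum>p\<in>UNIV. \<Sum>q\<in>UNIV. G i j p q U1))"
      by (intro integrable_mult_right Bochner_Integration.integrable_sum G_int)
    show "(\<integral>U2. F (U1, U2) \<partial>\<nu>) \<le> 1 / ((real CARD('n))\<^sup>2 - 1) *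
      (\<Sum>i\<in>UNIV. \<Sum>j\<in>UNIV. \<Sum>p\<in>UNIV. \<Sum>q\<in>UNIV. G i j p q U1)" for U1
      unfolding FG G_def by (rule haar_linear_form_square_le[OF \<nu> n trB])
  qed
  also have "\<dots> = 1 / ((real CARD('n))\<^sup>2 - 1) *
      (\<Sum>i\<in>UNIV. \<Sum>j\<in>UNIV. \<Sum>p\<in>UNIV. \<Sum>q\<in>UNIV. (\<integral>U1. G i j p q U1 \<partial>\<mu>))"
    by (simp add: G_int)
  also have "\<dots> \<le> 1 / ((real CARD('n))\<^sup>2 - 1) *
      (\<Sum>i\<in>UNIV. \<Sum>j\<in>UNIV. \<Sum>p\<in>UNIV. \<Sum>q\<in>UNIV. 1 / ((real CARD('m))\<^sup>2 - 1) *
      (\<Sum>k\<in>UNIV. \<Sum>l\<in>UNIV. \<Sum>a\<in>UNIV. \<Sum>b\<in>UNIV.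
         (cmod (t $ (k, i) $ (l, j)))\<^sup>2 * (cmod (Y $ (a, p) $ (b, q)))\<^sup>2))"
    by (intro mult_left_mono sum_mono G_le) (use c in simp)
  also have "\<dots> = 1 / (((real CARD('m))\<^sup>2 - 1) * ((real CARD('n))\<^sup>2 - 1)) *
      ((\<Sum>i\<in>UNIV. \<Sum>j\<in>UNIV. \<Sum>k\<in>UNIV. \<Sum>l\<in>UNIV. (cmod (t $ (k, i) $ (l, j)))\<^sup>2) *
       (\<Sum>p\<in>UNIV. \<Sum>q\<in>UNIV. \<Sum>a\<in>UNIV. \<Sum>b\<in>UNIV. (cmod (Y $ (a, p) $ (b, q)))\<^sup>2))"
    by (simp only: sum_distrib_left[symmetric] sum_distrib_right[symmetric])
       (simp only: mult.commute mult.left_commute mult.assoc,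
        simp only: mult.assoc[symmetric] times_divide_times_eq mult_1)
  finally show ?thesis by (simp only: F_def nrm mult.assoc)
qed

section \<open>Centred superoperators\<close>

definition maximally_mixed :: "'n::finite cmat" where
  "maximally_mixed = cscale (1 / of_nat CARD('n)) (mat 1)"

text \<open>This is \<open>1 - E\<close> for the Haar twirl \<open>E\<close>, the orthogonal
  projection onto the traceless matrices.\<close>

definition centre :: "'n::finite cmat \<Rightarrow> 'n cmat" where
  "centre Y = Y - cscale (trace Y) maximally_mixed"

text \<open>The product of the two one-sided centrings, multiplied out. The plus terms are grouped
  apart from the minus terms because each group is a positive map, also in the presence of a
  reference, which is the splitting that smoothing requires.\<close>

definition centre_pair :: "('m::finite \<times> 'n::finite) cmat \<Rightarrow> ('m \<times> 'n) cmat" where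
  "centre_pair Y = (Y + cscale (trace Y) maximally_mixed) -
    (kron maximally_mixed (trace_out_fst Y) + kron (trace_out_snd Y) maximally_mixed)"

lemma maximally_mixed_nth: "maximally_mixed $ i $ j = (if i = j then 1 / of_nat CARD('n) else 0)"
  for i :: "'n::finite"
  by (simp add: maximally_mixed_def cscale_def mat_def)

lemma trace_maximally_mixed [simp]: "trace maximally_mixed = 1"
  by (simp add: trace_def maximally_mixed_nth)

lemma psd_maximally_mixed: "psd (maximally_mixed :: 'n::finite cmat)"
proof (rule psd_gram[where K = UNIV and b = "\<lambda>k i. if k = i then of_real (sqrt (1 / CARD('n))) else 0"])
  fix i j :: 'n
  have "complex_of_real (1 / CARD('n)) = of_real (sqrt (1 / CARD('n))) * of_real (sqrt (1 / CARD('n)))"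
    by (simp flip: of_real_mult)
  then show "maximally_mixed $ i $ j = (\<Sum>k\<in>UNIV. cnj (if k = i then of_real (sqrt (1 / CARD('n))) else 0) *
      (if k = j then of_real (sqrt (1 / CARD('n))) else 0))"
    by (simp add: maximally_mixed_nth if_distrib[of cnj] if_distrib[of "\<lambda>x. x * _"] cong: if_cong)
qed

lemma superoperator_add: "superoperator S \<Longrightarrow> superoperator S' \<Longrightarrow> superoperator (\<lambda>Y. S Y + S' Y)"
  by (simp add: superoperator_def) (simp add: cscale_def vec_eq_iff distrib_left)

lemma superoperator_diff: "superoperator S \<Longrightarrow> superoperator S' \<Longrightarrow> superoperator (\<lambda>Y. S Y - S' Y)"
  by (simp add: superoperator_def) (simp add: cscale_def vec_eq_iff right_diff_distrib)

lemma superoperator_id: "superoperator (\<lambda>Y. Y)"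
  by (simp add: superoperator_def)

lemma superoperator_trace_mixed: "superoperator (\<lambda>Y. cscale (trace Y) maximally_mixed)"
  by (simp add: superoperator_def vec_eq_iff cscale_def trace_def sum.distrib distrib_right sum_distrib_left mult.assoc)

lemma superoperator_kron_mixed_left: "superoperator (\<lambda>Y. kron maximally_mixed (trace_out_fst Y))"
  by (simp add: superoperator_def vec_eq_iff cscale_def kron_def trace_out_fst_def sum.distrib distrib_left
      sum_distrib_left mult.left_commute)

lemma superoperator_kron_mixed_right: "superoperator (\<lambda>Y. kron (trace_out_snd Y) maximally_mixed)"
  by (simp add: superoperator_def vec_eq_iff cscale_def kron_def trace_out_snd_def sum.distrib distrib_right
      sum_distrib_left sum_distrib_right mult.assoc)

lemma superoperator_conj_by: "superoperator (conj_by V)"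
  by (simp add: superoperator_def vec_eq_iff conj_by_nth cscale_def sum.distrib distrib_left sum_distrib_left mult_ac)

lemma trace_out_snd_tensor_id:
  assumes "superoperator S"
  shows "trace_out_snd (tensor_id S X) = S (trace_out_snd X)"
proof -
  have blocks: "trace_out_snd X = (\<Sum>r\<in>UNIV. block_snd X r r)" for X :: "('x::finite \<times> 'c::finite) cmat"
    by (simp add: vec_eq_iff trace_out_snd_def sum_component)
  show ?thesis
    unfolding blocks[of "tensor_id S X"] block_snd_tensor_id
    by (simp only: superoperatorD(5)[OF assms, symmetric] blocks[symmetric])
qed

lemma tensor_id_add: "tensor_id (\<lambda>Y. S Y + S' Y) X = tensor_id S X + tensor_id S' X"
  by (simp add: tensor_id_def vec_eq_iff)

lemma tensor_id_diff: "tensor_id (\<lambda>Y. S Y - S' Y) X = tensor_id S X - tensor_id S' X"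
  by (simp add: tensor_id_def vec_eq_iff)

lemma tensor_id_id: "tensor_id (\<lambda>Y. Y) X = X"
  by (rule cmat_pair_eqI) (simp add: tensor_id_nth)

lemma tensor_id_trace_mixed: "tensor_id (\<lambda>Y. cscale (trace Y) maximally_mixed) X = kron maximally_mixed (trace_out_fst X)"
  by (rule cmat_pair_eqI) (simp add: tensor_id_nth cscale_def trace_def trace_out_fst_def)

lemma bij_assoc_swap: "bij (\<lambda>((i, j), k). ((i, k), j))" "bij (\<lambda>((i, j), k). (i, (j, k)))"
  by (rule bij_betw_byWitness[where f' = "\<lambda>((i, k), j). ((i, j), k)"], auto)
    (rule bij_betw_byWitness[where f' = "\<lambda>(i, (j, k)). ((i, j), k)"], auto)

lemma tensor_id_kron_right:
  "tensor_id (\<lambda>Y. kron Y Z) X = relabel (\<lambda>((i, j), k). ((i, k), j)) (kron X Z)"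
  by (auto simp: tensor_id_def relabel_def kron_def vec_eq_iff)

lemma tensor_id_kron_left:
  "tensor_id (\<lambda>Y. kron Z Y) X = relabel (\<lambda>((i, j), k). (i, (j, k))) (kron Z X)"
  by (auto simp: tensor_id_def relabel_def kron_def vec_eq_iff)

lemma psd_tensor_id_kron:
  assumes "psd X" "psd Z"
  shows "psd (tensor_id (\<lambda>Y. kron Y Z) X)" "psd (tensor_id (\<lambda>Y. kron Z Y) X)"
  unfolding tensor_id_kron_left tensor_id_kron_right using assms by (auto intro: psd_relabel psd_kron)

lemma trace_tensor_id_kron:
  "trace (tensor_id (\<lambda>Y. kron Y Z) X) = trace X * trace Z"
  "trace (tensor_id (\<lambda>Y. kron Z Y) X) = trace X * trace Z"
  unfolding tensor_id_kron_left tensor_id_kron_right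
  by (simp_all add: trace_relabel bij_assoc_swap trace_kron)

lemma block_snd_marginal1: "block_snd (marginal1 X) r r' = trace_out_snd (block_snd X r r')"
  by (simp add: vec_eq_iff marginal1_nth trace_out_snd_def)

lemma block_snd_marginal2: "block_snd (marginal2 X) r r' = trace_out_fst (block_snd X r r')"
  by (simp add: vec_eq_iff marginal2_nth trace_out_fst_def)

lemma tensor_id_trace_out_snd: "tensor_id (\<lambda>Y. S (trace_out_snd Y)) X = tensor_id S (marginal1 X)"
  by (rule cmat_pair_eqI) (simp only: tensor_id_nth block_snd_marginal1)

lemma tensor_id_trace_out_fst: "tensor_id (\<lambda>Y. S (trace_out_fst Y)) X = tensor_id S (marginal2 X)"
  by (rule cmat_pair_eqI) (simp only: tensor_id_nth block_snd_marginal2)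

section \<open>Norms and partial traces of centred matrices\<close>

lemma trace_centre: "trace (centre Y) = 0"
  by (simp add: centre_def trace_sub) (simp add: trace_def cscale_def maximally_mixed_nth)

text \<open>Pythagoras: the removed multiple of the identity is orthogonal to the traceless
  remainder.\<close>

lemma norm_centre_le: "norm (centre Y) \<le> norm Y"
proof -
  let ?Z = "cscale (trace Y) (maximally_mixed :: 'a cmat)"
  have dZ: "trace (dagger ?Z ** X) = cnj (trace Y) / of_nat CARD('a) * trace X" for X :: "'a cmat"
    unfolding trace_dagger_mult
    by (simp add: cscale_def maximally_mixed_nth trace_def if_distrib[of "\<lambda>x. _ * x"] if_distrib[of cnj]
        if_distrib[of "\<lambda>x. x * _"] sum_distrib_left cong: if_cong)
  have "trace (dagger ?Z ** centre Y) = 0" by (simp add: dZ trace_centre)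
  moreover have "trace (dagger (centre Y) ** ?Z) = cnj (trace (dagger ?Z ** centre Y))"
    unfolding trace_dagger_mult by (simp add: mult.commute)
  moreover have "dagger Y ** Y = dagger (centre Y) ** centre Y + dagger ?Z ** centre Y +
      dagger (centre Y) ** ?Z + dagger ?Z ** ?Z"
  proof -
    have Y: "Y = centre Y + ?Z" by (simp add: centre_def)
    have "dagger (A + B) ** (A + B) = dagger A ** A + dagger B ** A + dagger A ** B + dagger B ** B" for A B :: "'a cmat"
      by (simp add: vec_eq_iff matrix_matrix_mult_def dagger_nth algebra_simps sum.distrib)
    from this[of "centre Y" ?Z] show ?thesis by (simp only: Y[symmetric])
  qed
  ultimately have "trace (dagger Y ** Y) = trace (dagger (centre Y) ** centre Y) + trace (dagger ?Z ** ?Z)"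
    by (simp add: trace_add)
  then have "complex_of_real ((norm Y)\<^sup>2) = of_real ((norm (centre Y))\<^sup>2 + (norm ?Z)\<^sup>2)"
    by (simp only: norm_cmat_trace of_real_add)
  then have "(norm Y)\<^sup>2 = (norm (centre Y))\<^sup>2 + (norm ?Z)\<^sup>2" by (simp only: of_real_eq_iff)
  then have "(norm (centre Y))\<^sup>2 \<le> (norm Y)\<^sup>2" by simp
  then show ?thesis by (simp add: power2_le_iff_abs_le)
qed

lemma norm_power2_blocks: "(norm X)\<^sup>2 = (\<Sum>r\<in>UNIV. \<Sum>r'\<in>UNIV. (norm (block_snd X r r'))\<^sup>2)"
  for X :: "('a::finite \<times> 'r::finite) cmat"
proof -
  have "(norm X)\<^sup>2 = (\<Sum>r\<in>UNIV. \<Sum>i\<in>UNIV. \<Sum>r'\<in>UNIV. \<Sum>j\<in>UNIV. (cmod (X $ (i, r) $ (j, r')))\<^sup>2)"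
    by (simp add: norm_cmat_power2 sum_prod_UNIV)
  also have "\<dots> = (\<Sum>r\<in>UNIV. \<Sum>r'\<in>UNIV. \<Sum>i\<in>UNIV. \<Sum>j\<in>UNIV. (cmod (X $ (i, r) $ (j, r')))\<^sup>2)"
    by (rule sum.cong[OF refl], rule sum.swap)
  finally show ?thesis by (simp add: norm_cmat_power2)
qed

lemma norm_tensor_id_centre_le: "norm (tensor_id centre X) \<le> norm X"
proof -
  have "(norm (tensor_id centre X))\<^sup>2 \<le> (norm X)\<^sup>2"
    unfolding norm_power2_blocks block_snd_tensor_id
    by (intro sum_mono power_mono norm_centre_le norm_ge_zero)
  then show ?thesis by (simp add: power2_le_iff_abs_le)
qed

lemma norm_relabel_swap: "norm (relabel prod.swap X) = norm X"
  for X :: "('a::finite \<times> 'r::finite) cmat"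
proof -
  have "(norm (relabel prod.swap X))\<^sup>2 = (norm X)\<^sup>2"
    unfolding norm_cmat_power2 UNIV_pair_sum[where ?'a = 'r] sum_prod_UNIV[where ?'a = 'a]
    by (simp add: relabel_def)
  then show ?thesis by simp
qed

lemma tensor_id_centre_nth: "tensor_id centre X $ (i, r) $ (j, r') =
    X $ (i, r) $ (j, r') - (if i = j then (\<Sum>k\<in>UNIV. X $ (k, r) $ (k, r')) / of_nat CARD('a) else 0)"
  for X :: "('a::finite \<times> 'r::finite) cmat"
  by (simp add: tensor_id_nth centre_def cscale_def maximally_mixed_nth trace_def)

text \<open>Centring one factor at a time, with a swap to reach the second. The norm bound and the
  vanishing partial traces thereby reduce to a single factor.\<close>

lemma centre_pair_eq:
  fixes Y :: "('a::finite \<times> 'b::finite) cmat"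
  shows "centre_pair Y = tensor_id centre (relabel prod.swap (tensor_id centre (relabel prod.swap Y)))"
  by (rule cmat_pair_eqI)
    (simp add: centre_pair_def tensor_id_centre_nth relabel_def kron_def cscale_def maximally_mixed_nth
      trace_out_fst_def trace_out_snd_def trace_def sum_prod_UNIV card_prod sum_subtractf diff_divide_distrib
      sum_divide_distrib sum.swap[of _ "UNIV :: 'b set" "UNIV :: 'a set"] mult.commute)

lemma norm_centre_pair_le: "norm (centre_pair Y) \<le> norm Y"
proof -
  have "norm (centre_pair Y) \<le> norm (tensor_id centre (relabel prod.swap Y))"
    unfolding centre_pair_eq by (rule order_trans[OF norm_tensor_id_centre_le]) (simp only: norm_relabel_swap order_refl)
  also have "\<dots> \<le> norm Y"
    by (rule order_trans[OF norm_tensor_id_centre_le]) (simp only: norm_relabel_swap order_refl)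
  finally show ?thesis .
qed

lemma trace_out_fst_tensor_id_centre: "trace_out_fst (tensor_id centre X) = 0"
proof -
  have "trace_out_fst (tensor_id centre X) $ i $ j = trace (centre (block_snd X i j))" for i j
    by (simp add: trace_out_fst_def trace_def tensor_id_nth)
  then show ?thesis by (simp add: vec_eq_iff trace_centre)
qed

lemma superoperator_centre: "superoperator centre"
  using superoperator_diff[OF superoperator_id superoperator_trace_mixed] by (simp add: centre_def[abs_def])

lemma trace_out_snd_relabel_swap: "trace_out_snd (relabel prod.swap X) = trace_out_fst X"
  by (simp add: trace_out_snd_def trace_out_fst_def relabel_def)

lemma trace_out_centre_pair:
  "trace_out_fst (centre_pair Y) = 0" "trace_out_snd (centre_pair Y) = 0"
proof -
  show "trace_out_fst (centre_pair Y) = 0"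
    unfolding centre_pair_eq by (rule trace_out_fst_tensor_id_centre)
  show "trace_out_snd (centre_pair Y) = 0"
    unfolding centre_pair_eq
    by (simp add: trace_out_snd_relabel_swap trace_out_snd_tensor_id[OF superoperator_centre] trace_out_fst_tensor_id_centre
        superoperatorD(4)[OF superoperator_centre])
qed

section \<open>Smoothed decoupling of a single term\<close>

text \<open>Jensen's inequality for the square root, read off from the nonnegative variance of
  \<open>sqrt (f x)\<close>; integrability comes from
  \<open>sqrt (f x) \<le> f x + 1\<close>.\<close>

lemma (in prob_space) expectation_sqrt_le:
  fixes f :: "'a \<Rightarrow> real"
  assumes f: "integrable M f" and nonneg: "\<And>x. 0 \<le> f x"
  shows "integrable M (\<lambda>x. sqrt (f x))" "(\<integral>x. sqrt (f x) \<partial>M) \<le> sqrt (\<integral>x. f x \<partial>M)"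
proof -
  show int: "integrable M (\<lambda>x. sqrt (f x))"
  proof (rule Bochner_Integration.integrable_bound)
    show "integrable M (\<lambda>x. f x + 1)" using f by simp
    show "(\<lambda>x. sqrt (f x)) \<in> borel_measurable M"
      using borel_measurable_integrable[OF f] by measurable
    have "sqrt (f x) \<le> f x + 1" for x
    proof (cases "f x \<le> 1")
      case True
      then have "sqrt (f x) \<le> 1" by simp
      then show ?thesis using nonneg[of x] by linarith
    next
      case False
      then have "sqrt (f x) \<le> sqrt ((f x)\<^sup>2)" by (intro real_sqrt_le_mono) (simp add: power2_eq_square)
      then show ?thesis using nonneg[of x] by simp
    qed
    then show "AE x in M. norm (sqrt (f x)) \<le> norm (f x + 1)"
      using nonneg by (intro AE_I2) (simp add: add_nonneg_nonneg)
  qed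
  have "0 \<le> variance (\<lambda>x. sqrt (f x))" by (rule variance_positive)
  also have "\<dots> = (\<integral>x. f x \<partial>M) - (\<integral>x. sqrt (f x) \<partial>M)\<^sup>2"
    using variance_eq[OF int] f nonneg by simp
  finally have "(\<integral>x. sqrt (f x) \<partial>M)\<^sup>2 \<le> (\<integral>x. f x \<partial>M)" by simp
  then show "(\<integral>x. sqrt (f x) \<partial>M) \<le> sqrt (\<integral>x. f x \<partial>M)"
    by (rule real_le_rsqrt)
qed

text \<open>Under the support condition the Hilbert-Schmidt norm of this matrix is 2 to the power of
  half the divergence.\<close>

definition weighted :: "'n::finite cmat \<Rightarrow> 'n cmat \<Rightarrow> 'n cmat" where
  "weighted \<beta> \<alpha> = mpow \<beta> (-1/4) ** \<alpha> ** mpow \<beta> (-1/4)"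

text \<open>A feasible point of the smoothed divergence at which the divergence is below infinity.
  The reference is the marginal of the unsmoothed state.\<close>

definition smoothing ::
    "real \<Rightarrow> ('a::finite \<times> 'c::finite) cmat \<Rightarrow> ('a \<times> 'c) cmat \<Rightarrow> bool" where
  "smoothing \<epsilon> \<alpha> \<alpha>' \<longleftrightarrow> subnormalised \<alpha>' \<and> schatten 1 (\<alpha>' - \<alpha>) \<le> \<epsilon> * Re (trace \<alpha>) \<and>
     supp \<alpha>' \<subseteq> supp (kron (mat 1) (trace_out_fst \<alpha>))"

lemma psd_weighted:
  assumes "psd \<alpha>" "psd \<beta>"
  shows "psd (weighted \<beta> \<alpha>)"
  using psd_conj[OF assms(1), of "mpow \<beta> (-1/4)"]
  by (simp add: weighted_def mpow_hermitian[OF assms(2)])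

lemma smoothing_factorisation:
  assumes s: "smoothing \<epsilon> \<alpha> \<alpha>'" and \<alpha>: "psd \<alpha>"
  defines "w \<equiv> mpow (trace_out_fst \<alpha>) (1/4)"
  shows "\<alpha>' = kron (mat 1) w ** weighted (kron (mat 1) (trace_out_fst \<alpha>)) \<alpha>' ** kron (mat 1) w"
proof -
  have "psd (kron (mat 1) (trace_out_fst \<alpha>))"
    by (intro psd_kron psd_mat_1 psd_trace_out_fst \<alpha>)
  from mpow_quarter_sandwich[OF this, of \<alpha>'] show ?thesis
    using s unfolding weighted_def w_def mpow_kron_mat_1[OF psd_trace_out_fst[OF \<alpha>]]
    by (simp add: smoothing_def subnormalised_def psd_hermitian)
qed

text \<open>The smoothing error is relative to the trace of \<alpha>, which is at most 1; its Jordan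
  decomposition supplies \<open>P\<close> and \<open>N\<close>.\<close>

lemma smoothing_decomposition:
  assumes s: "smoothing \<epsilon> \<alpha> \<alpha>'" and \<alpha>: "subnormalised \<alpha>" and \<epsilon>: "0 \<le> \<epsilon>"
  obtains P N where "psd P" "psd N" "\<alpha> = \<alpha>' + (P - N)" "Re (trace P) + Re (trace N) \<le> \<epsilon>"
proof -
  have "dagger (\<alpha>' - \<alpha>) = \<alpha>' - \<alpha>"
    using s \<alpha> by (simp add: smoothing_def subnormalised_def dagger_diff psd_hermitian)
  then obtain P N where PN: "psd P" "psd N" "\<alpha>' - \<alpha> = P - N"
    "schatten 1 (\<alpha>' - \<alpha>) = Re (trace P) + Re (trace N)"
    using schatten_1_decomposition by blast
  have "\<epsilon> * Re (trace \<alpha>) \<le> \<epsilon> * 1"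
    using \<alpha> \<epsilon> by (intro mult_left_mono) (auto simp: subnormalised_def)
  then have "Re (trace N) + Re (trace P) \<le> \<epsilon>"
    using s PN(4) by (simp add: smoothing_def)
  moreover have "\<alpha> = \<alpha>' + (N - P)" using PN(3) by (simp add: algebra_simps)
  ultimately show thesis using that[of N P] PN by blast
qed

lemma hermitian_choi_apply_diff:
  assumes "psd \<tau>" "psd X" "psd Y"
  shows "dagger (choi_apply \<tau> (X - Y)) = choi_apply \<tau> (X - Y)"
  using assms by (simp add: dagger_choi_apply dagger_diff psd_hermitian)

context random_unitary
begin

text \<open>On average the rotated marginal is maximally mixed on the contracted system, and then
  the trace of the contraction factorises.\<close>

lemma expectation_trace_choi_apply:
  fixes \<Delta> :: "('n \<times> 'b::finite) cmat" and X :: "('n \<times> 'r::finite) cmat"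
  assumes first: "\<And>Y i j. (\<integral>\<omega>. conj_by (V \<omega>) Y $ i $ j \<partial>M) = (if i = j then trace Y / of_nat CARD('n) else 0)"
    and \<Delta>: "psd \<Delta>" and X: "psd X"
  shows "integrable M (\<lambda>\<omega>. Re (trace (choi_apply \<Delta> (tensor_id (conj_by (V \<omega>)) X))))"
    and "(\<integral>\<omega>. Re (trace (choi_apply \<Delta> (tensor_id (conj_by (V \<omega>)) X))) \<partial>M) = Re (trace \<Delta>) * Re (trace X)"
proof -
  have eq: "trace (choi_apply \<Delta> (tensor_id (conj_by (V \<omega>)) X)) = of_nat CARD('n) *
     (\<Sum>i\<in>UNIV. \<Sum>j\<in>UNIV. trace_out_snd \<Delta> $ i $ j * conj_by (V \<omega>) (trace_out_snd X) $ i $ j)" for \<omega>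
    by (simp add: trace_choi_apply trace_out_snd_tensor_id[OF superoperator_conj_by])
  have int: "integrable M (\<lambda>\<omega>. trace (choi_apply \<Delta> (tensor_id (conj_by (V \<omega>)) X)))"
    unfolding eq by (intro integrable_mult_right Bochner_Integration.integrable_sum integrable_conj_by)
  then show "integrable M (\<lambda>\<omega>. Re (trace (choi_apply \<Delta> (tensor_id (conj_by (V \<omega>)) X))))"
    by (rule integrable_Re)
  have "(\<integral>\<omega>. trace (choi_apply \<Delta> (tensor_id (conj_by (V \<omega>)) X)) \<partial>M) = of_nat CARD('n) *
     (\<Sum>i\<in>UNIV. \<Sum>j\<in>UNIV. trace_out_snd \<Delta> $ i $ j * (\<integral>\<omega>. conj_by (V \<omega>) (trace_out_snd X) $ i $ j \<partial>M))"
    unfolding eq by (simp add: integrable_conj_by)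
  also have "\<dots> = trace (trace_out_snd \<Delta>) * trace (trace_out_snd X)"
    unfolding first by (simp add: trace_def[of "trace_out_snd \<Delta>"] sum_distrib_left sum_distrib_right
        if_distrib[of "\<lambda>x. _ * x"] cong: if_cong)
  also have "\<dots> = trace \<Delta> * trace X" by (simp only: trace_trace_out_snd)
  finally have *: "(\<integral>\<omega>. trace (choi_apply \<Delta> (tensor_id (conj_by (V \<omega>)) X)) \<partial>M) = trace \<Delta> * trace X" .
  \<comment> \<open>The trace of a positive matrix is real, which lets the real part of the product
    of traces split.\<close>
  have real: "Im (trace Z) = 0" if "psd Z" for Z :: "'z::finite cmat"
  proof -
    have "cnj (trace Z) = trace (dagger Z)" by (simp add: trace_def dagger_nth)
    then show ?thesis using psd_hermitian[OF that] by (metis Reals_cnj_iff complex_is_Real_iff)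
  qed
  show "(\<integral>\<omega>. Re (trace (choi_apply \<Delta> (tensor_id (conj_by (V \<omega>)) X))) \<partial>M) = Re (trace \<Delta>) * Re (trace X)"
    using integral_Re[OF int] by (simp add: * real[OF X])
qed

lemma integrable_bilinear_form_square:
  "integrable M (\<lambda>\<omega>. (cmod (\<Sum>i\<in>UNIV. \<Sum>j\<in>UNIV. t i j * conj_by (V \<omega>) Y $ i $ j))\<^sup>2)"
  using integrable_linear_form_square[where A = UNIV and t = "\<lambda>p. t (fst p) (snd p)" and Y = "\<lambda>_. Y"
      and f = fst and g = snd]
  by (simp add: UNIV_pair_sum[where ?'a = 'n and ?'b = 'n])

text \<open>The squared norm splits over the blocks in B and R, each of which is a bilinear form
  covered by \<open>second\<close>. The dimension in \<open>\<kappa> / real CARD('n)\<close> cancels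
  the prefactor of \<open>choi_apply\<close>, and Jensen passes from the squared norm to the
  norm.\<close>

lemma expectation_norm_choi_apply_le:
  fixes \<tau> :: "('n \<times> 'b::finite) cmat" and \<rho> :: "('n \<times> 'r::finite) cmat"
  assumes second: "\<And>t Y. (\<integral>\<omega>. (cmod (\<Sum>i\<in>UNIV. \<Sum>j\<in>UNIV. t $ i $ j * conj_by (V \<omega>) (G Y) $ i $ j))\<^sup>2 \<partial>M)
      \<le> (\<kappa> / real CARD('n))\<^sup>2 * (norm t)\<^sup>2 * (norm Y)\<^sup>2"
    and \<kappa>: "0 \<le> \<kappa>"
  shows "integrable M (\<lambda>\<omega>. norm (choi_apply \<tau> (tensor_id (\<lambda>Y. conj_by (V \<omega>) (G Y)) \<rho>)))"
    and "(\<integral>\<omega>. norm (choi_apply \<tau> (tensor_id (\<lambda>Y. conj_by (V \<omega>) (G Y)) \<rho>)) \<partial>M) \<le> \<kappa> * norm \<tau> * norm \<rho>"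
proof -
  define N where "N \<omega> = choi_apply \<tau> (tensor_id (\<lambda>Y. conj_by (V \<omega>) (G Y)) \<rho>)" for \<omega>
  define F where "F b r b' r' \<omega> = (cmod (\<Sum>i\<in>UNIV. \<Sum>j\<in>UNIV.
      block_snd \<tau> b b' $ i $ j * conj_by (V \<omega>) (G (block_snd \<rho> r r')) $ i $ j))\<^sup>2" for b r b' r' \<omega>
  have N2: "(norm (N \<omega>))\<^sup>2 = (real CARD('n))\<^sup>2 *
      (\<Sum>b\<in>UNIV. \<Sum>r\<in>UNIV. \<Sum>b'\<in>UNIV. \<Sum>r'\<in>UNIV. F b r b' r' \<omega>)" for \<omega>
    by (simp add: norm_cmat_power2 UNIV_pair_sum[where ?'a = 'b and ?'b = 'r] N_def F_def choi_apply_nth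
        tensor_id_nth norm_mult power_mult_distrib sum_distrib_left[of "(real CARD('n))\<^sup>2"])
  have F_int: "integrable M (F b r b' r')" for b r b' r'
    unfolding F_def using integrable_bilinear_form_square[of "\<lambda>i j. block_snd \<tau> b b' $ i $ j"] by simp
  have int: "integrable M (\<lambda>\<omega>. (norm (N \<omega>))\<^sup>2)"
    unfolding N2 by (intro integrable_mult_right Bochner_Integration.integrable_sum F_int)
  have "(\<integral>\<omega>. (norm (N \<omega>))\<^sup>2 \<partial>M) = (real CARD('n))\<^sup>2 *
      (\<Sum>b\<in>UNIV. \<Sum>r\<in>UNIV. \<Sum>b'\<in>UNIV. \<Sum>r'\<in>UNIV. (\<integral>\<omega>. F b r b' r' \<omega> \<partial>M))"
    unfolding N2 by (simp add: F_int)
  also have "\<dots> \<le> (real CARD('n))\<^sup>2 * (\<Sum>b\<in>UNIV. \<Sum>r\<in>UNIV. \<Sum>b'\<in>UNIV. \<Sum>r'\<in>UNIV.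
      (\<kappa> / real CARD('n))\<^sup>2 * (norm (block_snd \<tau> b b'))\<^sup>2 * (norm (block_snd \<rho> r r'))\<^sup>2)"
    unfolding F_def by (intro mult_left_mono sum_mono second) simp
  also have "(\<Sum>b\<in>UNIV. \<Sum>r\<in>UNIV. \<Sum>b'\<in>UNIV. \<Sum>r'\<in>UNIV.
      (\<kappa> / real CARD('n))\<^sup>2 * (norm (block_snd \<tau> b b'))\<^sup>2 * (norm (block_snd \<rho> r r'))\<^sup>2) =
     (\<Sum>b\<in>UNIV. \<Sum>b'\<in>UNIV. \<Sum>r\<in>UNIV. \<Sum>r'\<in>UNIV.
      (\<kappa> / real CARD('n))\<^sup>2 * (norm (block_snd \<tau> b b'))\<^sup>2 * (norm (block_snd \<rho> r r'))\<^sup>2)"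
    by (rule sum.cong[OF refl], rule sum.swap)
  also have "\<dots> = (\<kappa> / real CARD('n))\<^sup>2 * (norm \<tau>)\<^sup>2 * (norm \<rho>)\<^sup>2"
    unfolding norm_power2_blocks[of \<tau>] norm_power2_blocks[of \<rho>]
    by (simp only: sum_distrib_left[symmetric] sum_distrib_right[symmetric])
  also have "(real CARD('n))\<^sup>2 * ((\<kappa> / real CARD('n))\<^sup>2 * (norm \<tau>)\<^sup>2 * (norm \<rho>)\<^sup>2) = (\<kappa> * norm \<tau> * norm \<rho>)\<^sup>2"
    by (simp add: power_mult_distrib power_divide)
  finally have "sqrt (\<integral>\<omega>. (norm (N \<omega>))\<^sup>2 \<partial>M) \<le> sqrt ((\<kappa> * norm \<tau> * norm \<rho>)\<^sup>2)"
    by (rule real_sqrt_le_mono)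
  also have "\<dots> = \<kappa> * norm \<tau> * norm \<rho>" using \<kappa> by simp
  finally have bound: "sqrt (\<integral>\<omega>. (norm (N \<omega>))\<^sup>2 \<partial>M) \<le> \<kappa> * norm \<tau> * norm \<rho>" .
  note * = expectation_sqrt_le[OF int, simplified]
  show "integrable M (\<lambda>\<omega>. norm (choi_apply \<tau> (tensor_id (\<lambda>Y. conj_by (V \<omega>) (G Y)) \<rho>)))"
    using *(1) by (simp add: N_def)
  show "(\<integral>\<omega>. norm (choi_apply \<tau> (tensor_id (\<lambda>Y. conj_by (V \<omega>) (G Y)) \<rho>)) \<partial>M) \<le> \<kappa> * norm \<tau> * norm \<rho>"
    using order_trans[OF *(2) bound] by (simp add: N_def)
qed

text \<open>
  Both states are replaced by their smoothings. The error of smoothing \<open>\<rho>\<close> is bounded pointwise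
  because the channel does not increase the trace. The error of smoothing \<open>\<tau>\<close> is bounded only
  on average: the first moment replaces the rotated state by the maximally mixed one. The
  remaining term is bounded by the second moment. The integrable majorant \<open>h\<close> avoids the question
  whether the trace norm is measurable.
\<close>

lemma smoothed_decoupling_term:
  fixes \<tau> \<tau>' :: "('n \<times> 'b::finite) cmat" and \<rho> \<rho>' :: "('n \<times> 'r::finite) cmat"
    and G Gp Gm :: "'n cmat \<Rightarrow> 'n cmat"
  assumes first: "\<And>Y i j. (\<integral>\<omega>. conj_by (V \<omega>) Y $ i $ j \<partial>M) = (if i = j then trace Y / of_nat CARD('n) else 0)"
    and second: "\<And>t Y. (\<integral>\<omega>. (cmod (\<Sum>i\<in>UNIV. \<Sum>j\<in>UNIV. t $ i $ j * conj_by (V \<omega>) (G Y) $ i $ j))\<^sup>2 \<partial>M)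
      \<le> (\<kappa> / real CARD('n))\<^sup>2 * (norm t)\<^sup>2 * (norm Y)\<^sup>2"
    and \<kappa>: "0 \<le> \<kappa>"
    and G: "\<And>Y. G Y = Gp Y - Gm Y" and super: "superoperator Gp" "superoperator Gm"
    and Gp: "\<And>P :: ('n \<times> 'r) cmat. psd P \<Longrightarrow> psd (tensor_id Gp P)"
      "\<And>P :: ('n \<times> 'r) cmat. Re (trace (tensor_id Gp P)) = \<gamma> * Re (trace P)"
    and Gm: "\<And>P :: ('n \<times> 'r) cmat. psd P \<Longrightarrow> psd (tensor_id Gm P)"
      "\<And>P :: ('n \<times> 'r) cmat. Re (trace (tensor_id Gm P)) = \<gamma> * Re (trace P)"
    and \<gamma>: "0 \<le> \<gamma>" and \<epsilon>: "0 \<le> \<epsilon>"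
    and \<tau>: "subnormalised \<tau>" and \<rho>: "subnormalised \<rho>"
    and tni: "\<And>P :: ('n \<times> 'r) cmat. psd P \<Longrightarrow> Re (trace (choi_apply \<tau> P)) \<le> Re (trace P)"
    and \<tau>': "smoothing \<epsilon> \<tau> \<tau>'" and \<rho>': "smoothing \<epsilon> \<rho> \<rho>'"
  shows "\<exists>h. integrable M h \<and>
    (\<forall>\<omega>\<in>space M. schatten 1 (choi_apply \<tau> (tensor_id (\<lambda>Y. conj_by (V \<omega>) (G Y)) \<rho>)) \<le> h \<omega>) \<and>
    (\<integral>\<omega>. h \<omega> \<partial>M) \<le> 4 * \<gamma> * \<epsilon> + \<kappa> * norm (weighted (kron (mat 1) (trace_out_fst \<tau>)) \<tau>') *
      norm (weighted (kron (mat 1) (trace_out_fst \<rho>)) \<rho>')"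
proof -
  have psd: "psd \<tau>" "psd \<rho>" "psd \<tau>'" "psd \<rho>'"
    using \<tau> \<rho> \<tau>' \<rho>' by (auto simp: subnormalised_def smoothing_def)
  obtain P N where PN: "psd P" "psd N" "\<rho> = \<rho>' + (P - N)" "Re (trace P) + Re (trace N) \<le> \<epsilon>"
    using smoothing_decomposition[OF \<rho>' \<rho> \<epsilon>] by blast
  obtain P' N' where PN': "psd P'" "psd N'" "\<tau> = \<tau>' + (P' - N')" "Re (trace P') + Re (trace N') \<le> \<epsilon>"
    using smoothing_decomposition[OF \<tau>' \<tau> \<epsilon>] by blast
  define S where "S \<omega> X = tensor_id (conj_by (V \<omega>)) X" for \<omega> and X :: "('n \<times> 'r) cmat"
  have S_psd: "psd (S \<omega> X)" if "psd X" for \<omega> X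
    unfolding S_def by (rule psd_tensor_id_conj[OF that])
  have S_trace: "trace (S \<omega> X) = trace X" if "\<omega> \<in> space M" for \<omega> X
    unfolding S_def by (rule trace_tensor_id_conj[OF unitary_V[OF that]])
  have S_diff: "S \<omega> (X - Y) = S \<omega> X - S \<omega> Y" for \<omega> X Y
    unfolding S_def by (rule tensor_id_diff_right[OF superoperator_conj_by])
  have SG: "tensor_id (\<lambda>Y. conj_by (V \<omega>) (G Y)) X = S \<omega> (tensor_id Gp X) - S \<omega> (tensor_id Gm X)" for \<omega> X
  proof -
    have "tensor_id (\<lambda>Y. conj_by (V \<omega>) (G Y)) X = S \<omega> (tensor_id (\<lambda>Y. Gp Y - Gm Y) X)"
      unfolding S_def tensor_id_compose G ..
    then show ?thesis by (simp only: tensor_id_diff S_diff)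
  qed
  have superG: "superoperator (\<lambda>Y. conj_by (V \<omega>) (G Y))" for \<omega>
    using superoperator_diff[OF super] superoperator_conj_by[of "V \<omega>"]
    by (simp add: G superoperator_def)
  \<comment> \<open>\<open>Gp - Gm\<close> applied to \<open>P - N\<close> is the difference of the
    positive matrices \<open>Q1\<close> and \<open>Q2\<close>, whose traces add up to 2\<gamma>
    times the traces of \<open>P\<close> and \<open>N\<close>.\<close>
  define Q1 where "Q1 = tensor_id Gp P + tensor_id Gm N"
  define Q2 where "Q2 = tensor_id Gm P + tensor_id Gp N"
  have Q: "psd Q1" "psd Q2" by (auto simp: Q1_def Q2_def intro!: psd_add Gp Gm PN)
  have trQ: "Re (trace Q1) + Re (trace Q2) \<le> 2 * \<gamma> * \<epsilon>"
  proof -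
    have "Re (trace Q1) + Re (trace Q2) = 2 * \<gamma> * (Re (trace P) + Re (trace N))"
      by (simp add: Q1_def Q2_def trace_add Gp Gm algebra_simps)
    also have "\<dots> \<le> 2 * \<gamma> * \<epsilon>" using PN(4) \<gamma> by (intro mult_left_mono) auto
    finally show ?thesis .
  qed
  have SGP: "tensor_id (\<lambda>Y. conj_by (V \<omega>) (G Y)) \<rho> = tensor_id (\<lambda>Y. conj_by (V \<omega>) (G Y)) \<rho>' + (S \<omega> Q1 - S \<omega> Q2)" for \<omega>
  proof -
    have "\<rho> = \<rho>' - (N - P)" using PN(3) by simp
    then have "tensor_id (\<lambda>Y. conj_by (V \<omega>) (G Y)) \<rho> = tensor_id (\<lambda>Y. conj_by (V \<omega>) (G Y)) \<rho>' -
        (tensor_id (\<lambda>Y. conj_by (V \<omega>) (G Y)) N - tensor_id (\<lambda>Y. conj_by (V \<omega>) (G Y)) P)"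
      by (simp only: tensor_id_diff_right[OF superG])
    moreover have "S \<omega> (X + Y) = S \<omega> X + S \<omega> Y" for X Y
      using S_diff[of \<omega> "X + Y" Y] by simp
    ultimately show ?thesis by (simp add: SG Q1_def Q2_def)
  qed
  define R1 where "R1 = tensor_id Gp \<rho>'"
  define R2 where "R2 = tensor_id Gm \<rho>'"
  have R: "psd R1" "psd R2" by (auto simp: R1_def R2_def intro!: Gp Gm psd)
  have trR: "Re (trace R1) + Re (trace R2) \<le> 2 * \<gamma>"
  proof -
    have "Re (trace R1) + Re (trace R2) = 2 * \<gamma> * Re (trace \<rho>')"
      by (simp add: R1_def R2_def Gp Gm)
    also have "\<dots> \<le> 2 * \<gamma> * 1"
      using \<rho>' \<gamma> by (intro mult_left_mono) (auto simp: smoothing_def subnormalised_def)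
    finally show ?thesis by simp
  qed
  \<comment> \<open>The same regrouping for the error \<open>P' - N'\<close> of \<tau>, contracted
    with the rotated \<open>R1 - R2\<close>.\<close>
  define B1 where "B1 \<omega> = choi_apply P' (S \<omega> R1) + choi_apply N' (S \<omega> R2)" for \<omega>
  define B2 where "B2 \<omega> = choi_apply P' (S \<omega> R2) + choi_apply N' (S \<omega> R1)" for \<omega>
  have B: "psd (B1 \<omega>)" "psd (B2 \<omega>)" for \<omega>
    unfolding B1_def B2_def by (intro psd_add psd_choi_apply S_psd PN' R)+
  define \<tau>w where "\<tau>w = weighted (kron (mat 1) (trace_out_fst \<tau>)) \<tau>'"
  define \<rho>w where "\<rho>w = weighted (kron (mat 1) (trace_out_fst \<rho>)) \<rho>'"
  define F where "F \<omega> = choi_apply \<tau>w (tensor_id (\<lambda>Y. conj_by (V \<omega>) (G Y)) \<rho>w)" for \<omega>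
  define K where "K = kron (mpow (trace_out_fst \<tau>) (1/4)) (mpow (trace_out_fst \<rho>) (1/4))"
  have marg: "psd (trace_out_fst \<tau>)" "psd (trace_out_fst \<rho>)"
    using psd by (auto intro: psd_trace_out_fst)
  have dK: "dagger K = K" by (simp add: K_def dagger_kron mpow_hermitian marg)
  \<comment> \<open>Subnormalisation enters here: the squared norm is the product of the traces of
    \<tau> and \<rho>, so the weight costs nothing in Cauchy-Schwarz.\<close>
  have KK: "norm (K ** K) \<le> 1"
  proof -
    have "(norm (K ** K))\<^sup>2 = Re (trace \<tau>) * Re (trace \<rho>)"
      by (simp add: K_def kron_mult norm_kron power_mult_distrib norm_mpow_quarter marg trace_trace_out_fst)
    also have "\<dots> \<le> 1 * 1"
      using \<tau> \<rho> psd by (intro mult_mono) (auto simp: subnormalised_def intro: psd_trace_nonneg)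
    finally have "(norm (K ** K))\<^sup>2 \<le> 1\<^sup>2" by simp
    then show ?thesis by (rule power2_le_imp_le) simp
  qed
  \<comment> \<open>The quarter powers act on B and R, so they pass through \<open>G\<close>, the
    unitary and the contraction, and collect into \<open>K\<close>.\<close>
  have main: "choi_apply \<tau>' (tensor_id (\<lambda>Y. conj_by (V \<omega>) (G Y)) \<rho>') = K ** F \<omega> ** K" for \<omega>
  proof -
    let ?w = "kron (mat 1 :: 'n cmat) (mpow (trace_out_fst \<tau>) (1/4))"
    let ?v = "kron (mat 1 :: 'n cmat) (mpow (trace_out_fst \<rho>) (1/4))"
    have "choi_apply \<tau>' (tensor_id (\<lambda>Y. conj_by (V \<omega>) (G Y)) \<rho>') =
       choi_apply (?w ** \<tau>w ** ?w) (tensor_id (\<lambda>Y. conj_by (V \<omega>) (G Y)) (?v ** \<rho>w ** ?v))"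
      using smoothing_factorisation[OF \<tau>' psd(1)] smoothing_factorisation[OF \<rho>' psd(2)]
      by (simp add: \<tau>w_def \<rho>w_def)
    then show ?thesis
      by (simp only: tensor_id_local_sandwich[OF superG] choi_apply_local_sandwich F_def K_def)
  qed
  have \<tau>w: "psd \<tau>w" and \<rho>w: "psd \<rho>w"
    by (auto simp: \<tau>w_def \<rho>w_def intro!: psd_weighted psd_kron psd_mat_1 marg psd)
  have dF: "dagger (F \<omega>) = F \<omega>" for \<omega>
    unfolding F_def SG by (intro hermitian_choi_apply_diff S_psd \<tau>w Gp Gm \<rho>w)
  have Fle: "schatten 1 (K ** F \<omega> ** K) \<le> norm (F \<omega>)" for \<omega>
    using order_trans[OF schatten_1_weighted_le[OF dK dF] mult_right_mono[OF KK norm_ge_zero]] by simp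
  define h where "h \<omega> = norm (F \<omega>) + (2 * \<gamma> * \<epsilon> + (Re (trace (B1 \<omega>)) + Re (trace (B2 \<omega>))))" for \<omega>
  have pointwise: "schatten 1 (choi_apply \<tau> (tensor_id (\<lambda>Y. conj_by (V \<omega>) (G Y)) \<rho>)) \<le> h \<omega>" if \<omega>: "\<omega> \<in> space M" for \<omega>
  proof -
    let ?A1 = "choi_apply \<tau> (S \<omega> Q1)" and ?A2 = "choi_apply \<tau> (S \<omega> Q2)"
    let ?D = "(?A1 + B1 \<omega>) - (?A2 + B2 \<omega>)"
    have A: "psd ?A1" "psd ?A2" by (intro psd_choi_apply S_psd psd Q)+
    have "choi_apply \<tau> (tensor_id (\<lambda>Y. conj_by (V \<omega>) (G Y)) \<rho>) =
       choi_apply \<tau> (S \<omega> R1 - S \<omega> R2) + (?A1 - ?A2)"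
      unfolding SGP unfolding choi_apply_add_right choi_apply_diff_right SG R1_def R2_def ..
    also have "choi_apply \<tau> (S \<omega> R1 - S \<omega> R2) = choi_apply \<tau>' (S \<omega> R1 - S \<omega> R2) + (B1 \<omega> - B2 \<omega>)"
      by (subst (1) PN'(3)) (simp add: choi_apply_add_left choi_apply_diff_left choi_apply_diff_right B1_def B2_def)
    also have "choi_apply \<tau>' (S \<omega> R1 - S \<omega> R2) = K ** F \<omega> ** K"
      using main[of \<omega>] by (simp only: SG R1_def R2_def)
    finally have eq: "choi_apply \<tau> (tensor_id (\<lambda>Y. conj_by (V \<omega>) (G Y)) \<rho>) = K ** F \<omega> ** K + ?D"
      by simp
    have "schatten 1 (K ** F \<omega> ** K + ?D) \<le> schatten 1 (K ** F \<omega> ** K) + schatten 1 ?D"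
    proof (rule schatten_1_triangle)
      show "dagger (K ** F \<omega> ** K) = K ** F \<omega> ** K" by (simp add: dagger_mult dK dF matrix_mul_assoc)
      show "dagger ?D = ?D"
        using A B[of \<omega>] by (simp add: dagger_diff dagger_add psd_hermitian)
    qed
    also have "schatten 1 ?D \<le> Re (trace (?A1 + B1 \<omega>)) + Re (trace (?A2 + B2 \<omega>))"
      by (rule schatten_1_hermitian_le[OF _ _ refl]) (intro psd_add A B)+
    \<comment> \<open>The terms with \<open>Q1\<close> and \<open>Q2\<close> are bounded by
      \<open>tni\<close>, which holds for the unsmoothed \<tau>. The traces of \<open>B1\<close> and
      \<open>B2\<close> are kept and bounded after averaging.\<close>
    also have "\<dots> \<le> 2 * \<gamma> * \<epsilon> + (Re (trace (B1 \<omega>)) + Re (trace (B2 \<omega>)))"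
      using tni[OF S_psd[OF Q(1)], of \<omega>] tni[OF S_psd[OF Q(2)], of \<omega>] trQ
      by (simp add: trace_add S_trace[OF \<omega>])
    finally show ?thesis using Fle[of \<omega>] by (simp add: eq h_def)
  qed
  have ex: "integrable M (\<lambda>\<omega>. Re (trace (choi_apply \<Delta> (S \<omega> X))))"
      "(\<integral>\<omega>. Re (trace (choi_apply \<Delta> (S \<omega> X))) \<partial>M) = Re (trace \<Delta>) * Re (trace X)"
    if "psd \<Delta>" "psd X" for \<Delta> :: "('n \<times> 'b) cmat" and X
    unfolding S_def by (rule expectation_trace_choi_apply[OF first that])+
  have intB: "integrable M (\<lambda>\<omega>. Re (trace (B1 \<omega>)) + Re (trace (B2 \<omega>)))"
    unfolding B1_def B2_def trace_add plus_complex.sel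
    by (intro Bochner_Integration.integrable_add ex(1) PN' R)
  have "(\<integral>\<omega>. Re (trace (B1 \<omega>)) + Re (trace (B2 \<omega>)) \<partial>M) =
      (Re (trace P') + Re (trace N')) * (Re (trace R1) + Re (trace R2))"
    unfolding B1_def B2_def trace_add plus_complex.sel
    by (simp add: ex PN' R algebra_simps)
  also have "\<dots> \<le> \<epsilon> * (2 * \<gamma>)"
    using PN'(4) trR \<epsilon> psd_trace_nonneg[OF R(1)] psd_trace_nonneg[OF R(2)] by (intro mult_mono) auto
  finally have EB: "(\<integral>\<omega>. Re (trace (B1 \<omega>)) + Re (trace (B2 \<omega>)) \<partial>M) \<le> 2 * \<gamma> * \<epsilon>"
    by (simp only: mult_ac)
  note exF = expectation_norm_choi_apply_le[OF second \<kappa>, of \<tau>w \<rho>w, folded F_def]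
  have "integrable M h"
    unfolding h_def by (intro Bochner_Integration.integrable_add exF(1) intB integrable_const)
  moreover have "(\<integral>\<omega>. h \<omega> \<partial>M) \<le> 4 * \<gamma> * \<epsilon> + \<kappa> * norm \<tau>w * norm \<rho>w"
  proof -
    have "(\<integral>\<omega>. h \<omega> \<partial>M) = (\<integral>\<omega>. norm (F \<omega>) \<partial>M) +
        (2 * \<gamma> * \<epsilon> + (\<integral>\<omega>. Re (trace (B1 \<omega>)) + Re (trace (B2 \<omega>)) \<partial>M))"
      unfolding h_def using exF(1) intB by (simp add: prob_space)
    also have "\<dots> \<le> \<kappa> * norm \<tau>w * norm \<rho>w + (2 * \<gamma> * \<epsilon> + 2 * \<gamma> * \<epsilon>)"
      by (intro add_mono exF(2) EB order_refl)
    finally show ?thesis by (simp add: mult_ac)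
  qed
  ultimately show ?thesis using pointwise unfolding \<tau>w_def \<rho>w_def by blast
qed

end

text \<open>Identifies the factor \<open>D1\<close> of the claim, divided by the dimension, as the
  square root of the constant in the Haar second moment.\<close>

lemma dimension_factor_square:
  assumes "2 \<le> n"
  shows "((1 - real n powr (-2)) powr (-1/2) / real n)\<^sup>2 = 1 / ((real n)\<^sup>2 - 1)"
    and "0 < 1 - real n powr (-2)"
proof -
  have n: "real n powr (-2) = 1 / (real n)\<^sup>2"
    using assms by (simp add: powr_minus_divide powr_realpow[of "real n" 2, simplified])
  have "1 < (real n)\<^sup>2" using assms power_mono[of 2 "real n" 2] by simp
  then show pos: "0 < 1 - real n powr (-2)" unfolding n by (simp add: divide_less_eq)
  have "((1 - real n powr (-2)) powr (-1/2))\<^sup>2 = 1 / (1 - real n powr (-2))"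
    using pos by (simp add: power2_eq_square powr_minus_divide flip: powr_add)
  then have "((1 - real n powr (-2)) powr (-1/2) / real n)\<^sup>2 = 1 / (1 - 1 / (real n)\<^sup>2) / (real n)\<^sup>2"
    unfolding power_divide n by simp
  also have "\<dots> = 1 / ((real n)\<^sup>2 - 1)"
    using \<open>1 < (real n)\<^sup>2\<close> assms by (simp add: divide_simps)
  finally show "((1 - real n powr (-2)) powr (-1/2) / real n)\<^sup>2 = 1 / ((real n)\<^sup>2 - 1)" .
qed

text \<open>The case \<gamma> = 1: the identity and the replacement by the maximally mixed state
  both preserve the trace.\<close>

lemma centre_decoupling_term:
  fixes \<tau> \<tau>' :: "('n::finite \<times> 'b::finite) cmat" and \<rho> \<rho>' :: "('n \<times> 'r::finite) cmat"
  assumes \<mu>: "haar_unitary \<mu>" and n: "2 \<le> CARD('n)" and \<epsilon>: "0 \<le> \<epsilon>"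
    and \<tau>: "subnormalised \<tau>" and \<rho>: "subnormalised \<rho>"
    and tni: "\<And>P :: ('n \<times> 'r) cmat. psd P \<Longrightarrow> Re (trace (choi_apply \<tau> P)) \<le> Re (trace P)"
    and \<tau>': "smoothing \<epsilon> \<tau> \<tau>'" and \<rho>': "smoothing \<epsilon> \<rho> \<rho>'"
  shows "\<exists>h. integrable \<mu> h \<and>
    (\<forall>U\<in>space \<mu>. schatten 1 (choi_apply \<tau> (tensor_id (\<lambda>Y. conj_by U (centre Y)) \<rho>)) \<le> h U) \<and>
    (\<integral>U. h U \<partial>\<mu>) \<le> 4 * \<epsilon> + (1 - real CARD('n) powr (-2)) powr (-1/2) *
      norm (weighted (kron (mat 1) (trace_out_fst \<tau>)) \<tau>') * norm (weighted (kron (mat 1) (trace_out_fst \<rho>)) \<rho>')"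
proof -
  interpret random_unitary \<mu> "\<lambda>U. U" by (rule haar_random_unitary[OF \<mu>])
  have c: "0 \<le> 1 / ((real CARD('n))\<^sup>2 - 1)"
    using n power_mono[of 2 "real CARD('n)" 2] by simp
  have second: "(\<integral>U. (cmod (\<Sum>i\<in>UNIV. \<Sum>j\<in>UNIV. t $ i $ j * conj_by U (centre Y) $ i $ j))\<^sup>2 \<partial>\<mu>)
      \<le> ((1 - real CARD('n) powr (-2)) powr (-1/2) / real CARD('n))\<^sup>2 * (norm t)\<^sup>2 * (norm Y)\<^sup>2" for t Y :: "'n cmat"
  proof -
    have "(\<integral>U. (cmod (\<Sum>i\<in>UNIV. \<Sum>j\<in>UNIV. t $ i $ j * conj_by U (centre Y) $ i $ j))\<^sup>2 \<partial>\<mu>)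
       \<le> 1 / ((real CARD('n))\<^sup>2 - 1) * (\<Sum>i\<in>UNIV. \<Sum>j\<in>UNIV. \<Sum>p\<in>UNIV. \<Sum>q\<in>UNIV.
           (cmod (t $ i $ j))\<^sup>2 * (cmod (centre Y $ p $ q))\<^sup>2)"
      using haar_linear_form_square_le[OF \<mu> n, where t = "\<lambda>_::unit. \<lambda>i j. t $ i $ j" and Y = "\<lambda>_. centre Y"]
      by (simp add: UNIV_unit trace_centre norm_mult power_mult_distrib)
    also have "\<dots> = 1 / ((real CARD('n))\<^sup>2 - 1) * ((norm t)\<^sup>2 * (norm (centre Y))\<^sup>2)"
      unfolding norm_cmat_power2 by (simp only: sum_distrib_left[symmetric] sum_distrib_right[symmetric])
    also have "\<dots> \<le> 1 / ((real CARD('n))\<^sup>2 - 1) * ((norm t)\<^sup>2 * (norm Y)\<^sup>2)"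
      by (intro mult_left_mono[OF _ c] mult_left_mono power_mono norm_centre_le) simp_all
    finally show ?thesis by (simp only: dimension_factor_square[OF n] mult.assoc)
  qed
  have "\<exists>h. integrable \<mu> h \<and>
    (\<forall>U\<in>space \<mu>. schatten 1 (choi_apply \<tau> (tensor_id (\<lambda>Y. conj_by U (centre Y)) \<rho>)) \<le> h U) \<and>
    (\<integral>U. h U \<partial>\<mu>) \<le> 4 * 1 * \<epsilon> + (1 - real CARD('n) powr (-2)) powr (-1/2) *
      norm (weighted (kron (mat 1) (trace_out_fst \<tau>)) \<tau>') * norm (weighted (kron (mat 1) (trace_out_fst \<rho>)) \<rho>')"
    by (rule smoothed_decoupling_term[where G = centre and Gp = "\<lambda>Y. Y" and
          Gm = "\<lambda>Y. cscale (trace Y) maximally_mixed", OF haar_first_moment[OF \<mu>] second powr_ge_zero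
          centre_def superoperator_id superoperator_trace_mixed _ _ _ _ _ \<epsilon> \<tau> \<rho> tni \<tau>' \<rho>'])
      (auto simp: tensor_id_id tensor_id_trace_mixed trace_kron trace_trace_out_fst
        intro: psd_kron psd_maximally_mixed psd_trace_out_fst)
  then show ?thesis by simp
qed

lemma tensor_id_centre_pair_parts:
  "tensor_id (\<lambda>Y. Y + cscale (trace Y) maximally_mixed) X = X + kron maximally_mixed (trace_out_fst X)"
  "tensor_id (\<lambda>Y. kron maximally_mixed (trace_out_fst Y) + kron (trace_out_snd Y) maximally_mixed) X =
    tensor_id (\<lambda>Z. kron maximally_mixed Z) (marginal2 X) + tensor_id (\<lambda>Z. kron Z maximally_mixed) (marginal1 X)"
  unfolding tensor_id_add tensor_id_id tensor_id_trace_mixed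
    tensor_id_trace_out_snd[of "\<lambda>Z. kron Z maximally_mixed"] tensor_id_trace_out_fst[of "\<lambda>Z. kron maximally_mixed Z"]
  by (rule refl)+

text \<open>The case \<gamma> = 2: each of the two groups of terms in \<open>centre_pair\<close>
  doubles the trace. The two second moment constants multiply.\<close>

lemma centre_pair_decoupling_term:
  fixes \<tau> \<tau>' :: "(('m::finite \<times> 'n::finite) \<times> 'b::finite) cmat" and \<rho> \<rho>' :: "(('m \<times> 'n) \<times> 'r::finite) cmat"
  assumes \<mu>: "haar_unitary \<mu>" and \<nu>: "haar_unitary \<nu>"
    and m: "2 \<le> CARD('m)" and n: "2 \<le> CARD('n)" and \<epsilon>: "0 \<le> \<epsilon>"
    and \<tau>: "subnormalised \<tau>" and \<rho>: "subnormalised \<rho>"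
    and tni: "\<And>P :: (('m \<times> 'n) \<times> 'r) cmat. psd P \<Longrightarrow> Re (trace (choi_apply \<tau> P)) \<le> Re (trace P)"
    and \<tau>': "smoothing \<epsilon> \<tau> \<tau>'" and \<rho>': "smoothing \<epsilon> \<rho> \<rho>'"
  shows "\<exists>h. integrable (\<mu> \<Otimes>\<^sub>M \<nu>) h \<and>
    (\<forall>\<omega>\<in>space (\<mu> \<Otimes>\<^sub>M \<nu>).
      schatten 1 (choi_apply \<tau> (tensor_id (\<lambda>Y. conj_by (case \<omega> of (U1, U2) \<Rightarrow> kron U1 U2) (centre_pair Y)) \<rho>)) \<le> h \<omega>) \<and>
    (\<integral>\<omega>. h \<omega> \<partial>(\<mu> \<Otimes>\<^sub>M \<nu>)) \<le> 8 * \<epsilon> +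
      ((1 - real CARD('m) powr (-2)) powr (-1/2) * (1 - real CARD('n) powr (-2)) powr (-1/2)) *
      norm (weighted (kron (mat 1) (trace_out_fst \<tau>)) \<tau>') * norm (weighted (kron (mat 1) (trace_out_fst \<rho>)) \<rho>')"
proof -
  interpret random_unitary "\<mu> \<Otimes>\<^sub>M \<nu>" "\<lambda>(U1, U2). kron U1 U2" by (rule random_unitary_kron[OF \<mu> \<nu>])
  define \<kappa> where "\<kappa> = (1 - real CARD('m) powr (-2)) powr (-1/2) * (1 - real CARD('n) powr (-2)) powr (-1/2)"
  have \<kappa>: "0 \<le> \<kappa>" by (simp add: \<kappa>_def)
  have \<kappa>2: "(\<kappa> / real CARD('m \<times> 'n))\<^sup>2 = 1 / (((real CARD('m))\<^sup>2 - 1) * ((real CARD('n))\<^sup>2 - 1))"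
  proof -
    have "(\<kappa> / real CARD('m \<times> 'n))\<^sup>2 = ((1 - real CARD('m) powr (-2)) powr (-1/2) / real CARD('m))\<^sup>2 *
       ((1 - real CARD('n) powr (-2)) powr (-1/2) / real CARD('n))\<^sup>2"
      by (simp only: \<kappa>_def card_prod of_nat_mult power_mult_distrib[symmetric] times_divide_times_eq)
    then show ?thesis
      by (simp only: dimension_factor_square[OF m] dimension_factor_square[OF n] times_divide_times_eq mult_1)
  qed
  have second: "(\<integral>\<omega>. (cmod (\<Sum>x\<in>UNIV. \<Sum>y\<in>UNIV. t $ x $ y *
      conj_by (case \<omega> of (U1, U2) \<Rightarrow> kron U1 U2) (centre_pair Y) $ x $ y))\<^sup>2 \<partial>(\<mu> \<Otimes>\<^sub>M \<nu>))
      \<le> (\<kappa> / real CARD('m \<times> 'n))\<^sup>2 * (norm t)\<^sup>2 * (norm Y)\<^sup>2" for t Y :: "('m \<times> 'n) cmat"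
  proof -
    have "(norm (centre_pair Y))\<^sup>2 \<le> (norm Y)\<^sup>2"
      by (intro power_mono norm_centre_pair_le norm_ge_zero)
    then show ?thesis
      by (intro order_trans[OF haar_pair_linear_form_square_le[OF \<mu> \<nu> m n trace_out_centre_pair]])
        (simp only: \<kappa>2[symmetric] zero_le_power2 mult_left_mono mult_nonneg_nonneg)
  qed
  have "\<exists>h. integrable (\<mu> \<Otimes>\<^sub>M \<nu>) h \<and>
    (\<forall>\<omega>\<in>space (\<mu> \<Otimes>\<^sub>M \<nu>).
      schatten 1 (choi_apply \<tau> (tensor_id (\<lambda>Y. conj_by (case \<omega> of (U1, U2) \<Rightarrow> kron U1 U2) (centre_pair Y)) \<rho>)) \<le> h \<omega>) \<and>
    (\<integral>\<omega>. h \<omega> \<partial>(\<mu> \<Otimes>\<^sub>M \<nu>)) \<le> 4 * 2 * \<epsilon> + \<kappa> *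
      norm (weighted (kron (mat 1) (trace_out_fst \<tau>)) \<tau>') * norm (weighted (kron (mat 1) (trace_out_fst \<rho>)) \<rho>')"
    by (rule smoothed_decoupling_term[where G = centre_pair and
          Gp = "\<lambda>Y. Y + cscale (trace Y) maximally_mixed" and
          Gm = "\<lambda>Y. kron maximally_mixed (trace_out_fst Y) + kron (trace_out_snd Y) maximally_mixed",
          OF haar_pair_first_moment[OF \<mu> \<nu>] second \<kappa> centre_pair_def
          superoperator_add[OF superoperator_id superoperator_trace_mixed]
          superoperator_add[OF superoperator_kron_mixed_left superoperator_kron_mixed_right]
          _ _ _ _ _ \<epsilon> \<tau> \<rho> tni \<tau>' \<rho>'])
      (auto simp: tensor_id_centre_pair_parts trace_add trace_kron trace_trace_out_fst trace_tensor_id_kron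
        trace_marginal1 trace_marginal2
        intro!: psd_add psd_kron psd_maximally_mixed psd_trace_out_fst psd_tensor_id_kron psd_marginal1 psd_marginal2)
  then show ?thesis by (simp add: \<kappa>_def)
qed

section \<open>Telescoping\<close>

text \<open>A maximally mixed input on one system traces that system out of the Choi state; its
  normalisation reduces the prefactor of \<open>choi_apply\<close> to the dimension of the other
  system.\<close>

lemma choi_apply_kron_mixed_right:
  "choi_apply \<tau> (tensor_id (\<lambda>Y. kron Y maximally_mixed) X) = choi_apply (marginal1 \<tau>) X"
  for \<tau> :: "(('m::finite \<times> 'n::finite) \<times> 'b::finite) cmat"
proof (rule cmat_pair_eqI)
  fix b r b' r'
  have "(\<Sum>i\<in>UNIV. \<Sum>j\<in>UNIV. \<tau> $ (i, b) $ (j, b') * tensor_id (\<lambda>Y. kron Y (maximally_mixed :: 'n cmat)) X $ (i, r) $ (j, r')) =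
     (\<Sum>i1\<in>UNIV. \<Sum>i2\<in>UNIV. \<Sum>j1\<in>UNIV. \<tau> $ ((i1, i2), b) $ ((j1, i2), b') * (X $ (i1, r) $ (j1, r') / of_nat CARD('n)))"
    by (simp add: UNIV_pair_sum[where ?'a = 'm and ?'b = 'n] tensor_id_nth maximally_mixed_nth
        if_distrib[of "\<lambda>x. _ * x"] cong: if_cong)
  also have "\<dots> = (\<Sum>i1\<in>UNIV. \<Sum>j1\<in>UNIV. \<Sum>i2\<in>UNIV. \<tau> $ ((i1, i2), b) $ ((j1, i2), b') * (X $ (i1, r) $ (j1, r') / of_nat CARD('n)))"
    by (rule sum.cong[OF refl], rule sum.swap)
  also have "\<dots> = (\<Sum>i1\<in>UNIV. \<Sum>j1\<in>UNIV. marginal1 \<tau> $ (i1, b) $ (j1, b') * X $ (i1, r) $ (j1, r')) / of_nat CARD('n)"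
    by (simp add: marginal1_nth sum_divide_distrib sum_distrib_right)
  finally show "choi_apply \<tau> (tensor_id (\<lambda>Y. kron Y maximally_mixed) X) $ (b, r) $ (b', r') = choi_apply (marginal1 \<tau>) X $ (b, r) $ (b', r')"
    by (simp add: choi_apply_nth card_prod)
qed

lemma choi_apply_kron_mixed_left:
  "choi_apply \<tau> (tensor_id (\<lambda>Y. kron maximally_mixed Y) X) = choi_apply (marginal2 \<tau>) X"
  for \<tau> :: "(('m::finite \<times> 'n::finite) \<times> 'b::finite) cmat"
proof (rule cmat_pair_eqI)
  fix b r b' r'
  have "(\<Sum>i\<in>UNIV. \<Sum>j\<in>UNIV. \<tau> $ (i, b) $ (j, b') * tensor_id (\<lambda>Y. kron (maximally_mixed :: 'm cmat) Y) X $ (i, r) $ (j, r')) =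
     (\<Sum>i2\<in>UNIV. \<Sum>i1\<in>UNIV. \<Sum>j2\<in>UNIV. \<tau> $ ((i1, i2), b) $ ((i1, j2), b') * (X $ (i2, r) $ (j2, r') / of_nat CARD('m)))"
    by (simp add: sum_prod_UNIV[where ?'a = 'm and ?'b = 'n] tensor_id_nth maximally_mixed_nth
        if_distrib[of "\<lambda>x. _ * x"] if_distrib[of "\<lambda>x. x * _"] cong: if_cong)
  also have "\<dots> = (\<Sum>i2\<in>UNIV. \<Sum>j2\<in>UNIV. \<Sum>i1\<in>UNIV. \<tau> $ ((i1, i2), b) $ ((i1, j2), b') * (X $ (i2, r) $ (j2, r') / of_nat CARD('m)))"
    by (rule sum.cong[OF refl], rule sum.swap)
  also have "\<dots> = (\<Sum>i2\<in>UNIV. \<Sum>j2\<in>UNIV. marginal2 \<tau> $ (i2, b) $ (j2, b') * X $ (i2, r) $ (j2, r')) / of_nat CARD('m)"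
    by (simp add: marginal2_nth sum_divide_distrib sum_distrib_right)
  finally show "choi_apply \<tau> (tensor_id (\<lambda>Y. kron maximally_mixed Y) X) $ (b, r) $ (b', r') = choi_apply (marginal2 \<tau>) X $ (b, r) $ (b', r')"
    by (simp add: choi_apply_nth card_prod)
qed

text \<open>The fully averaged input produces exactly the product state that the claim compares
  with.\<close>

lemma choi_apply_maximally_mixed: "choi_apply \<tau> (kron maximally_mixed Z) = kron (trace_out_fst \<tau>) Z"
  by (rule cmat_pair_eqI)
    (simp add: choi_apply_nth maximally_mixed_nth trace_out_fst_def sum_distrib_left sum_distrib_right
      if_distrib[of "\<lambda>x. _ * x"] if_distrib[of "\<lambda>x. x * _"] cong: if_cong)

lemma conj_by_maximally_mixed: "unitary V \<Longrightarrow> conj_by V (cscale c maximally_mixed) = cscale c maximally_mixed"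
proof -
  assume V: "unitary V"
  have "cscale c maximally_mixed = cscale (c / of_nat CARD('a)) (mat 1 :: 'a cmat)"
    by (simp add: maximally_mixed_def cscale_def vec_eq_iff)
  then show "conj_by V (cscale c maximally_mixed) = cscale c maximally_mixed"
    using superoperatorD(3)[OF superoperator_conj_by[of V]] unitaryD[OF V] by simp
qed

lemma conj_by_kron: "conj_by (kron U V) (kron A B) = kron (conj_by U A) (conj_by V B)"
  by (simp add: dagger_kron kron_mult)

text \<open>
  With the averages \<open>E\<^sub>1\<close>, \<open>E\<^sub>2\<close> over the two local unitaries, this is the expansion
  \<open>(1 - E\<^sub>1)(1 - E\<^sub>2) + (1 - E\<^sub>1) E\<^sub>2 + E\<^sub>1 (1 - E\<^sub>2) + E\<^sub>1 E\<^sub>2\<close> of the identity.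
\<close>

lemma centre_pair_telescope:
  "Y = centre_pair Y + kron (centre (trace_out_snd Y)) maximally_mixed +
    kron maximally_mixed (centre (trace_out_fst Y)) + cscale (trace Y) maximally_mixed"
proof -
  have 1: "kron (centre (trace_out_snd Y)) maximally_mixed =
      kron (trace_out_snd Y) maximally_mixed - cscale (trace Y) maximally_mixed"
    by (rule cmat_pair_eqI)
      (simp add: centre_def maximally_mixed_nth cscale_def left_diff_distrib trace_trace_out_snd card_prod)
  have 2: "kron maximally_mixed (centre (trace_out_fst Y)) =
      kron maximally_mixed (trace_out_fst Y) - cscale (trace Y) maximally_mixed"
    by (rule cmat_pair_eqI)
      (simp add: centre_def maximally_mixed_nth cscale_def right_diff_distrib trace_trace_out_fst card_prod)
  show ?thesis unfolding centre_pair_def 1 2 by simp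
qed

text \<open>Averaging over one unitary passes to a marginal of \<tau> as well as of \<rho>, and the
  fully averaged term cancels against the subtracted product.\<close>

lemma choi_apply_telescope:
  fixes \<tau> :: "(('m::finite \<times> 'n::finite) \<times> 'b::finite) cmat" and \<rho> :: "(('m \<times> 'n) \<times> 'r::finite) cmat"
  assumes U: "unitary U" and V: "unitary V"
  shows "choi_apply \<tau> (tensor_id (conj_by (kron U V)) \<rho>) - kron (trace_out_fst \<tau>) (trace_out_fst \<rho>) =
    choi_apply \<tau> (tensor_id (\<lambda>Y. conj_by (kron U V) (centre_pair Y)) \<rho>) +
    choi_apply (marginal1 \<tau>) (tensor_id (\<lambda>Y. conj_by U (centre Y)) (marginal1 \<rho>)) +
    choi_apply (marginal2 \<tau>) (tensor_id (\<lambda>Y. conj_by V (centre Y)) (marginal2 \<rho>))"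
proof -
  have UV: "unitary (kron U V)" by (rule unitary_kron[OF U V])
  have mixed: "conj_by U maximally_mixed = maximally_mixed" "conj_by V maximally_mixed = maximally_mixed"
    using conj_by_maximally_mixed[OF U, of 1] conj_by_maximally_mixed[OF V, of 1]
    by (simp_all add: cscale_def vec_lambda_eta)
  have expand: "conj_by (kron U V) Y = conj_by (kron U V) (centre_pair Y) +
      kron (conj_by U (centre (trace_out_snd Y))) maximally_mixed +
      kron maximally_mixed (conj_by V (centre (trace_out_fst Y))) + cscale (trace Y) maximally_mixed" for Y
    by (subst centre_pair_telescope)
      (simp only: superoperatorD(1)[OF superoperator_conj_by] conj_by_kron mixed conj_by_maximally_mixed[OF UV])
  have "tensor_id (conj_by (kron U V)) \<rho> = tensor_id (\<lambda>Y. conj_by (kron U V) (centre_pair Y) +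
      kron (conj_by U (centre (trace_out_snd Y))) maximally_mixed +
      kron maximally_mixed (conj_by V (centre (trace_out_fst Y))) + cscale (trace Y) maximally_mixed) \<rho>"
    by (rule arg_cong[where f = "\<lambda>S. tensor_id S \<rho>"], rule ext, rule expand)
  also have "\<dots> = tensor_id (\<lambda>Y. conj_by (kron U V) (centre_pair Y)) \<rho> +
      tensor_id (\<lambda>Y. kron Y maximally_mixed) (tensor_id (\<lambda>Y. conj_by U (centre Y)) (marginal1 \<rho>)) +
      tensor_id (\<lambda>Y. kron maximally_mixed Y) (tensor_id (\<lambda>Y. conj_by V (centre Y)) (marginal2 \<rho>)) +
      kron maximally_mixed (trace_out_fst \<rho>)"
    unfolding tensor_id_add tensor_id_trace_mixed tensor_id_compose
      tensor_id_trace_out_snd[of "\<lambda>Z. kron (conj_by U (centre Z)) maximally_mixed"]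
      tensor_id_trace_out_fst[of "\<lambda>Z. kron maximally_mixed (conj_by V (centre Z))"] ..
  finally show ?thesis
    by (simp add: choi_apply_add_right choi_apply_kron_mixed_right choi_apply_kron_mixed_left choi_apply_maximally_mixed)
qed

lemma dagger_tensor_id:
  assumes "\<And>Y. G (dagger Y) = dagger (G Y)"
  shows "dagger (tensor_id G X) = tensor_id G (dagger X)"
proof (rule cmat_pair_eqI)
  fix i r j r'
  have "block_snd (dagger X) r r' = dagger (block_snd X r' r)"
    by (simp add: vec_eq_iff dagger_nth)
  then show "dagger (tensor_id G X) $ (i, r) $ (j, r') = tensor_id G (dagger X) $ (i, r) $ (j, r')"
    by (simp add: dagger_nth tensor_id_nth assms)
qed

lemma trace_dagger: "trace (dagger Y) = cnj (trace Y)"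
  by (simp add: trace_def dagger_nth)

lemma dagger_centre: "centre (dagger Y) = dagger (centre Y)"
  by (simp add: vec_eq_iff centre_def dagger_nth cscale_def maximally_mixed_nth trace_dagger)

lemma dagger_centre_pair: "centre_pair (dagger Y) = dagger (centre_pair Y)"
  by (rule cmat_pair_eqI)
    (simp add: centre_pair_def dagger_nth cscale_def maximally_mixed_nth trace_dagger trace_out_fst_def trace_out_snd_def)

text \<open>Supplies the hermiticity that \<open>schatten_1_triangle\<close> asks for.\<close>

lemma hermitian_choi_apply_conj_by:
  assumes "psd \<tau>" "psd \<rho>" and "\<And>Y. G (dagger Y) = dagger (G Y)"
  shows "dagger (choi_apply \<tau> (tensor_id (\<lambda>Y. conj_by V (G Y)) \<rho>)) = choi_apply \<tau> (tensor_id (\<lambda>Y. conj_by V (G Y)) \<rho>)"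
  using assms by (simp add: dagger_choi_apply dagger_tensor_id dagger_conj psd_hermitian)

section \<open>From entropies to norms\<close>

text \<open>A strict bound on an infimum yields a feasible point without any statement about
  attainment.\<close>

lemma smooth_renyi2_div_lessD:
  fixes \<alpha> :: "('a::finite \<times> 'c::finite) cmat"
  assumes "smooth_renyi2_div \<epsilon> \<alpha> (kron (mat 1) (trace_out_fst \<alpha>)) < ereal z"
  shows "\<exists>\<alpha>'. smoothing \<epsilon> \<alpha> \<alpha>' \<and> norm (weighted (kron (mat 1) (trace_out_fst \<alpha>)) \<alpha>') \<le> 2 powr (z / 2)"
proof -
  let ?\<beta> = "kron (mat 1 :: 'a cmat) (trace_out_fst \<alpha>)"
  obtain \<alpha>' where \<alpha>': "subnormalised \<alpha>'" "schatten 1 (\<alpha>' - \<alpha>) \<le> \<epsilon> * Re (trace \<alpha>)" "renyi2_div \<alpha>' ?\<beta> < ereal z"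
    using assms unfolding smooth_renyi2_div_def INF_less_iff by auto
  then have "supp \<alpha>' \<subseteq> supp ?\<beta>" by (auto simp: renyi2_div_def split: if_splits)
  with \<alpha>' have "smoothing \<epsilon> \<alpha> \<alpha>'" by (simp add: smoothing_def)
  moreover have "2 * elog2 (norm (weighted ?\<beta> \<alpha>')) < ereal z"
    using \<alpha>'(3) \<open>supp \<alpha>' \<subseteq> supp ?\<beta>\<close> by (simp add: renyi2_div_def weighted_def schatten_2)
  then have "norm (weighted ?\<beta> \<alpha>') \<le> 2 powr (z / 2)"
  proof (cases "norm (weighted ?\<beta> \<alpha>') \<le> 0")
    case True
    then show ?thesis by (rule order_trans) simp
  next
    case False
    assume "2 * elog2 (norm (weighted ?\<beta> \<alpha>')) < ereal z"
    with False have "ereal 2 * ereal (log 2 (norm (weighted ?\<beta> \<alpha>'))) < ereal z"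
      by (simp add: elog2_def)
    then have "log 2 (norm (weighted ?\<beta> \<alpha>')) \<le> z / 2" by simp
    then show ?thesis by (subst (asm) log_le_iff) (use False in auto)
  qed
  ultimately show ?thesis by blast
qed

lemma eexp2_nonneg: "0 \<le> eexp2 x"
  by (cases x) (simp_all add: eexp2_def)

text \<open>The slack \<delta> leaves room for strict real bounds \<open>a\<close> and
  \<open>b\<close> on the two divergences whose mean is at most the logarithm of
  \<open>R + \<delta>\<close>.\<close>

lemma eexp2_real_imp_smoothings:
  fixes \<alpha> :: "('a::finite \<times> 'c::finite) cmat" and \<beta> :: "('b::finite \<times> 'd::finite) cmat"
  assumes R: "eexp2 (- ereal (1/2) * smooth_H2 \<epsilon> \<alpha> - ereal (1/2) * smooth_H2 \<epsilon> \<beta>) = ereal R" and \<delta>: "0 < \<delta>"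
  shows "\<exists>\<alpha>' \<beta>'. smoothing \<epsilon> \<alpha> \<alpha>' \<and> smoothing \<epsilon> \<beta> \<beta>' \<and>
    norm (weighted (kron (mat 1) (trace_out_fst \<alpha>)) \<alpha>') * norm (weighted (kron (mat 1) (trace_out_fst \<beta>)) \<beta>') \<le> R + \<delta>"
proof -
  define x where "x = smooth_renyi2_div \<epsilon> \<alpha> (kron (mat 1) (trace_out_fst \<alpha>))"
  define y where "y = smooth_renyi2_div \<epsilon> \<beta> (kron (mat 1) (trace_out_fst \<beta>))"
  have R': "eexp2 (- ereal (1/2) * - x - ereal (1/2) * - y) = ereal R"
    using R by (simp only: smooth_H2_def x_def y_def)
  have R0: "0 \<le> R" using eexp2_nonneg[of "- ereal (1/2) * - x - ereal (1/2) * - y"] R' by simp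
  define t where "t = log 2 (R + \<delta>)"
  have t: "2 powr t = R + \<delta>" using R0 \<delta> by (simp add: t_def)
  have "\<exists>a b. x < ereal a \<and> y < ereal b \<and> (a + b) / 2 \<le> t"
  proof (cases x)
    case (real r)
    show ?thesis
    proof (cases y)
      case (real s)
      have "R = 2 powr (r / 2 + s / 2)" using R' \<open>x = ereal r\<close> real by (simp add: eexp2_def)
      then have "2 powr (r / 2 + s / 2) < 2 powr t" using \<delta> t by simp
      then have "r / 2 + s / 2 < t" by simp
      \<comment> \<open>Both divergences are raised by the gap between their mean and
        \<open>t\<close>, which brings the mean exactly to \<open>t\<close>.\<close>
      then show ?thesis using \<open>x = ereal r\<close> real
        by (intro exI[of _ "r + (t - (r / 2 + s / 2))"] exI[of _ "s + (t - (r / 2 + s / 2))"])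
          (simp add: field_simps)
    next
      case PInf
      then show ?thesis using R' real by (simp add: eexp2_def)
    next
      case MInf
      \<comment> \<open>A divergence of minus infinity admits every real bound, so \<open>b\<close>
        compensates for whatever \<open>a\<close> takes of \<open>2 * t\<close>.\<close>
      then show ?thesis using real by (intro exI[of _ "r + 1"] exI[of _ "2 * t - (r + 1)"]) simp
    qed
  next
    \<comment> \<open>In \<open>ereal\<close> the sum of infinity and minus infinity is infinity, so
      one infinite divergence contradicts the finite value \<open>R\<close> even when the other is
      minus infinity.\<close>
    case PInf
    then show ?thesis using R' by (cases y) (simp_all add: eexp2_def)
  next
    case MInf
    show ?thesis
    proof (cases y)
      case (real s)
      then show ?thesis using MInf by (intro exI[of _ "2 * t - (s + 1)"] exI[of _ "s + 1"]) simp
    next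
      case PInf
      then show ?thesis using R' MInf by (simp add: eexp2_def)
    next
      case MInf
      then show ?thesis using \<open>x = - \<infinity>\<close> by (intro exI[of _ t]) simp
    qed
  qed
  then obtain a b where ab: "x < ereal a" "y < ereal b" "(a + b) / 2 \<le> t" by blast
  obtain \<alpha>' where \<alpha>': "smoothing \<epsilon> \<alpha> \<alpha>'" "norm (weighted (kron (mat 1) (trace_out_fst \<alpha>)) \<alpha>') \<le> 2 powr (a / 2)"
    using smooth_renyi2_div_lessD ab(1) unfolding x_def by blast
  obtain \<beta>' where \<beta>': "smoothing \<epsilon> \<beta> \<beta>'" "norm (weighted (kron (mat 1) (trace_out_fst \<beta>)) \<beta>') \<le> 2 powr (b / 2)"
    using smooth_renyi2_div_lessD ab(2) unfolding y_def by blast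
  have "norm (weighted (kron (mat 1) (trace_out_fst \<alpha>)) \<alpha>') * norm (weighted (kron (mat 1) (trace_out_fst \<beta>)) \<beta>') \<le>
      2 powr (a / 2) * 2 powr (b / 2)"
    by (intro mult_mono \<alpha>' \<beta>') simp_all
  also have "\<dots> = 2 powr ((a + b) / 2)" by (simp add: powr_add[symmetric] add_divide_distrib)
  also have "\<dots> \<le> 2 powr t" using ab(3) by simp
  finally show ?thesis using \<alpha>'(1) \<beta>'(1) t by auto
qed

section \<open>Integrals of functions of one variable over a product space\<close>

lemma prob_pair_integral_fst:
  fixes f :: "'a \<Rightarrow> real"
  assumes N: "prob_space N" and f: "integrable M f"
  shows "integrable (M \<Otimes>\<^sub>M N) (\<lambda>\<omega>. f (fst \<omega>))" "(\<integral>\<omega>. f (fst \<omega>) \<partial>(M \<Otimes>\<^sub>M N)) = (\<integral>x. f x \<partial>M)"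
proof -
  have d: "distr (M \<Otimes>\<^sub>M N) M fst = M" by (rule prob_space.distr_pair_fst[OF N])
  show "integrable (M \<Otimes>\<^sub>M N) (\<lambda>\<omega>. f (fst \<omega>))"
    by (rule integrable_distr[OF measurable_fst]) (simp add: d f)
  show "(\<integral>\<omega>. f (fst \<omega>) \<partial>(M \<Otimes>\<^sub>M N)) = (\<integral>x. f x \<partial>M)"
    using integral_distr[OF measurable_fst, of f M N] f by (simp add: d)
qed

lemma prob_pair_integral_snd:
  fixes f :: "'b \<Rightarrow> real"
  assumes M: "prob_space M" and N: "prob_space N" and f: "integrable N f"
  shows "integrable (M \<Otimes>\<^sub>M N) (\<lambda>\<omega>. f (snd \<omega>))" "(\<integral>\<omega>. f (snd \<omega>) \<partial>(M \<Otimes>\<^sub>M N)) = (\<integral>x. f x \<partial>N)"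
proof -
  interpret M: prob_space M by (rule M)
  interpret N: prob_space N by (rule N)
  interpret Q: pair_prob_space N M ..
  note * = prob_pair_integral_fst[OF M f]
  show "integrable (M \<Otimes>\<^sub>M N) (\<lambda>\<omega>. f (snd \<omega>))"
    using Q.integrable_product_swap[OF *(1)] by (simp add: case_prod_unfold)
  show "(\<integral>\<omega>. f (snd \<omega>) \<partial>(M \<Otimes>\<^sub>M N)) = (\<integral>x. f x \<partial>N)"
    using Q.integral_product_swap[OF borel_measurable_integrable[OF *(1)]] *(2) by (simp add: case_prod_unfold)
qed

section \<open>Trace bounds for the channel and combination of the three terms\<close>

lemma trace_choi_apply_choi_state_le:
  fixes T :: "('a1::finite \<times> 'a2::finite) cmat \<Rightarrow> 'b::finite cmat"
  assumes "superoperator T" "trace_nonincreasing T" "psd P"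
  shows "Re (trace (choi_apply (choi_state T) P)) \<le> Re (trace P)"
proof -
  have "Re (trace (choi_apply (choi_state T) P)) = Re (trace (T (trace_out_snd P)))"
    by (simp add: tensor_id_eq_choi_apply[OF assms(1), symmetric] trace_tensor_id[OF assms(1)])
  also have "\<dots> \<le> Re (trace (trace_out_snd P))"
    using assms(2) psd_trace_out_snd[OF assms(3)] by (simp add: trace_nonincreasing_def)
  finally show ?thesis by (simp only: trace_trace_out_snd)
qed

text \<open>The trace bound on the maximally mixed input, with the trivial reference
  \<open>unit\<close>, is a bound on the trace of the Choi state.\<close>

lemma subnormalised_choi_state:
  fixes T :: "('a1::finite \<times> 'a2::finite) cmat \<Rightarrow> 'b::finite cmat"
  assumes "superoperator T" "completely_positive T" "trace_nonincreasing T"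
  shows "subnormalised (choi_state T)"
proof -
  have "Re (trace (choi_apply (choi_state T) (kron maximally_mixed (maximally_mixed :: unit cmat)))) \<le>
      Re (trace (kron (maximally_mixed :: ('a1 \<times> 'a2) cmat) (maximally_mixed :: unit cmat)))"
    by (intro trace_choi_apply_choi_state_le assms psd_kron psd_maximally_mixed)
  then have "Re (trace (choi_state T)) \<le> 1"
    by (simp add: choi_apply_maximally_mixed trace_kron trace_trace_out_fst)
  then show ?thesis using psd_choi_state[OF assms(2)] by (simp add: subnormalised_def)
qed

text \<open>The smoothed states of the three terms are unrelated to one another. The three
  majorants, lifted to the product space, add up to a pointwise bound on the trace norm.\<close>

lemma expectation_decoupling_le:
  fixes \<tau> :: "(('m::finite \<times> 'n::finite) \<times> 'b::finite) cmat" and \<rho> :: "(('m \<times> 'n) \<times> 'r::finite) cmat"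
  assumes \<mu>: "haar_unitary \<mu>" and \<nu>: "haar_unitary \<nu>"
    and m: "2 \<le> CARD('m)" and n: "2 \<le> CARD('n)" and \<epsilon>: "0 \<le> \<epsilon>"
    and \<tau>: "subnormalised \<tau>" and \<rho>: "subnormalised \<rho>"
    and tni: "\<And>P :: (('m \<times> 'n) \<times> 'r) cmat. psd P \<Longrightarrow> Re (trace (choi_apply \<tau> P)) \<le> Re (trace P)"
    and s1: "smoothing \<epsilon> (marginal1 \<tau>) \<tau>1" "smoothing \<epsilon> (marginal1 \<rho>) \<rho>1"
    and s2: "smoothing \<epsilon> (marginal2 \<tau>) \<tau>2" "smoothing \<epsilon> (marginal2 \<rho>) \<rho>2"
    and s12: "smoothing \<epsilon> \<tau> \<tau>12" "smoothing \<epsilon> \<rho> \<rho>12"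
  defines "K1 \<equiv> (1 - real CARD('m) powr (-2)) powr (-1/2)" and "K2 \<equiv> (1 - real CARD('n) powr (-2)) powr (-1/2)"
  shows "(\<integral>(U1, U2). schatten 1 (choi_apply \<tau> (tensor_id (conj_by (kron U1 U2)) \<rho>) -
      kron (trace_out_fst \<tau>) (trace_out_fst \<rho>)) \<partial>(\<mu> \<Otimes>\<^sub>M \<nu>)) \<le> 16 * \<epsilon> +
    K1 * (norm (weighted (kron (mat 1) (trace_out_fst (marginal1 \<rho>))) \<rho>1) *
      norm (weighted (kron (mat 1) (trace_out_fst (marginal1 \<tau>))) \<tau>1)) +
    K2 * (norm (weighted (kron (mat 1) (trace_out_fst (marginal2 \<rho>))) \<rho>2) *
      norm (weighted (kron (mat 1) (trace_out_fst (marginal2 \<tau>))) \<tau>2)) +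
    K1 * K2 * (norm (weighted (kron (mat 1) (trace_out_fst \<rho>)) \<rho>12) *
      norm (weighted (kron (mat 1) (trace_out_fst \<tau>)) \<tau>12))"
proof -
  interpret M1: random_unitary \<mu> "\<lambda>U. U" by (rule haar_random_unitary[OF \<mu>])
  interpret M2: random_unitary \<nu> "\<lambda>U. U" by (rule haar_random_unitary[OF \<nu>])
  have psd: "psd \<tau>" "psd \<rho>" using \<tau> \<rho> by (auto simp: subnormalised_def)
  \<comment> \<open>Tensoring an input with a maximally mixed state transfers the trace bound from
    \<tau> to its marginal.\<close>
  have tni1: "Re (trace (choi_apply (marginal1 \<tau>) P)) \<le> Re (trace P)" if "psd P" for P :: "('m \<times> 'r) cmat"
    using tni[OF psd_tensor_id_kron(1)[OF that psd_maximally_mixed]]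
    by (simp add: choi_apply_kron_mixed_right trace_tensor_id_kron)
  have tni2: "Re (trace (choi_apply (marginal2 \<tau>) P)) \<le> Re (trace P)" if "psd P" for P :: "('n \<times> 'r) cmat"
    using tni[OF psd_tensor_id_kron(2)[OF that psd_maximally_mixed]]
    by (simp add: choi_apply_kron_mixed_left trace_tensor_id_kron)
  obtain h1 where h1: "integrable \<mu> h1"
    "\<And>U. U \<in> space \<mu> \<Longrightarrow> schatten 1 (choi_apply (marginal1 \<tau>) (tensor_id (\<lambda>Y. conj_by U (centre Y)) (marginal1 \<rho>))) \<le> h1 U"
    "(\<integral>U. h1 U \<partial>\<mu>) \<le> 4 * \<epsilon> + K1 * norm (weighted (kron (mat 1) (trace_out_fst (marginal1 \<tau>))) \<tau>1) *
      norm (weighted (kron (mat 1) (trace_out_fst (marginal1 \<rho>))) \<rho>1)"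
    using centre_decoupling_term[OF \<mu> m \<epsilon> subnormalised_marginal(1)[OF \<tau>] subnormalised_marginal(1)[OF \<rho>] tni1 s1]
    unfolding K1_def by blast
  obtain h2 where h2: "integrable \<nu> h2"
    "\<And>U. U \<in> space \<nu> \<Longrightarrow> schatten 1 (choi_apply (marginal2 \<tau>) (tensor_id (\<lambda>Y. conj_by U (centre Y)) (marginal2 \<rho>))) \<le> h2 U"
    "(\<integral>U. h2 U \<partial>\<nu>) \<le> 4 * \<epsilon> + K2 * norm (weighted (kron (mat 1) (trace_out_fst (marginal2 \<tau>))) \<tau>2) *
      norm (weighted (kron (mat 1) (trace_out_fst (marginal2 \<rho>))) \<rho>2)"
    using centre_decoupling_term[OF \<nu> n \<epsilon> subnormalised_marginal(2)[OF \<tau>] subnormalised_marginal(2)[OF \<rho>] tni2 s2]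
    unfolding K2_def by blast
  obtain h where h: "integrable (\<mu> \<Otimes>\<^sub>M \<nu>) h"
    "\<And>\<omega>. \<omega> \<in> space (\<mu> \<Otimes>\<^sub>M \<nu>) \<Longrightarrow>
      schatten 1 (choi_apply \<tau> (tensor_id (\<lambda>Y. conj_by (case \<omega> of (U1, U2) \<Rightarrow> kron U1 U2) (centre_pair Y)) \<rho>)) \<le> h \<omega>"
    "(\<integral>\<omega>. h \<omega> \<partial>(\<mu> \<Otimes>\<^sub>M \<nu>)) \<le> 8 * \<epsilon> + (K1 * K2) * norm (weighted (kron (mat 1) (trace_out_fst \<tau>)) \<tau>12) *
      norm (weighted (kron (mat 1) (trace_out_fst \<rho>)) \<rho>12)"
    using centre_pair_decoupling_term[OF \<mu> \<nu> m n \<epsilon> \<tau> \<rho> tni s12] unfolding K1_def K2_def by blast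
  note i1 = prob_pair_integral_fst[OF M2.prob_space_axioms h1(1)]
  note i2 = prob_pair_integral_snd[OF M1.prob_space_axioms M2.prob_space_axioms h2(1)]
  have int: "integrable (\<mu> \<Otimes>\<^sub>M \<nu>) (\<lambda>\<omega>. h \<omega> + h1 (fst \<omega>) + h2 (snd \<omega>))"
    by (intro Bochner_Integration.integrable_add h(1) i1(1) i2(1))
  have le: "schatten 1 (choi_apply \<tau> (tensor_id (conj_by (kron U1 U2)) \<rho>) -
      kron (trace_out_fst \<tau>) (trace_out_fst \<rho>)) \<le> h (U1, U2) + h1 U1 + h2 U2"
    if \<omega>: "(U1, U2) \<in> space (\<mu> \<Otimes>\<^sub>M \<nu>)" for U1 U2
  proof -
    have sp: "U1 \<in> space \<mu>" "U2 \<in> space \<nu>" using \<omega> by (auto simp: space_pair_measure)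
    let ?X = "choi_apply \<tau> (tensor_id (\<lambda>Y. conj_by (kron U1 U2) (centre_pair Y)) \<rho>)"
    let ?X1 = "choi_apply (marginal1 \<tau>) (tensor_id (\<lambda>Y. conj_by U1 (centre Y)) (marginal1 \<rho>))"
    let ?X2 = "choi_apply (marginal2 \<tau>) (tensor_id (\<lambda>Y. conj_by U2 (centre Y)) (marginal2 \<rho>))"
    have d: "dagger ?X = ?X" "dagger ?X1 = ?X1" "dagger ?X2 = ?X2"
      by (intro hermitian_choi_apply_conj_by psd psd_marginal1 psd_marginal2 dagger_centre dagger_centre_pair)+
    have "schatten 1 (?X + ?X1 + ?X2) \<le> schatten 1 (?X + ?X1) + schatten 1 ?X2"
      by (rule schatten_1_triangle) (simp_all only: dagger_add d)
    also have "schatten 1 (?X + ?X1) \<le> schatten 1 ?X + schatten 1 ?X1"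
      by (rule schatten_1_triangle) (simp_all only: d)
    finally have "schatten 1 (?X + ?X1 + ?X2) \<le> schatten 1 ?X + schatten 1 ?X1 + schatten 1 ?X2" by simp
    also have "\<dots> \<le> h (U1, U2) + h1 U1 + h2 U2"
      using h(2)[OF \<omega>] h1(2)[OF sp(1)] h2(2)[OF sp(2)] by simp
    finally show ?thesis
      unfolding choi_apply_telescope[OF M1.unitary_V[OF sp(1)] M2.unitary_V[OF sp(2)]] .
  qed
  have nonneg: "0 \<le> schatten 1 X" for X :: "('b \<times> 'r) cmat" by (simp add: schatten_def)
  have "(\<integral>(U1, U2). schatten 1 (choi_apply \<tau> (tensor_id (conj_by (kron U1 U2)) \<rho>) -
      kron (trace_out_fst \<tau>) (trace_out_fst \<rho>)) \<partial>(\<mu> \<Otimes>\<^sub>M \<nu>)) \<le>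
    (\<integral>\<omega>. h \<omega> + h1 (fst \<omega>) + h2 (snd \<omega>) \<partial>(\<mu> \<Otimes>\<^sub>M \<nu>))"
  \<comment> \<open>Only the majorant has to be integrable: if the trace norm were not, its Bochner
    integral would be 0 by convention, which a nonnegative majorant covers.\<close>
  proof (rule integral_mono'[OF int])
    fix \<omega> assume \<omega>: "\<omega> \<in> space (\<mu> \<Otimes>\<^sub>M \<nu>)"
    obtain U1 U2 where [simp]: "\<omega> = (U1, U2)" by (cases \<omega>)
    show "(case \<omega> of (U1, U2) \<Rightarrow> schatten 1 (choi_apply \<tau> (tensor_id (conj_by (kron U1 U2)) \<rho>) -
      kron (trace_out_fst \<tau>) (trace_out_fst \<rho>))) \<le> h \<omega> + h1 (fst \<omega>) + h2 (snd \<omega>)"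
      using le \<omega> by simp
    show "0 \<le> h \<omega> + h1 (fst \<omega>) + h2 (snd \<omega>)"
      using order_trans[OF nonneg le] \<omega> by simp
  qed
  also have "\<dots> = (\<integral>\<omega>. h \<omega> \<partial>(\<mu> \<Otimes>\<^sub>M \<nu>)) + (\<integral>U. h1 U \<partial>\<mu>) + (\<integral>U. h2 U \<partial>\<nu>)"
    by (simp add: h(1) i1 i2)
  finally show ?thesis using h(3) h1(3) h2(3) by (simp add: mult_ac)
qed

theorem proposition3:
  fixes T :: "('a1::finite \<times> 'a2::finite) cmat \<Rightarrow> 'b::finite cmat"
    and \<rho> :: "(('a1 \<times> 'a2) \<times> 'r::finite) cmat"
    and \<tau> :: "(('a1 \<times> 'a2) \<times> 'b) cmat"
    and \<sigma> :: "'a1 cmat \<Rightarrow> 'a2 cmat \<Rightarrow> ('b \<times> 'r) cmat"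
    and \<mu>1 :: "'a1 cmat measure"
    and \<mu>2 :: "'a2 cmat measure"
    and D1 D2 D12 \<epsilon> :: real
  assumes "CARD('a1) \<ge> 2" and "CARD('a2) \<ge> 2"
    and "superoperator T" and "completely_positive T" and "trace_nonincreasing T"
    and "\<tau> = choi_state T"
    and "subnormalised \<rho>"
    and "\<And>U1 U2. \<sigma> U1 U2 = tensor_id T
           (kron (kron U1 U2) (mat 1) ** \<rho> ** dagger (kron (kron U1 U2) (mat 1)))"
    and "D1 = (1 - real CARD('a1) powr (-2)) powr (-1/2)"
    and "D2 = (1 - real CARD('a2) powr (-2)) powr (-1/2)"
    and "D12 = 2 * (1 - real CARD('a1) powr (-2)) powr (-1/2)
                 * (1 - real CARD('a2) powr (-2)) powr (-1/2)"
    and "0 < \<epsilon>" and "\<epsilon> < 1"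
    and "haar_unitary \<mu>1" and "haar_unitary \<mu>2"
  shows "ereal (\<integral>(U1, U2). schatten 1 (\<sigma> U1 U2 - kron (trace_out_fst \<tau>) (trace_out_fst \<rho>))
             \<partial>(\<mu>1 \<Otimes>\<^sub>M \<mu>2))
    \<le> ereal (16 * \<epsilon>)
      + ereal (2 * D1) * eexp2 (- ereal (1/2) * smooth_H2 \<epsilon> (marginal1 \<rho>)
                                - ereal (1/2) * smooth_H2 \<epsilon> (marginal1 \<tau>))
      + ereal (2 * D2) * eexp2 (- ereal (1/2) * smooth_H2 \<epsilon> (marginal2 \<rho>)
                                - ereal (1/2) * smooth_H2 \<epsilon> (marginal2 \<tau>))
      + ereal (4 * D12) * eexp2 (- ereal (1/2) * smooth_H2 \<epsilon> \<rho>
                                 - ereal (1/2) * smooth_H2 \<epsilon> \<tau>)"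
    (is "ereal ?I \<le> _ + _ * ?e1 + _ * ?e2 + _ * ?e12")
proof -
  have D: "0 < D1" "0 < D2" "D12 = 2 * D1 * D2"
    using dimension_factor_square(2)[OF assms(1)] dimension_factor_square(2)[OF assms(2)]
    unfolding assms(9,10,11) by (simp_all only: powr_gt_zero)
  have \<tau>: "subnormalised \<tau>"
    unfolding assms(6) by (rule subnormalised_choi_state[OF assms(3,4,5)])
  have \<sigma>: "\<sigma> U1 U2 = choi_apply \<tau> (tensor_id (conj_by (kron U1 U2)) \<rho>)" for U1 U2
    unfolding assms(8) tensor_id_conj[symmetric] assms(6) by (rule tensor_id_eq_choi_apply[OF assms(3)])
  show ?thesis
  proof (cases "?e1 = \<infinity> \<or> ?e2 = \<infinity> \<or> ?e12 = \<infinity>")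
    \<comment> \<open>The coefficients are positive, so one infinite exponential makes the whole
      right-hand side infinite.\<close>
    case True
    then have "ereal (2 * D1) * ?e1 = \<infinity> \<or> ereal (2 * D2) * ?e2 = \<infinity> \<or> ereal (4 * D12) * ?e12 = \<infinity>"
      using D by auto
    then have "ereal (16 * \<epsilon>) + ereal (2 * D1) * ?e1 + ereal (2 * D2) * ?e2 + ereal (4 * D12) * ?e12 = \<infinity>"
      unfolding ereal_plus_eq_PInfty by blast
    then show ?thesis by (simp only: ereal_less_eq)
  next
    case False
    have real: "\<exists>R\<ge>0. e = ereal R" if "0 \<le> e" "e \<noteq> \<infinity>" for e :: ereal
      using that by (cases e) auto
    obtain R1 R2 R12 where R: "0 \<le> R1" "0 \<le> R2" "0 \<le> R12"
      and e: "?e1 = ereal R1" "?e2 = ereal R2" "?e12 = ereal R12"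
      using real[OF eexp2_nonneg] False by metis
    \<comment> \<open>The smoothed states depend on \<delta>, but the resulting inequality between
      numbers holds for every positive \<delta>, so a limit is possible.\<close>
    have bound: "?I \<le> 16 * \<epsilon> + D1 * R1 + D2 * R2 + D1 * D2 * R12 + (D1 + D2 + D1 * D2) * \<delta>" if \<delta>: "0 < \<delta>" for \<delta>
    proof -
      obtain \<rho>1 \<tau>1 where s1: "smoothing \<epsilon> (marginal1 \<rho>) \<rho>1" "smoothing \<epsilon> (marginal1 \<tau>) \<tau>1"
        and b1: "norm (weighted (kron (mat 1) (trace_out_fst (marginal1 \<rho>))) \<rho>1) *
          norm (weighted (kron (mat 1) (trace_out_fst (marginal1 \<tau>))) \<tau>1) \<le> R1 + \<delta>"
        using eexp2_real_imp_smoothings[OF e(1) \<delta>] by blast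
      obtain \<rho>2 \<tau>2 where s2: "smoothing \<epsilon> (marginal2 \<rho>) \<rho>2" "smoothing \<epsilon> (marginal2 \<tau>) \<tau>2"
        and b2: "norm (weighted (kron (mat 1) (trace_out_fst (marginal2 \<rho>))) \<rho>2) *
          norm (weighted (kron (mat 1) (trace_out_fst (marginal2 \<tau>))) \<tau>2) \<le> R2 + \<delta>"
        using eexp2_real_imp_smoothings[OF e(2) \<delta>] by blast
      obtain \<rho>12 \<tau>12 where s12: "smoothing \<epsilon> \<rho> \<rho>12" "smoothing \<epsilon> \<tau> \<tau>12"
        and b12: "norm (weighted (kron (mat 1) (trace_out_fst \<rho>)) \<rho>12) *
          norm (weighted (kron (mat 1) (trace_out_fst \<tau>)) \<tau>12) \<le> R12 + \<delta>"
        using eexp2_real_imp_smoothings[OF e(3) \<delta>] by blast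
      have tni: "Re (trace (choi_apply \<tau> P)) \<le> Re (trace P)" if "psd P" for P :: "(('a1 \<times> 'a2) \<times> 'r) cmat"
        unfolding assms(6) by (rule trace_choi_apply_choi_state_le[OF assms(3,5) that])
      note expectation_decoupling_le[OF assms(14,15,1,2) less_imp_le[OF assms(12)] \<tau> assms(7) tni
          s1(2,1) s2(2,1) s12(2,1), folded assms(9,10) \<sigma>]
      also have "16 * \<epsilon> + D1 * (norm (weighted (kron (mat 1) (trace_out_fst (marginal1 \<rho>))) \<rho>1) *
            norm (weighted (kron (mat 1) (trace_out_fst (marginal1 \<tau>))) \<tau>1)) +
          D2 * (norm (weighted (kron (mat 1) (trace_out_fst (marginal2 \<rho>))) \<rho>2) *
            norm (weighted (kron (mat 1) (trace_out_fst (marginal2 \<tau>))) \<tau>2)) +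
          D1 * D2 * (norm (weighted (kron (mat 1) (trace_out_fst \<rho>)) \<rho>12) *
            norm (weighted (kron (mat 1) (trace_out_fst \<tau>)) \<tau>12)) \<le>
          16 * \<epsilon> + D1 * (R1 + \<delta>) + D2 * (R2 + \<delta>) + D1 * D2 * (R12 + \<delta>)"
        using D by (intro add_mono mult_left_mono b1 b2 b12 order_refl) simp_all
      finally show ?thesis by (simp add: algebra_simps)
    qed
    have "?I \<le> 16 * \<epsilon> + D1 * R1 + D2 * R2 + D1 * D2 * R12"
    proof (rule field_le_epsilon)
      fix e :: real assume "0 < e"
      moreover have K: "0 < D1 + D2 + D1 * D2" using D by (simp add: add_pos_pos)
      ultimately show "?I \<le> 16 * \<epsilon> + D1 * R1 + D2 * R2 + D1 * D2 * R12 + e"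
        using bound[of "e / (D1 + D2 + D1 * D2)"] by simp
    qed
    \<comment> \<open>Since \<open>D12 = 2 * D1 * D2\<close>, the coefficient \<open>D1 * D2\<close>
      reached so far is half of \<open>D12\<close>; passing to the stated constants uses only
      nonnegativity.\<close>
    also have "\<dots> \<le> 16 * \<epsilon> + 2 * D1 * R1 + 2 * D2 * R2 + 4 * D12 * R12"
      using D R by (intro add_mono) (simp_all add: mult_right_mono)
    finally show ?thesis unfolding e by simp
  qed
qed

end
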